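(* Let $C^*(\mathbb{N})\subset B(\ell^2(\mathbb{N}))$ be the partial translation algebra arising from the inclusion of the natural numbers $\mathbb{N}=\{0,1,2,\dots\}$ in the integers. Then $C^*(\mathbb{N})$ is isomorphic to the Toeplitz algebra $\mathcal{T}$. Moreover, the inclusion $\mathbb{N}\subset\mathbb{Z}$ induces the Toeplitz extension: there is a surjective $*$-homomorphism $C^*(\mathbb{N})\to C^*_\rho(\mathbb{Z})$ which, for every $n\in\mathbb{Z}$, takes the operator of partial translation by $n$ on $\mathbb{N}$ to the operator of translation by $n$ on $\mathbb{Z}$, and whose kernel is the algebra $\mathcal{K}(\ell^2(\mathbb{N}))$ of compact operators; and there are isomorphisms $\mathcal{K}(\ell^2(\mathbb{N}))\cong\mathcal{K}(H_2)$, $C^*(\mathbb{N})\cong\mathcal{T}$ and $C^*_\rho(\mathbb{Z})\cong C(S^1)$ identifying the resulting extension $$0\to \mathcal{K}(\ell^2(\mathbb{N}))\to C^*(\mathbb{N})\to C^*_\rho(\mathbb{Z})\to 0$$ with the Toeplitz extension $$0\to\mathcal{K}(H_2)\to\mathcal{T}\to C(S^1)\to 0.$$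
   Context: For a subset $X\subseteq\mathbb{Z}$ and $n\in\mathbb{Z}$, the partial translation by $n$ on $X$ is the map $t_n$ with domain $\{x\in X: x+n\in X\}$ given by $t_n(x)=x+n$. It is regarded as the partial isometry of $\ell^2(X)$ sending $\delta_x$ to $\delta_{x+n}$ if $x+n\in X$ and to $0$ otherwise. The partial translation algebra $C^*(X)\subset B(\ell^2(X))$ arising from the inclusion $X\subset\mathbb{Z}$ is the $C^*$-algebra generated by all the operators $t_n$, $n\in\mathbb{Z}$. For $X=\mathbb{Z}$ this is the (right) reduced group $C^*$-algebra $C^*_\rho(\mathbb{Z})\subset B(\ell^2(\mathbb{Z}))$. $H_2\subset L^2(S^1)$ is the Hardy space, i.e. the closed span of $\{z^n:n\ge 0\}$. The Toeplitz algebra $\mathcal{T}\subset B(H_2)$ is the $C^*$-algebra generated by the Toeplitz operator $T_z$ (compression to $H_2$ of multiplication by $z$). The Toeplitz extension is $0\to\mathcal{K}(H_2)\to\mathcal{T}\to C(S^1)\to 0$, with quotient map sending $T_z$ to the function $z$; here $\mathcal{K}(H_2)$ denotes the compact operators on $H_2$. *)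

theory Defs
  imports "HOL-Analysis.Analysis" "HOL-Algebra.Congruence"
begin

section \<open>Complex Hilbert spaces with explicit carrier\<close>

text \<open>The inner product is linear in its first and conjugate linear in its second argument.\<close>

record 'v hilbert = "'v partial_object" +
  vzero :: 'v
  vadd :: "'v \<Rightarrow> 'v \<Rightarrow> 'v"
  vscale :: "complex \<Rightarrow> 'v \<Rightarrow> 'v"
  cinner :: "'v \<Rightarrow> 'v \<Rightarrow> complex"

definition vdiff :: "'v hilbert \<Rightarrow> 'v \<Rightarrow> 'v \<Rightarrow> 'v" where
  "vdiff H x y = vadd H x (vscale H (-1) y)"

definition hnorm :: "'v hilbert \<Rightarrow> 'v \<Rightarrow> real" where
  "hnorm H x = sqrt (Re (cinner H x x))"

text \<open>The library's metric spaces require nonnegativity and symmetry of the distance also outside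
  the carrier, hence the default value \<open>0\<close> there, here and in \<open>op_dist\<close> below.\<close>

definition hdist :: "'v hilbert \<Rightarrow> 'v \<Rightarrow> 'v \<Rightarrow> real" where
  "hdist H x y =
     (if x \<in> carrier H \<and> y \<in> carrier H then hnorm H (vdiff H x y) else 0)"

abbreviation htopology :: "'v hilbert \<Rightarrow> 'v topology" where
  "htopology H \<equiv> Metric_space.mtopology (carrier H) (hdist H)"

definition closed_subspace :: "'v hilbert \<Rightarrow> 'v set \<Rightarrow> bool" where
  "closed_subspace H V \<longleftrightarrow>
     V \<subseteq> carrier H \<and> vzero H \<in> V \<and>
     (\<forall>x\<in>V. \<forall>y\<in>V. vadd H x y \<in> V) \<and>
     (\<forall>c. \<forall>x\<in>V. vscale H c x \<in> V) \<and>
     closedin (htopology H) V"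

definition closed_span :: "'v hilbert \<Rightarrow> 'v set \<Rightarrow> 'v set" where
  "closed_span H S = closed_subspace H hull S"

definition orth_proj :: "'v hilbert \<Rightarrow> 'v set \<Rightarrow> 'v \<Rightarrow> 'v" where
  "orth_proj H V x = (THE v. v \<in> V \<and> (\<forall>w\<in>V. cinner H (vdiff H x v) w = 0))"

section \<open>Complex *-algebras with explicit carrier\<close>

text \<open>No unit is part of the signature, so that algebras of compact operators are covered.\<close>

record 'a star_algebra = "'a partial_object" +
  azero :: 'a
  aadd :: "'a \<Rightarrow> 'a \<Rightarrow> 'a"
  ascale :: "complex \<Rightarrow> 'a \<Rightarrow> 'a"
  amult :: "'a \<Rightarrow> 'a \<Rightarrow> 'a"
  astar :: "'a \<Rightarrow> 'a"

definition star_subalgebra :: "'a star_algebra \<Rightarrow> 'a set \<Rightarrow> bool" where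
  "star_subalgebra A B \<longleftrightarrow>
     B \<subseteq> carrier A \<and> azero A \<in> B \<and>
     (\<forall>x\<in>B. \<forall>y\<in>B. aadd A x y \<in> B) \<and>
     (\<forall>c. \<forall>x\<in>B. ascale A c x \<in> B) \<and>
     (\<forall>x\<in>B. \<forall>y\<in>B. amult A x y \<in> B) \<and>
     (\<forall>x\<in>B. astar A x \<in> B)"

definition star_hom :: "'a star_algebra \<Rightarrow> 'b star_algebra \<Rightarrow> ('a \<Rightarrow> 'b) set" where
  "star_hom A B = {f. f \<in> carrier A \<rightarrow> carrier B \<and>
     (\<forall>x\<in>carrier A. \<forall>y\<in>carrier A. f (aadd A x y) = aadd B (f x) (f y)) \<and>
     (\<forall>c. \<forall>x\<in>carrier A. f (ascale A c x) = ascale B c (f x)) \<and>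
     (\<forall>x\<in>carrier A. \<forall>y\<in>carrier A. f (amult A x y) = amult B (f x) (f y)) \<and>
     (\<forall>x\<in>carrier A. f (astar A x) = astar B (f x))}"

definition star_iso :: "'a star_algebra \<Rightarrow> 'b star_algebra \<Rightarrow> ('a \<Rightarrow> 'b) set" where
  "star_iso A B = {f \<in> star_hom A B. bij_betw f (carrier A) (carrier B)}"

definition star_kernel :: "'a star_algebra \<Rightarrow> 'b star_algebra \<Rightarrow> ('a \<Rightarrow> 'b) \<Rightarrow> 'a set" where
  "star_kernel A B f = {x \<in> carrier A. f x = azero B}"

text \<open>\<open>0 \<rightarrow> K \<rightarrow> A \<rightarrow> Q \<rightarrow> 0\<close> with maps \<open>i\<close> and \<open>p\<close>.\<close>

definition star_extension ::
  "'k star_algebra \<Rightarrow> ('k \<Rightarrow> 'a) \<Rightarrow> 'a star_algebra \<Rightarrow> ('a \<Rightarrow> 'q) \<Rightarrow> 'q star_algebra \<Rightarrow> bool" where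
  "star_extension K i A p Q \<longleftrightarrow>
     i \<in> star_hom K A \<and> inj_on i (carrier K) \<and>
     p \<in> star_hom A Q \<and> p ` carrier A = carrier Q \<and>
     i ` carrier K = star_kernel A Q p"

section \<open>Bounded and compact operators\<close>

text \<open>Operators on a Hilbert space are functions on its carrier, extensional in the sense of
  \<^const>\<open>extensional\<close>.\<close>

definition bounded_ops :: "'v hilbert \<Rightarrow> ('v \<Rightarrow> 'v) set" where
  "bounded_ops H = {T \<in> carrier H \<rightarrow>\<^sub>E carrier H.
     (\<forall>x\<in>carrier H. \<forall>y\<in>carrier H. T (vadd H x y) = vadd H (T x) (T y)) \<and>
     (\<forall>c. \<forall>x\<in>carrier H. T (vscale H c x) = vscale H c (T x)) \<and>
     (\<exists>C. \<forall>x\<in>carrier H. hnorm H (T x) \<le> C * hnorm H x)}"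

definition adjoint_op :: "'v hilbert \<Rightarrow> ('v \<Rightarrow> 'v) \<Rightarrow> 'v \<Rightarrow> 'v" where
  "adjoint_op H T = (THE S. S \<in> bounded_ops H \<and>
     (\<forall>x\<in>carrier H. \<forall>y\<in>carrier H. cinner H (T x) y = cinner H x (S y)))"

definition op_algebra :: "'v hilbert \<Rightarrow> ('v \<Rightarrow> 'v) star_algebra" where
  "op_algebra H = \<lparr>carrier = bounded_ops H,
     azero = (\<lambda>x\<in>carrier H. vzero H),
     aadd = (\<lambda>S T. \<lambda>x\<in>carrier H. vadd H (S x) (T x)),
     ascale = (\<lambda>c T. \<lambda>x\<in>carrier H. vscale H c (T x)),
     amult = (\<lambda>S T. compose (carrier H) S T),
     astar = adjoint_op H\<rparr>"

definition op_norm :: "'v hilbert \<Rightarrow> ('v \<Rightarrow> 'v) \<Rightarrow> real" where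
  "op_norm H T = (SUP x\<in>{x \<in> carrier H. hnorm H x \<le> 1}. hnorm H (T x))"

definition op_dist :: "'v hilbert \<Rightarrow> ('v \<Rightarrow> 'v) \<Rightarrow> ('v \<Rightarrow> 'v) \<Rightarrow> real" where
  "op_dist H S T =
     (if S \<in> bounded_ops H \<and> T \<in> bounded_ops H
      then op_norm H (\<lambda>x\<in>carrier H. vdiff H (S x) (T x)) else 0)"

abbreviation op_topology :: "'v hilbert \<Rightarrow> ('v \<Rightarrow> 'v) topology" where
  "op_topology H \<equiv> Metric_space.mtopology (bounded_ops H) (op_dist H)"

definition generated_cstar_algebra ::
  "'v hilbert \<Rightarrow> ('v \<Rightarrow> 'v) set \<Rightarrow> ('v \<Rightarrow> 'v) star_algebra" where
  "generated_cstar_algebra H S = (op_algebra H)\<lparr>carrier :=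
     (\<lambda>B. star_subalgebra (op_algebra H) B \<and> closedin (op_topology H) B) hull S\<rparr>"

definition compact_ops :: "'v hilbert \<Rightarrow> ('v \<Rightarrow> 'v) set" where
  "compact_ops H = {T \<in> bounded_ops H.
     compactin (htopology H) (htopology H closure_of (T ` {x \<in> carrier H. hnorm H x \<le> 1}))}"

definition compact_algebra :: "'v hilbert \<Rightarrow> ('v \<Rightarrow> 'v) star_algebra" where
  "compact_algebra H = (op_algebra H)\<lparr>carrier := compact_ops H\<rparr>"

section \<open>Partial translation algebras of subsets of the integers\<close>

text \<open>Elements of \<open>\<ell>\<^sup>2(X)\<close> are functions on the integers vanishing outside \<open>X\<close>.\<close>

definition ell2 :: "int set \<Rightarrow> (int \<Rightarrow> complex) hilbert" where
  "ell2 X = \<lparr>carrier = {\<xi>. (\<forall>x. x \<notin> X \<longrightarrow> \<xi> x = 0) \<and> (\<lambda>x. (cmod (\<xi> x))\<^sup>2) summable_on X},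
     vzero = (\<lambda>x. 0),
     vadd = (\<lambda>\<xi> \<eta> x. \<xi> x + \<eta> x),
     vscale = (\<lambda>c \<xi> x. c * \<xi> x),
     cinner = (\<lambda>\<xi> \<eta>. \<Sum>\<^sub>\<infinity>x\<in>X. \<xi> x * cnj (\<eta> x))\<rparr>"

definition ell2_delta :: "int \<Rightarrow> int \<Rightarrow> complex" where
  "ell2_delta x = (\<lambda>y. if y = x then 1 else 0)"

definition translation_op :: "int set \<Rightarrow> int \<Rightarrow> (int \<Rightarrow> complex) \<Rightarrow> (int \<Rightarrow> complex)" where
  "translation_op X n =
     (\<lambda>\<xi>\<in>carrier (ell2 X). \<lambda>y. if y \<in> X \<and> y - n \<in> X then \<xi> (y - n) else 0)"

lemma ell2_delta_in_carrier:
  assumes "x \<in> X"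
  shows "ell2_delta x \<in> carrier (ell2 X)"
proof -
  have "(\<lambda>y. (cmod (ell2_delta x y))\<^sup>2) summable_on {x}"
    by simp
  then have "(\<lambda>y. (cmod (ell2_delta x y))\<^sup>2) summable_on X"
    by (rule summable_on_cong_neutral[THEN iffD1, rotated -1])
       (use assms in \<open>auto simp: ell2_delta_def\<close>)
  then show ?thesis
    using assms by (auto simp: ell2_def ell2_delta_def)
qed

text \<open>The partial isometry given by the partial map \<open>x \<mapsto> x + n\<close> on \<open>X\<close>.\<close>

lemma translation_op_delta:
  assumes "x \<in> X"
  shows "translation_op X n (ell2_delta x) =
           (if x + n \<in> X then ell2_delta (x + n) else (\<lambda>y. 0))"
  using assms ell2_delta_in_carrier[OF assms]
  by (auto simp: translation_op_def ell2_delta_def fun_eq_iff)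

lemma translation_op_UNIV:
  assumes "\<xi> \<in> carrier (ell2 UNIV)"
  shows "translation_op UNIV n \<xi> = (\<lambda>y. \<xi> (y - n))"
  using assms by (simp add: translation_op_def)

definition partial_translation_algebra ::
  "int set \<Rightarrow> ((int \<Rightarrow> complex) \<Rightarrow> (int \<Rightarrow> complex)) star_algebra" where
  "partial_translation_algebra X = generated_cstar_algebra (ell2 X) (range (translation_op X))"

abbreviation reduced_group_algebra_int ::
  "((int \<Rightarrow> complex) \<Rightarrow> (int \<Rightarrow> complex)) star_algebra" where
  "reduced_group_algebra_int \<equiv> partial_translation_algebra UNIV"

section \<open>The Hardy space and the Toeplitz algebra\<close>

text \<open>Elements of \<open>L\<^sup>2(M)\<close> are classes of square integrable functions modulo equality almost
  everywhere; the operations are computed on chosen representatives.\<close>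

definition L2_fun :: "'a measure \<Rightarrow> ('a \<Rightarrow> complex) set" where
  "L2_fun M = {f \<in> borel_measurable M. integrable M (\<lambda>x. (cmod (f x))\<^sup>2)}"

definition L2_class :: "'a measure \<Rightarrow> ('a \<Rightarrow> complex) \<Rightarrow> ('a \<Rightarrow> complex) set" where
  "L2_class M f = {g \<in> L2_fun M. AE x in M. g x = f x}"

definition L2_rep :: "('a \<Rightarrow> complex) set \<Rightarrow> 'a \<Rightarrow> complex" where
  "L2_rep u = (SOME f. f \<in> u)"

definition L2_space :: "'a measure \<Rightarrow> ('a \<Rightarrow> complex) set hilbert" where
  "L2_space M = \<lparr>carrier = L2_class M ` L2_fun M,
     vzero = L2_class M (\<lambda>x. 0),
     vadd = (\<lambda>u v. L2_class M (\<lambda>x. L2_rep u x + L2_rep v x)),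
     vscale = (\<lambda>c u. L2_class M (\<lambda>x. c * L2_rep u x)),
     cinner = (\<lambda>u v. \<integral>x. L2_rep u x * cnj (L2_rep v x) \<partial>M)\<rparr>"

abbreviation unit_circle :: "complex set" where
  "unit_circle \<equiv> sphere 0 1"

text \<open>Normalised arc length.\<close>

definition circle_measure :: "complex measure" where
  "circle_measure =
     distr (uniform_measure lborel {0..2*pi}) (restrict_space borel unit_circle) cis"

abbreviation L2_circle :: "(complex \<Rightarrow> complex) set hilbert" where
  "L2_circle \<equiv> L2_space circle_measure"

definition hardy_space :: "(complex \<Rightarrow> complex) set hilbert" where
  "hardy_space = L2_circle\<lparr>carrier :=
     closed_span L2_circle (range (\<lambda>n::nat. L2_class circle_measure (\<lambda>z. z ^ n)))\<rparr>"

definition mult_op ::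
  "(complex \<Rightarrow> complex) \<Rightarrow> (complex \<Rightarrow> complex) set \<Rightarrow> (complex \<Rightarrow> complex) set" where
  "mult_op f u = L2_class circle_measure (\<lambda>z. f z * L2_rep u z)"

definition toeplitz_op ::
  "(complex \<Rightarrow> complex) \<Rightarrow> (complex \<Rightarrow> complex) set \<Rightarrow> (complex \<Rightarrow> complex) set" where
  "toeplitz_op f =
     (\<lambda>u\<in>carrier hardy_space. orth_proj L2_circle (carrier hardy_space) (mult_op f u))"

definition toeplitz_algebra ::
  "((complex \<Rightarrow> complex) set \<Rightarrow> (complex \<Rightarrow> complex) set) star_algebra" where
  "toeplitz_algebra = generated_cstar_algebra hardy_space {toeplitz_op (\<lambda>z. z)}"

definition continuous_circle_algebra :: "(complex \<Rightarrow> complex) star_algebra" where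
  "continuous_circle_algebra =
     \<lparr>carrier = {f \<in> extensional unit_circle. continuous_on unit_circle f},
      azero = (\<lambda>z\<in>unit_circle. 0),
      aadd = (\<lambda>f g. \<lambda>z\<in>unit_circle. f z + g z),
      ascale = (\<lambda>c f. \<lambda>z\<in>unit_circle. c * f z),
      amult = (\<lambda>f g. \<lambda>z\<in>unit_circle. f z * g z),
      astar = (\<lambda>f. \<lambda>z\<in>unit_circle. cnj (f z))\<rparr>"

text \<open>The quotient map of the Toeplitz extension is determined by its value at
  \<open>T\<^sub>z\<close>, since *-homomorphisms of C*-algebras are continuous.\<close>

definition toeplitz_quotient_map ::
  "(((complex \<Rightarrow> complex) set \<Rightarrow> (complex \<Rightarrow> complex) set) \<Rightarrow> (complex \<Rightarrow> complex)) \<Rightarrow> bool" where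
  "toeplitz_quotient_map \<sigma> \<longleftrightarrow>
     star_extension (compact_algebra hardy_space) (\<lambda>k. k) toeplitz_algebra
       \<sigma> continuous_circle_algebra \<and>
     \<sigma> (toeplitz_op (\<lambda>z. z)) = (\<lambda>z\<in>unit_circle. z)"

end

theory Submission
  imports Defs
begin

text \<open>Let \<open>S = t\<^sub>1\<close> be the unilateral shift. The algebra generated by all triples
  (translation by \<open>n\<close> on \<open>\<nat>\<close>, translation by \<open>n\<close> on \<open>\<int>\<close>, the function \<open>z\<^sup>n\<close>) consists of triples
  \<open>(T, A, f)\<close> such that \<open>T\<close> and \<open>A\<close> agree on vectors supported far out, \<open>A\<close> commutes with
  translations, and \<open>A\<close> acts on trigonometric polynomials as multiplication by \<open>f\<close>. The first two
  properties give \<open>\<parallel>A\<parallel> \<le> \<parallel>T\<parallel>\<close>; Parseval's identity and approximate eigenvectors give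
  \<open>\<parallel>A\<parallel> = \<parallel>f\<parallel>\<^sub>\<infinity>\<close>. Hence the projections of this algebra extend by continuity to *-homomorphisms
  \<open>C\<^sup>*(\<nat>) \<rightarrow> C\<^sup>*\<^sub>\<rho>(\<int>) \<cong> C(S\<^sup>1)\<close>, the second one being onto by the Stone-Weierstrass theorem. Since
  \<open>T\<close> differs from the compression of \<open>A\<close> to \<open>\<ell>\<^sup>2(\<nat>)\<close> by an operator with finitely many columns, the
  kernel of the first one consists of compact operators; it contains all of them because the matrix
  units are \<open>S\<^sup>i (1 - S S\<^sup>*) S\<^sup>*\<^sup>j\<close>. Finally the unitary \<open>\<ell>\<^sup>2(\<nat>) \<rightarrow> H\<^sub>2\<close>, \<open>\<delta>\<^sub>n \<mapsto> z\<^sup>n\<close>, which exists by the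
  Riesz-Fischer theorem, carries \<open>S\<close> to \<open>T\<^sub>z\<close> and the whole extension to the Toeplitz extension.\<close>

text \<open>Many words in the translations represent the same operator, so no map can be defined on
  words. The maps therefore begin as relations, and an inequality between distances of related
  elements yields single-valuedness, continuity and the extension to closures in one stroke. The
  obstacle is to find properties that survive products: agreement far out would be lost under
  composition if operators could move supports arbitrarily, hence the locality invariant, whose
  radius grows additively. Surjectivity onto \<open>C\<^sup>*\<^sub>\<rho>(\<int>)\<close> does not
  rest on closedness of the range of a *-homomorphism: compression to
  \<open>\<ell>\<^sup>2(\<nat>)\<close> is an explicit contractive linear section, and the same
  section exhibits each element of the kernel as a limit of compact operators. Compactness enters as
  norm approximation by finite matrices, the form in which it meets the algebra generated by the
  shift.\<close>

section \<open>Inner product spaces\<close>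

text \<open>The vector space laws are consequences: a vector is determined by its inner products.\<close>

locale prehilbert =
  fixes H :: "'v hilbert"
  assumes zero_closed [simp]: "vzero H \<in> carrier H"
    and add_closed [simp]: "\<lbrakk>x \<in> carrier H; y \<in> carrier H\<rbrakk> \<Longrightarrow> vadd H x y \<in> carrier H"
    and scale_closed [simp]: "x \<in> carrier H \<Longrightarrow> vscale H c x \<in> carrier H"
    and cinner_add_left [simp]:
      "\<lbrakk>x \<in> carrier H; y \<in> carrier H; z \<in> carrier H\<rbrakk>
        \<Longrightarrow> cinner H (vadd H x y) z = cinner H x z + cinner H y z"
    and cinner_scale_left [simp]:
      "\<lbrakk>x \<in> carrier H; y \<in> carrier H\<rbrakk> \<Longrightarrow> cinner H (vscale H c x) y = c * cinner H x y"
    and cinner_zero_left [simp]: "x \<in> carrier H \<Longrightarrow> cinner H (vzero H) x = 0"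
    and cinner_commute: "\<lbrakk>x \<in> carrier H; y \<in> carrier H\<rbrakk> \<Longrightarrow> cinner H y x = cnj (cinner H x y)"
    and cinner_self_nonneg: "x \<in> carrier H \<Longrightarrow> 0 \<le> Re (cinner H x x)"
    and eq_if_cinner_vdiff_0:
      "\<lbrakk>x \<in> carrier H; y \<in> carrier H; cinner H (vdiff H x y) (vdiff H x y) = 0\<rbrakk> \<Longrightarrow> x = y"
begin

lemma vdiff_closed [simp]: "\<lbrakk>x \<in> carrier H; y \<in> carrier H\<rbrakk> \<Longrightarrow> vdiff H x y \<in> carrier H"
  by (simp add: vdiff_def)

lemma cinner_vdiff_left [simp]:
  "\<lbrakk>x \<in> carrier H; y \<in> carrier H; z \<in> carrier H\<rbrakk>
    \<Longrightarrow> cinner H (vdiff H x y) z = cinner H x z - cinner H y z"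
  by (simp add: vdiff_def)

lemma cinner_add_right [simp]:
  "\<lbrakk>x \<in> carrier H; y \<in> carrier H; z \<in> carrier H\<rbrakk>
    \<Longrightarrow> cinner H z (vadd H x y) = cinner H z x + cinner H z y"
  using cinner_commute[of "vadd H x y" z] cinner_commute[of x z] cinner_commute[of y z] by simp

lemma cinner_scale_right [simp]:
  "\<lbrakk>x \<in> carrier H; y \<in> carrier H\<rbrakk> \<Longrightarrow> cinner H x (vscale H c y) = cnj c * cinner H x y"
  using cinner_commute[of "vscale H c y" x] cinner_commute[of y x] by simp

lemma cinner_zero_right [simp]: "x \<in> carrier H \<Longrightarrow> cinner H x (vzero H) = 0"
  using cinner_commute[of "vzero H" x] by simp

lemma cinner_vdiff_right [simp]:
  "\<lbrakk>x \<in> carrier H; y \<in> carrier H; z \<in> carrier H\<rbrakk>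
    \<Longrightarrow> cinner H z (vdiff H x y) = cinner H z x - cinner H z y"
  by (simp add: vdiff_def)

text \<open>Vector identities are reduced to scalar ones by pairing with an arbitrary
  \<open>w\<close>. Definiteness is assumed for \<open>vdiff\<close> because passing from a zero
  difference to equality would already be a vector space law.\<close>

lemma vec_eqI:
  assumes "x \<in> carrier H" "y \<in> carrier H" "\<And>w. w \<in> carrier H \<Longrightarrow> cinner H x w = cinner H y w"
  shows "x = y"
  by (rule eq_if_cinner_vdiff_0) (use assms in simp_all)

lemma hnorm_nonneg [simp]: "x \<in> carrier H \<Longrightarrow> 0 \<le> hnorm H x"
  by (simp add: hnorm_def cinner_self_nonneg)

lemma hnorm_sq: "x \<in> carrier H \<Longrightarrow> (hnorm H x)\<^sup>2 = Re (cinner H x x)"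
  by (simp add: hnorm_def cinner_self_nonneg)

lemma cinner_self: "x \<in> carrier H \<Longrightarrow> cinner H x x = complex_of_real ((hnorm H x)\<^sup>2)"
  using cinner_commute[of x x] by (simp add: hnorm_sq complex_eq_iff)

lemma hnorm_zero [simp]: "hnorm H (vzero H) = 0"
  by (simp add: hnorm_def)

lemma hnorm_scale [simp]: "x \<in> carrier H \<Longrightarrow> hnorm H (vscale H c x) = cmod c * hnorm H x"
proof -
  assume x: "x \<in> carrier H"
  have "complex_of_real ((hnorm H (vscale H c x))\<^sup>2) = c * (cnj c * cinner H x x)"
    using cinner_self[of "vscale H c x"] x by (simp add: mult.left_commute)
  also have "\<dots> = complex_of_real ((cmod c)\<^sup>2) * complex_of_real ((hnorm H x)\<^sup>2)"
    unfolding complex_norm_square using x by (simp add: cinner_self)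
  finally have "(hnorm H (vscale H c x))\<^sup>2 = (cmod c * hnorm H x)\<^sup>2"
    unfolding power_mult_distrib of_real_mult[symmetric] of_real_eq_iff .
  then show ?thesis using x by (simp add: power2_eq_iff_nonneg)
qed

lemma hnorm_eq_0_iff [simp]: "x \<in> carrier H \<Longrightarrow> hnorm H x = 0 \<longleftrightarrow> x = vzero H"
  using eq_if_cinner_vdiff_0[of x "vzero H"] cinner_self[of x] by auto

lemma Cauchy_Schwarz:
  assumes x: "x \<in> carrier H" and y: "y \<in> carrier H"
  shows "cmod (cinner H x y) \<le> hnorm H x * hnorm H y"
proof (cases "hnorm H y = 0")
  case True
  then show ?thesis using x y by simp
next
  case False
  then have pos: "hnorm H y > 0" using y by (simp add: order_less_le)
  \<comment> \<open>\<open>w\<close> is \<open>N\<close> times the component of \<open>x\<close>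
    orthogonal to \<open>y\<close>. The factor \<open>N\<close> avoids a division, and nonnegativity
    of \<open>cinner H w w\<close> is the squared claim multiplied by \<open>N\<close>.\<close>
  define N a w where "N = (hnorm H y)\<^sup>2" and "a = cinner H x y"
    and "w = vdiff H (vscale H (complex_of_real N) x) (vscale H a y)"
  have w: "w \<in> carrier H" using x y by (simp add: w_def)
  have a2: "a * cnj a = (complex_of_real (cmod a))\<^sup>2"
    by (simp add: complex_norm_square flip: of_real_power)
  have "cinner H w w = N * (N * (hnorm H x)\<^sup>2) - N * (cmod a)\<^sup>2"
    using x y w cinner_commute[of x y]
    by (simp add: w_def cinner_self[OF x] cinner_self[OF y] N_def a2 flip: a_def)
      (simp add: algebra_simps a2)
  then have "0 \<le> N * (N * (hnorm H x)\<^sup>2) - N * (cmod a)\<^sup>2"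
    using cinner_self_nonneg[OF w] by (simp add: complex_eq_iff)
  then have "N * (cmod a)\<^sup>2 \<le> N * (N * (hnorm H x)\<^sup>2)" by simp
  moreover have "N > 0" using pos by (simp add: N_def)
  ultimately have "(cmod a)\<^sup>2 \<le> N * (hnorm H x)\<^sup>2" by simp
  then have "(cmod a)\<^sup>2 \<le> (hnorm H x * hnorm H y)\<^sup>2"
    by (simp add: N_def power_mult_distrib mult.commute)
  then show ?thesis unfolding a_def by (rule power2_le_imp_le) (use x y in simp)
qed

lemma hnorm_add_sq:
  assumes "x \<in> carrier H" "y \<in> carrier H"
  shows "(hnorm H (vadd H x y))\<^sup>2 = (hnorm H x)\<^sup>2 + 2 * Re (cinner H x y) + (hnorm H y)\<^sup>2"
  using assms cinner_commute[of x y] by (simp add: hnorm_sq)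

lemma hnorm_triangle:
  assumes "x \<in> carrier H" "y \<in> carrier H"
  shows "hnorm H (vadd H x y) \<le> hnorm H x + hnorm H y"
proof -
  have "Re (cinner H x y) \<le> hnorm H x * hnorm H y"
    using Cauchy_Schwarz[OF assms] complex_Re_le_cmod order_trans by blast
  then have "(hnorm H (vadd H x y))\<^sup>2 \<le> (hnorm H x + hnorm H y)\<^sup>2"
    by (simp add: hnorm_add_sq assms power2_sum)
  then show ?thesis by (rule power2_le_imp_le) (use assms in simp)
qed

lemma vdiff_self [simp]: "x \<in> carrier H \<Longrightarrow> vdiff H x x = vzero H"
  by (rule vec_eqI) simp_all

lemma vdiff_zero [simp]: "x \<in> carrier H \<Longrightarrow> vdiff H x (vzero H) = x"
  by (rule vec_eqI) simp_all

lemma vadd_vdiff_cancel: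
  "\<lbrakk>x \<in> carrier H; y \<in> carrier H; z \<in> carrier H\<rbrakk> \<Longrightarrow> vadd H (vdiff H x y) (vdiff H y z) = vdiff H x z"
  by (rule vec_eqI) simp_all

lemma vdiff_scale:
  "\<lbrakk>x \<in> carrier H; y \<in> carrier H\<rbrakk> \<Longrightarrow> vdiff H (vscale H c x) (vscale H c y) = vscale H c (vdiff H x y)"
  by (rule vec_eqI) (simp_all add: algebra_simps)

lemma vdiff_add:
  "\<lbrakk>x \<in> carrier H; y \<in> carrier H; x' \<in> carrier H; y' \<in> carrier H\<rbrakk>
    \<Longrightarrow> vdiff H (vadd H x y) (vadd H x' y') = vadd H (vdiff H x x') (vdiff H y y')"
  by (rule vec_eqI) (simp_all add: algebra_simps)

lemma vdiff_minus:
  "\<lbrakk>x \<in> carrier H; y \<in> carrier H\<rbrakk> \<Longrightarrow> vdiff H y x = vscale H (-1) (vdiff H x y)"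
  by (rule vec_eqI) (simp_all add: algebra_simps)

lemma hnorm_vdiff_commute:
  "\<lbrakk>x \<in> carrier H; y \<in> carrier H\<rbrakk> \<Longrightarrow> hnorm H (vdiff H x y) = hnorm H (vdiff H y x)"
  by (simp add: vdiff_minus[of x y])

lemma vdiff_eq_zero_iff [simp]:
  assumes "x \<in> carrier H" "y \<in> carrier H"
  shows "vdiff H x y = vzero H \<longleftrightarrow> x = y"
  using assms eq_if_cinner_vdiff_0[OF assms] by (metis cinner_zero_left vdiff_self zero_closed)

lemma hnorm_vdiff_triangle:
  "\<lbrakk>x \<in> carrier H; y \<in> carrier H; z \<in> carrier H\<rbrakk>
    \<Longrightarrow> hnorm H (vdiff H x z) \<le> hnorm H (vdiff H x y) + hnorm H (vdiff H y z)"
  using hnorm_triangle[of "vdiff H x y" "vdiff H y z"] by (simp add: vadd_vdiff_cancel)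

lemma hnorm_le_vdiff:
  "\<lbrakk>x \<in> carrier H; y \<in> carrier H\<rbrakk> \<Longrightarrow> hnorm H x \<le> hnorm H (vdiff H x y) + hnorm H y"
  using hnorm_vdiff_triangle[of x y "vzero H"] by simp

lemma hdist_eq [simp]:
  "\<lbrakk>x \<in> carrier H; y \<in> carrier H\<rbrakk> \<Longrightarrow> hdist H x y = hnorm H (vdiff H x y)"
  by (simp add: hdist_def)

sublocale hmetric: Metric_space "carrier H" "hdist H"
proof
  show "0 \<le> hdist H x y" for x y by (simp add: hdist_def)
  show "hdist H x y = hdist H y x" for x y
    using hnorm_vdiff_commute by (simp add: hdist_def)
qed (use hnorm_vdiff_triangle in simp_all)

lemma closedin_htopologyD:
  assumes "closedin (htopology H) V" "\<And>n. s n \<in> V" "x \<in> carrier H"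
    "(\<lambda>n. hnorm H (vdiff H (s n) x)) \<longlonglongrightarrow> 0"
  shows "x \<in> V"
proof -
  have V: "V \<subseteq> carrier H" using assms(1) closedin_subset by fastforce
  have "limitin (htopology H) s x sequentially"
    using assms V by (auto simp: hmetric.limitin_metric_dist_null subset_iff)
  moreover have "range s \<subseteq> V" using assms(2) by blast
  ultimately show ?thesis
    using assms(1) unfolding hmetric.metric_closedin_iff_sequentially_closed by blast
qed

end

section \<open>Bounded operators\<close>

context prehilbert
begin

lemma bounded_opsD:
  assumes "T \<in> bounded_ops H"
  shows op_closed: "\<And>x. x \<in> carrier H \<Longrightarrow> T x \<in> carrier H"
    and op_extensional: "T \<in> extensional (carrier H)"
    and op_add: "\<And>x y. \<lbrakk>x \<in> carrier H; y \<in> carrier H\<rbrakk> \<Longrightarrow> T (vadd H x y) = vadd H (T x) (T y)"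
    and op_scale: "\<And>c x. x \<in> carrier H \<Longrightarrow> T (vscale H c x) = vscale H c (T x)"
  using assms by (auto simp: bounded_ops_def PiE_def)

lemma op_vdiff:
  "\<lbrakk>T \<in> bounded_ops H; x \<in> carrier H; y \<in> carrier H\<rbrakk> \<Longrightarrow> T (vdiff H x y) = vdiff H (T x) (T y)"
  by (simp add: vdiff_def op_add op_scale)

lemma op_zero: "T \<in> bounded_ops H \<Longrightarrow> T (vzero H) = vzero H"
  using op_vdiff[of T "vzero H" "vzero H"] op_closed[of T "vzero H"] by simp

lemma op_eqI:
  assumes "S \<in> bounded_ops H" "T \<in> bounded_ops H" "\<And>x. x \<in> carrier H \<Longrightarrow> S x = T x"
  shows "S = T"
  by (rule extensionalityI[OF op_extensional op_extensional]) (use assms in auto)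

lemma bounded_opsI:
  assumes "\<And>x. x \<in> carrier H \<Longrightarrow> T x \<in> carrier H" "T \<in> extensional (carrier H)"
    "\<And>x y. \<lbrakk>x \<in> carrier H; y \<in> carrier H\<rbrakk> \<Longrightarrow> T (vadd H x y) = vadd H (T x) (T y)"
    "\<And>c x. x \<in> carrier H \<Longrightarrow> T (vscale H c x) = vscale H c (T x)"
    "\<And>x. x \<in> carrier H \<Longrightarrow> hnorm H (T x) \<le> C * hnorm H x"
  shows "T \<in> bounded_ops H"
proof -
  have "\<exists>C. \<forall>x\<in>carrier H. hnorm H (T x) \<le> C * hnorm H x" using assms(5) by blast
  then show ?thesis using assms(1-4) by (simp add: bounded_ops_def PiE_def)
qed

lemma op_bounded:
  assumes "T \<in> bounded_ops H"
  obtains C where "0 \<le> C" "\<And>x. x \<in> carrier H \<Longrightarrow> hnorm H (T x) \<le> C * hnorm H x"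
proof -
  obtain C where C: "\<forall>x\<in>carrier H. hnorm H (T x) \<le> C * hnorm H x"
    using assms by (auto simp: bounded_ops_def)
  \<comment> \<open>In a trivial space the constant supplied by \<open>bounded_ops\<close> may be
    negative.\<close>
  have "hnorm H (T x) \<le> max C 0 * hnorm H x" if "x \<in> carrier H" for x
  proof -
    have "C * hnorm H x \<le> max C 0 * hnorm H x"
      by (rule mult_right_mono) (use that in auto)
    then show ?thesis using C that by force
  qed
  then show ?thesis using that[of "max C 0"] by auto
qed

lemma op_norm_bound:
  assumes T: "T \<in> bounded_ops H" and x: "x \<in> carrier H"
  shows "hnorm H (T x) \<le> op_norm H T * hnorm H x"
proof (cases "hnorm H x = 0")
  case True
  then show ?thesis using x T by (simp add: op_zero)
next
  case False
  then have pos: "hnorm H x > 0" using x hnorm_nonneg by (simp add: order_less_le del: hnorm_eq_0_iff)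
  define c where "c = complex_of_real (1 / hnorm H x)"
  have c: "cmod c = 1 / hnorm H x" unfolding c_def norm_of_real using pos by simp
  obtain C where C: "0 \<le> C" "\<And>x. x \<in> carrier H \<Longrightarrow> hnorm H (T x) \<le> C * hnorm H x"
    using op_bounded[OF T] by blast
  have bdd: "bdd_above ((\<lambda>x. hnorm H (T x)) ` {x \<in> carrier H. hnorm H x \<le> 1})"
  proof (rule bdd_aboveI2)
    fix x assume "x \<in> {x \<in> carrier H. hnorm H x \<le> 1}"
    then show "hnorm H (T x) \<le> C"
      using C(2)[of x] mult_left_mono[of "hnorm H x" 1 C] C(1) by simp
  qed
  have "hnorm H (T (vscale H c x)) \<le> op_norm H T"
    unfolding op_norm_def
    by (rule cSUP_upper[OF _ bdd]) (use x pos c in simp)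
  then have "hnorm H (T x) / hnorm H x \<le> op_norm H T"
    using x T by (simp add: op_scale op_closed c)
  then show ?thesis using pos by (simp add: field_simps)
qed

lemma op_norm_nonneg: "T \<in> bounded_ops H \<Longrightarrow> 0 \<le> op_norm H T"
proof -
  assume T: "T \<in> bounded_ops H"
  obtain C where C: "0 \<le> C" "\<And>x. x \<in> carrier H \<Longrightarrow> hnorm H (T x) \<le> C * hnorm H x"
    using op_bounded[OF T] by blast
  have bdd: "bdd_above ((\<lambda>x. hnorm H (T x)) ` {x \<in> carrier H. hnorm H x \<le> 1})"
  proof (rule bdd_aboveI2)
    fix x assume "x \<in> {x \<in> carrier H. hnorm H x \<le> 1}"
    then show "hnorm H (T x) \<le> C"
      using C(2)[of x] mult_left_mono[of "hnorm H x" 1 C] C(1) by simp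
  qed
  have "hnorm H (T (vzero H)) \<le> op_norm H T"
    unfolding op_norm_def by (rule cSUP_upper[OF _ bdd]) simp
  then show ?thesis using T by (simp add: op_zero)
qed

lemma op_norm_least:
  assumes "0 \<le> e" "\<And>x. x \<in> carrier H \<Longrightarrow> hnorm H (T x) \<le> e * hnorm H x"
  shows "op_norm H T \<le> e"
  unfolding op_norm_def
proof (rule cSUP_least)
  show "{x \<in> carrier H. hnorm H x \<le> 1} \<noteq> {}" using zero_closed hnorm_zero zero_le_one by (metis (mono_tags, lifting) empty_iff mem_Collect_eq)
next
  fix x assume "x \<in> {x \<in> carrier H. hnorm H x \<le> 1}"
  then show "hnorm H (T x) \<le> e"
    using assms(2)[of x] mult_left_mono[of "hnorm H x" 1 e] assms(1) by simp
qed

lemma zero_op_closed: "(\<lambda>x\<in>carrier H. vzero H) \<in> bounded_ops H"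
proof (rule bounded_opsI[where C = 0])
  have "vadd H (vzero H) (vzero H) = vzero H" "vscale H c (vzero H) = vzero H" for c
    by (rule vec_eqI; simp)+
  then show "\<And>c x. x \<in> carrier H \<Longrightarrow>
      (\<lambda>x\<in>carrier H. vzero H) (vscale H c x) = vscale H c ((\<lambda>x\<in>carrier H. vzero H) x)"
    and "\<And>x y. \<lbrakk>x \<in> carrier H; y \<in> carrier H\<rbrakk> \<Longrightarrow> (\<lambda>x\<in>carrier H. vzero H) (vadd H x y) =
      vadd H ((\<lambda>x\<in>carrier H. vzero H) x) ((\<lambda>x\<in>carrier H. vzero H) y)"
    by simp_all
qed simp_all

lemma add_op_closed:
  assumes S: "S \<in> bounded_ops H" and T: "T \<in> bounded_ops H"
  shows "(\<lambda>x\<in>carrier H. vadd H (S x) (T x)) \<in> bounded_ops H"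
proof (rule bounded_opsI[where C = "op_norm H S + op_norm H T"])
  fix x y assume xy: "x \<in> carrier H" "y \<in> carrier H"
  have "vadd H (vadd H (S x) (S y)) (vadd H (T x) (T y)) =
      vadd H (vadd H (S x) (T x)) (vadd H (S y) (T y))"
    by (rule vec_eqI) (use xy S T in \<open>simp_all add: op_closed\<close>)
  then show "(\<lambda>x\<in>carrier H. vadd H (S x) (T x)) (vadd H x y) =
      vadd H ((\<lambda>x\<in>carrier H. vadd H (S x) (T x)) x) ((\<lambda>x\<in>carrier H. vadd H (S x) (T x)) y)"
    using xy S T by (simp add: op_add)
next
  fix c x assume x: "x \<in> carrier H"
  have "vadd H (vscale H c (S x)) (vscale H c (T x)) = vscale H c (vadd H (S x) (T x))"
    by (rule vec_eqI) (use x S T in \<open>simp_all add: op_closed algebra_simps\<close>)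
  then show "(\<lambda>x\<in>carrier H. vadd H (S x) (T x)) (vscale H c x) =
      vscale H c ((\<lambda>x\<in>carrier H. vadd H (S x) (T x)) x)"
    using x S T by (simp add: op_scale)
next
  fix x assume x: "x \<in> carrier H"
  have "hnorm H (vadd H (S x) (T x)) \<le> hnorm H (S x) + hnorm H (T x)"
    by (rule hnorm_triangle) (use x S T in \<open>simp_all add: op_closed\<close>)
  also have "\<dots> \<le> (op_norm H S + op_norm H T) * hnorm H x"
    using op_norm_bound[OF S x] op_norm_bound[OF T x] by (simp add: algebra_simps)
  finally show "hnorm H ((\<lambda>x\<in>carrier H. vadd H (S x) (T x)) x) \<le>
      (op_norm H S + op_norm H T) * hnorm H x"
    using x by simp
qed (use S T in \<open>simp_all add: op_closed\<close>)

lemma scale_op_closed: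
  assumes T: "T \<in> bounded_ops H"
  shows "(\<lambda>x\<in>carrier H. vscale H c (T x)) \<in> bounded_ops H"
proof (rule bounded_opsI[where C = "cmod c * op_norm H T"])
  fix x y assume xy: "x \<in> carrier H" "y \<in> carrier H"
  have "vscale H c (vadd H (T x) (T y)) = vadd H (vscale H c (T x)) (vscale H c (T y))"
    by (rule vec_eqI) (use xy T in \<open>simp_all add: op_closed algebra_simps\<close>)
  then show "(\<lambda>x\<in>carrier H. vscale H c (T x)) (vadd H x y) =
      vadd H ((\<lambda>x\<in>carrier H. vscale H c (T x)) x) ((\<lambda>x\<in>carrier H. vscale H c (T x)) y)"
    using xy T by (simp add: op_add)
next
  fix b x assume x: "x \<in> carrier H"
  have "vscale H c (vscale H b (T x)) = vscale H b (vscale H c (T x))"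
    by (rule vec_eqI) (use x T in \<open>simp_all add: op_closed algebra_simps\<close>)
  then show "(\<lambda>x\<in>carrier H. vscale H c (T x)) (vscale H b x) =
      vscale H b ((\<lambda>x\<in>carrier H. vscale H c (T x)) x)"
    using x T by (simp add: op_scale)
next
  fix x assume x: "x \<in> carrier H"
  then show "hnorm H ((\<lambda>x\<in>carrier H. vscale H c (T x)) x) \<le> cmod c * op_norm H T * hnorm H x"
    using mult_left_mono[OF op_norm_bound[OF T x], of "cmod c"] T
    by (simp add: op_closed mult.assoc)
qed (use T in \<open>simp_all add: op_closed\<close>)

lemma compose_op_closed:
  assumes S: "S \<in> bounded_ops H" and T: "T \<in> bounded_ops H"
  shows "compose (carrier H) S T \<in> bounded_ops H"
proof (rule bounded_opsI[where C = "op_norm H S * op_norm H T"])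
  fix x assume x: "x \<in> carrier H"
  have "hnorm H (S (T x)) \<le> op_norm H S * hnorm H (T x)"
    by (rule op_norm_bound) (use S T x in \<open>simp_all add: op_closed\<close>)
  also have "\<dots> \<le> op_norm H S * (op_norm H T * hnorm H x)"
    by (rule mult_left_mono) (use op_norm_bound[OF T x] op_norm_nonneg[OF S] in simp_all)
  finally show "hnorm H (compose (carrier H) S T x) \<le> op_norm H S * op_norm H T * hnorm H x"
    using x by (simp add: compose_eq mult.assoc)
qed (use S T in \<open>simp_all add: compose_eq op_closed op_add op_scale\<close>)

lemma vdiff_op_closed:
  assumes S: "S \<in> bounded_ops H" and T: "T \<in> bounded_ops H"
  shows "(\<lambda>x\<in>carrier H. vdiff H (S x) (T x)) \<in> bounded_ops H"
proof -
  have "(\<lambda>x\<in>carrier H. vdiff H (S x) (T x)) =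
      (\<lambda>x\<in>carrier H. vadd H (S x) ((\<lambda>x\<in>carrier H. vscale H (- 1) (T x)) x))"
    by (auto simp: vdiff_def)
  then show ?thesis using add_op_closed[OF S scale_op_closed[OF T]] by simp
qed

lemma op_dist_bound:
  assumes S: "S \<in> bounded_ops H" and T: "T \<in> bounded_ops H" and x: "x \<in> carrier H"
  shows "hnorm H (vdiff H (S x) (T x)) \<le> op_dist H S T * hnorm H x"
  using op_norm_bound[OF vdiff_op_closed[OF S T] x] S T x by (simp add: op_dist_def)

text \<open>Outside \<open>bounded_ops\<close> the distance is 0, so the estimate is owed only for
  bounded operators.\<close>

lemma op_dist_leI:
  assumes "0 \<le> e"
    "\<And>x. \<lbrakk>S \<in> bounded_ops H; T \<in> bounded_ops H; x \<in> carrier H\<rbrakk>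
      \<Longrightarrow> hnorm H (vdiff H (S x) (T x)) \<le> e * hnorm H x"
  shows "op_dist H S T \<le> e"
  unfolding op_dist_def by (auto simp: assms(1) intro!: op_norm_least assms)

lemma op_dist_nonneg [simp]: "0 \<le> op_dist H S T"
  by (simp add: op_dist_def op_norm_nonneg vdiff_op_closed)

sublocale opmetric: Metric_space "bounded_ops H" "op_dist H"
proof
  show "op_dist H S T = op_dist H T S" for S T
  proof -
    have "op_dist H S T \<le> op_dist H T S" for S T
    proof (rule op_dist_leI)
      fix x assume *: "S \<in> bounded_ops H" "T \<in> bounded_ops H" "x \<in> carrier H"
      show "hnorm H (vdiff H (S x) (T x)) \<le> op_dist H T S * hnorm H x"
        using op_dist_bound[OF *(2,1,3)] * by (simp add: hnorm_vdiff_commute[of "S x"] op_closed)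
    qed simp
    then show ?thesis by (simp add: antisym)
  qed
next
  fix S T assume ST: "S \<in> bounded_ops H" "T \<in> bounded_ops H"
  show "op_dist H S T = 0 \<longleftrightarrow> S = T"
  proof
    assume 0: "op_dist H S T = 0"
    have "S x = T x" if x: "x \<in> carrier H" for x
    proof -
      have "hnorm H (vdiff H (S x) (T x)) = 0"
        using op_dist_bound[OF ST x] 0 ST x
        by (intro antisym hnorm_nonneg vdiff_closed) (simp_all add: op_closed)
      then show ?thesis using x ST by (simp add: op_closed)
    qed
    then show "S = T" using ST by (intro op_eqI)
  next
    assume eq: "S = T"
    have "op_dist H S T \<le> 0"
      by (rule op_dist_leI) (simp_all add: eq op_closed)
    then show "op_dist H S T = 0" by (simp add: antisym)
  qed
next
  fix R S T assume RST: "R \<in> bounded_ops H" "S \<in> bounded_ops H" "T \<in> bounded_ops H"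
  show "op_dist H R T \<le> op_dist H R S + op_dist H S T"
  proof (rule op_dist_leI)
    fix x assume x: "x \<in> carrier H"
    have "hnorm H (vdiff H (R x) (T x))
        \<le> hnorm H (vdiff H (R x) (S x)) + hnorm H (vdiff H (S x) (T x))"
      by (rule hnorm_vdiff_triangle) (use RST x in \<open>simp_all add: op_closed\<close>)
    also have "\<dots> \<le> (op_dist H R S + op_dist H S T) * hnorm H x"
      using op_dist_bound[OF RST(1,2) x] op_dist_bound[OF RST(2,3) x]
      by (simp add: algebra_simps)
    finally show "hnorm H (vdiff H (R x) (T x)) \<le> (op_dist H R S + op_dist H S T) * hnorm H x" .
  qed simp
qed simp

text \<open>Distance to the zero operator plays the part of the norm, since
  \<open>metric_star_algebra\<close> speaks only of a metric.\<close>

lemma op_dist_zero_bound: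
  assumes T: "T \<in> bounded_ops H" and x: "x \<in> carrier H"
  shows "hnorm H (T x) \<le> op_dist H T (\<lambda>x\<in>carrier H. vzero H) * hnorm H x"
  using op_dist_bound[OF T zero_op_closed x] T x by (simp add: op_closed)

lemma op_dist_add:
  assumes "S \<in> bounded_ops H" "T \<in> bounded_ops H" "S' \<in> bounded_ops H" "T' \<in> bounded_ops H"
  shows "op_dist H (\<lambda>x\<in>carrier H. vadd H (S x) (T x)) (\<lambda>x\<in>carrier H. vadd H (S' x) (T' x))
    \<le> op_dist H S S' + op_dist H T T'"
proof (rule op_dist_leI)
  fix x assume x: "x \<in> carrier H"
  have "hnorm H (vadd H (vdiff H (S x) (S' x)) (vdiff H (T x) (T' x)))
      \<le> hnorm H (vdiff H (S x) (S' x)) + hnorm H (vdiff H (T x) (T' x))"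
    by (rule hnorm_triangle) (use assms x in \<open>simp_all add: op_closed\<close>)
  also have "\<dots> \<le> (op_dist H S S' + op_dist H T T') * hnorm H x"
    using op_dist_bound[OF assms(1,3) x] op_dist_bound[OF assms(2,4) x]
    by (simp add: algebra_simps)
  finally show "hnorm H (vdiff H ((\<lambda>x\<in>carrier H. vadd H (S x) (T x)) x)
      ((\<lambda>x\<in>carrier H. vadd H (S' x) (T' x)) x)) \<le> (op_dist H S S' + op_dist H T T') * hnorm H x"
    using assms x by (simp add: vdiff_add op_closed)
qed simp

lemma op_dist_scale:
  assumes "T \<in> bounded_ops H" "T' \<in> bounded_ops H"
  shows "op_dist H (\<lambda>x\<in>carrier H. vscale H c (T x)) (\<lambda>x\<in>carrier H. vscale H c (T' x))
    \<le> cmod c * op_dist H T T'"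
proof (rule op_dist_leI)
  fix x assume x: "x \<in> carrier H"
  show "hnorm H (vdiff H ((\<lambda>x\<in>carrier H. vscale H c (T x)) x)
      ((\<lambda>x\<in>carrier H. vscale H c (T' x)) x)) \<le> cmod c * op_dist H T T' * hnorm H x"
    using assms x mult_left_mono[OF op_dist_bound[OF assms x], of "cmod c"]
    by (simp add: vdiff_scale op_closed mult.assoc)
qed simp

text \<open>The two terms estimate \<open>S (T - T')\<close> and \<open>(S - S') T'\<close>, into
  which the difference of the products splits.\<close>

lemma op_dist_compose:
  assumes S: "S \<in> bounded_ops H" and T: "T \<in> bounded_ops H"
    and S': "S' \<in> bounded_ops H" and T': "T' \<in> bounded_ops H"
  shows "op_dist H (compose (carrier H) S T) (compose (carrier H) S' T')
    \<le> op_dist H S (\<lambda>x\<in>carrier H. vzero H) * op_dist H T T'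
      + op_dist H S S' * op_dist H T' (\<lambda>x\<in>carrier H. vzero H)"
    (is "_ \<le> ?s * ?d + ?e * ?t")
proof (rule op_dist_leI)
  fix x assume x: "x \<in> carrier H"
  note [simp] = op_closed[OF S] op_closed[OF T] op_closed[OF S'] op_closed[OF T'] x
  have 1: "hnorm H (vdiff H (S (T x)) (S (T' x))) \<le> ?s * (?d * hnorm H x)"
  proof -
    have "hnorm H (S (vdiff H (T x) (T' x))) \<le> ?s * hnorm H (vdiff H (T x) (T' x))"
      by (rule op_dist_zero_bound[OF S]) simp
    also have "\<dots> \<le> ?s * (?d * hnorm H x)"
      by (rule mult_left_mono[OF op_dist_bound[OF T T']]) simp_all
    finally show ?thesis by (simp add: op_vdiff[OF S])
  qed
  have 2: "hnorm H (vdiff H (S (T' x)) (S' (T' x))) \<le> ?e * (?t * hnorm H x)"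
    by (rule order_trans[OF op_dist_bound[OF S S']])
      (simp_all add: mult_left_mono op_dist_zero_bound[OF T'])
  have "hnorm H (vdiff H (S (T x)) (S' (T' x)))
      \<le> hnorm H (vdiff H (S (T x)) (S (T' x))) + hnorm H (vdiff H (S (T' x)) (S' (T' x)))"
    by (rule hnorm_vdiff_triangle) simp_all
  then show "hnorm H (vdiff H (compose (carrier H) S T x) (compose (carrier H) S' T' x))
      \<le> (?s * ?d + ?e * ?t) * hnorm H x"
    using 1 2 by (simp add: compose_eq algebra_simps)
qed simp

text \<open>The limit is formed pointwise and inherits linearity from uniqueness of limits.
  Convergence in operator norm comes from letting one index of the Cauchy estimate go to
  infinity.\<close>

lemma mcomplete_bounded_ops:
  assumes "hmetric.mcomplete"
  shows "opmetric.mcomplete"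
  unfolding opmetric.mcomplete_def
proof (intro allI impI)
  fix T :: "nat \<Rightarrow> 'v \<Rightarrow> 'v" assume C: "opmetric.MCauchy T"
  have T: "T n \<in> bounded_ops H" for n using C by (auto simp: opmetric.MCauchy_def)
  note [simp] = op_closed[OF T]
  have "\<exists>y. limitin (htopology H) (\<lambda>n. T n x) y sequentially" if x: "x \<in> carrier H" for x
  proof -
    have "hmetric.MCauchy (\<lambda>n. T n x)"
      unfolding hmetric.MCauchy_def
    proof (intro conjI allI impI)
      show "range (\<lambda>n. T n x) \<subseteq> carrier H" using x by auto
      fix e :: real assume e: "e > 0"
      \<comment> \<open>The added 1 keeps the divisor positive when \<open>x\<close> is the zero
        vector.\<close>
      define e' where "e' = e / (hnorm H x + 1)"
      have pos: "hnorm H x + 1 > 0" using hnorm_nonneg[OF x] by linarith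
      have e': "e' > 0" using e pos by (simp add: e'_def)
      obtain N where N: "\<And>n m. \<lbrakk>N \<le> n; N \<le> m\<rbrakk> \<Longrightarrow> op_dist H (T n) (T m) < e'"
        using C e' unfolding opmetric.MCauchy_def by metis
      have "hdist H (T n x) (T m x) < e" if "N \<le> n" "N \<le> m" for n m
      proof -
        have "hdist H (T n x) (T m x) \<le> op_dist H (T n) (T m) * hnorm H x"
          using x op_dist_bound[OF T T x] by simp
        also have "\<dots> \<le> e' * hnorm H x"
          by (rule mult_right_mono) (use N[OF that] x in auto)
        also have "\<dots> < e' * (hnorm H x + 1)" using e' by simp
        also have "\<dots> = e" using pos by (simp add: e'_def)
        finally show ?thesis .
      qed
      then show "\<exists>N. \<forall>n m. N \<le> n \<longrightarrow> N \<le> m \<longrightarrow> hdist H (T n x) (T m x) < e" by blast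
    qed
    then show ?thesis using assms by (simp add: hmetric.mcomplete_def)
  qed
  then obtain L where L: "\<And>x. x \<in> carrier H \<Longrightarrow> limitin (htopology H) (\<lambda>n. T n x) (L x) sequentially"
    by metis
  define S where "S = restrict L (carrier H)"
  have Sc [simp]: "S x \<in> carrier H" if "x \<in> carrier H" for x
    using L[OF that] that by (simp add: S_def hmetric.limitin_mspace)
  have lim: "(\<lambda>n. hnorm H (vdiff H (T n x) (S x))) \<longlonglongrightarrow> 0" if "x \<in> carrier H" for x
    using L[OF that] Sc[OF that] that
    by (auto simp: hmetric.limitin_metric_dist_null S_def)
  have approx: "\<exists>N. \<forall>n\<ge>N. \<forall>x\<in>carrier H. hnorm H (vdiff H (T n x) (S x)) \<le> e * hnorm H x"
    if e: "e > 0" for e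
  proof -
    obtain N where N: "\<And>n m. \<lbrakk>N \<le> n; N \<le> m\<rbrakk> \<Longrightarrow> op_dist H (T n) (T m) < e"
      using C e unfolding opmetric.MCauchy_def by metis
    have "hnorm H (vdiff H (T n x) (S x)) \<le> e * hnorm H x" if n: "n \<ge> N" and x: "x \<in> carrier H" for n x
    proof (rule LIMSEQ_le_const)
      show "(\<lambda>m. e * hnorm H x + hnorm H (vdiff H (T m x) (S x))) \<longlonglongrightarrow> e * hnorm H x"
        using tendsto_add[OF tendsto_const lim[OF x]] by simp
      have "hnorm H (vdiff H (T n x) (S x)) \<le> e * hnorm H x + hnorm H (vdiff H (T m x) (S x))"
        if m: "m \<ge> N" for m
      proof -
        have "hnorm H (vdiff H (T n x) (T m x)) \<le> e * hnorm H x"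
          by (rule order_trans[OF op_dist_bound[OF T T x]], rule mult_right_mono)
            (use N[OF n m] x in auto)
        then show ?thesis
          using hnorm_vdiff_triangle[of "T n x" "T m x" "S x"] x by simp
      qed
      then show "\<exists>N. \<forall>m\<ge>N. hnorm H (vdiff H (T n x) (S x))
          \<le> e * hnorm H x + hnorm H (vdiff H (T m x) (S x))" by blast
    qed
    then show ?thesis by blast
  qed
  have uniq: "S x = y" if "x \<in> carrier H" "y \<in> carrier H"
    "(\<lambda>n. hnorm H (vdiff H (T n x) y)) \<longlonglongrightarrow> 0" for x y
  proof -
    have "limitin (htopology H) (\<lambda>n. T n x) y sequentially"
      using that by (simp add: hmetric.limitin_metric_dist_null)
    then show ?thesis
      using L[OF that(1)] that(1) hmetric.limitin_metric_unique by (fastforce simp: S_def)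
  qed
  obtain N where N: "\<And>x. x \<in> carrier H \<Longrightarrow> hnorm H (vdiff H (T N x) (S x)) \<le> 1 * hnorm H x"
    using approx[of 1] zero_less_one order_refl by metis
  have SB: "S \<in> bounded_ops H"
  proof (rule bounded_opsI[where C = "1 + op_norm H (T N)"])
    fix x y assume [simp]: "x \<in> carrier H" "y \<in> carrier H"
    show "S (vadd H x y) = vadd H (S x) (S y)"
    proof (rule uniq)
      have "(\<lambda>n. hnorm H (vdiff H (T n x) (S x)) + hnorm H (vdiff H (T n y) (S y))) \<longlonglongrightarrow> 0"
        using tendsto_add[OF lim lim] by simp
      then show "(\<lambda>n. hnorm H (vdiff H (T n (vadd H x y)) (vadd H (S x) (S y)))) \<longlonglongrightarrow> 0"
        by (rule real_tendsto_sandwich[OF _ _ tendsto_const, rotated -1])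
          (auto simp: op_add[OF T] vdiff_add hnorm_triangle)
    qed simp_all
  next
    fix c x assume [simp]: "x \<in> carrier H"
    show "S (vscale H c x) = vscale H c (S x)"
    proof (rule uniq)
      show "(\<lambda>n. hnorm H (vdiff H (T n (vscale H c x)) (vscale H c (S x)))) \<longlonglongrightarrow> 0"
        using tendsto_mult_left[OF lim, of x "cmod c"] by (simp add: op_scale[OF T] vdiff_scale)
    qed simp_all
  next
    fix x assume x: "x \<in> carrier H"
    show "hnorm H (S x) \<le> (1 + op_norm H (T N)) * hnorm H x"
      using N[OF x] hnorm_le_vdiff[of "S x" "T N x"] op_norm_bound[OF T x, of N] x
      by (simp add: algebra_simps hnorm_vdiff_commute)
  qed (simp, simp add: S_def)
  have "limitin opmetric.mtopology T S sequentially"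
    unfolding opmetric.limitin_metric
  proof (intro conjI SB allI impI)
    fix e :: real assume e: "e > 0"
    then obtain N where N: "\<And>n x. \<lbrakk>n \<ge> N; x \<in> carrier H\<rbrakk>
        \<Longrightarrow> hnorm H (vdiff H (T n x) (S x)) \<le> e / 2 * hnorm H x"
      using approx[of "e/2"] half_gt_zero by metis
    have "op_dist H (T n) S < e" if "n \<ge> N" for n
    proof -
      have "op_dist H (T n) S \<le> e/2" by (rule op_dist_leI) (use e N that in auto)
      then show ?thesis using e by simp
    qed
    then show "\<forall>\<^sub>F n in sequentially. T n \<in> bounded_ops H \<and> op_dist H (T n) S < e"
      using T by (auto simp: eventually_sequentially)
  qed
  then show "\<exists>S. limitin opmetric.mtopology T S sequentially" by blast
qed

text \<open>Uniqueness of the adjoint turns the definite description in \<open>adjoint_op\<close>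
  into a computation rule: each adjoint below is identified by exhibiting a candidate.\<close>

lemma adjoint_eqI:
  assumes "S \<in> bounded_ops H"
    "\<And>x y. \<lbrakk>x \<in> carrier H; y \<in> carrier H\<rbrakk> \<Longrightarrow> cinner H (T x) y = cinner H x (S y)"
  shows "adjoint_op H T = S"
  unfolding adjoint_op_def
proof (rule the_equality)
  fix R assume R: "R \<in> bounded_ops H \<and>
    (\<forall>x\<in>carrier H. \<forall>y\<in>carrier H. cinner H (T x) y = cinner H x (R y))"
  show "R = S"
  proof (rule op_eqI)
    fix y assume y: "y \<in> carrier H"
    show "R y = S y"
    proof (rule vec_eqI)
      fix w assume w: "w \<in> carrier H"
      then have "cinner H w (R y) = cinner H w (S y)" using R assms(2) y by metis
      then show "cinner H (R y) w = cinner H (S y) w"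
        using cinner_commute[of w] w y R assms(1) by (metis op_closed)
    qed (use R assms(1) y in \<open>auto simp: op_closed\<close>)
  qed (use R assms(1) in auto)
qed (use assms in simp)

end

section \<open>Metric *-algebras and extension of contractive homomorphisms\<close>

text \<open>The common ground of operator algebras and \<open>C(S\<^sup>1)\<close>: the estimates by
  which the operations pass to limits. Distance to \<open>azero A\<close> stands for the norm, and
  \<open>dist_mult\<close> has the shape of \<open>op_dist_compose\<close>.\<close>

locale metric_star_algebra = Metric_space "carrier A" d
  for A :: "'a star_algebra" and d :: "'a \<Rightarrow> 'a \<Rightarrow> real" +
  assumes star_subalgebra_carrier: "star_subalgebra A (carrier A)"
    and dist_add: "\<lbrakk>x \<in> carrier A; y \<in> carrier A; x' \<in> carrier A; y' \<in> carrier A\<rbrakk>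
      \<Longrightarrow> d (aadd A x y) (aadd A x' y') \<le> d x x' + d y y'"
    and dist_scale: "\<lbrakk>x \<in> carrier A; x' \<in> carrier A\<rbrakk>
      \<Longrightarrow> d (ascale A c x) (ascale A c x') \<le> cmod c * d x x'"
    and dist_mult: "\<lbrakk>x \<in> carrier A; y \<in> carrier A; x' \<in> carrier A; y' \<in> carrier A\<rbrakk>
      \<Longrightarrow> d (amult A x y) (amult A x' y') \<le> d x (azero A) * d y y' + d x x' * d y' (azero A)"
    and dist_star: "\<lbrakk>x \<in> carrier A; x' \<in> carrier A\<rbrakk> \<Longrightarrow> d (astar A x) (astar A x') \<le> d x x'"
begin

lemma op_closeds [simp]:
  "azero A \<in> carrier A"
  "\<lbrakk>x \<in> carrier A; y \<in> carrier A\<rbrakk> \<Longrightarrow> aadd A x y \<in> carrier A"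
  "x \<in> carrier A \<Longrightarrow> ascale A c x \<in> carrier A"
  "\<lbrakk>x \<in> carrier A; y \<in> carrier A\<rbrakk> \<Longrightarrow> amult A x y \<in> carrier A"
  "x \<in> carrier A \<Longrightarrow> astar A x \<in> carrier A"
  using star_subalgebra_carrier by (auto simp: star_subalgebra_def)

definition converges :: "(nat \<Rightarrow> 'a) \<Rightarrow> 'a \<Rightarrow> bool" where
  "converges s x \<longleftrightarrow> range s \<subseteq> carrier A \<and> x \<in> carrier A \<and> (\<lambda>n. d (s n) x) \<longlonglongrightarrow> 0"

lemma convergesD:
  assumes "converges s x"
  shows "s n \<in> carrier A" "x \<in> carrier A" "(\<lambda>n. d (s n) x) \<longlonglongrightarrow> 0"
  using assms by (auto simp: converges_def)

lemma converges_le: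
  assumes "\<And>n. s n \<in> carrier A" "x \<in> carrier A" "\<And>n. d (s n) x \<le> t n" "t \<longlonglongrightarrow> 0"
  shows "converges s x"
  unfolding converges_def
  using assms by (auto intro: real_tendsto_sandwich[OF _ _ tendsto_const assms(4)])

lemma converges_add:
  assumes "converges s x" "converges t y"
  shows "converges (\<lambda>n. aadd A (s n) (t n)) (aadd A x y)"
proof (rule converges_le)
  show "(\<lambda>n. d (s n) x + d (t n) y) \<longlonglongrightarrow> 0"
    using tendsto_add[OF convergesD(3)[OF assms(1)] convergesD(3)[OF assms(2)]] by simp
qed (use assms[THEN convergesD(1)] assms[THEN convergesD(2)] dist_add in auto)

lemma converges_scale:
  assumes "converges s x"
  shows "converges (\<lambda>n. ascale A c (s n)) (ascale A c x)"
proof (rule converges_le)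
  show "(\<lambda>n. cmod c * d (s n) x) \<longlonglongrightarrow> 0"
    using tendsto_mult_left[OF convergesD(3)[OF assms(1)]] by simp
qed (use assms[THEN convergesD(1)] assms[THEN convergesD(2)] dist_scale in auto)

lemma converges_star:
  assumes "converges s x"
  shows "converges (\<lambda>n. astar A (s n)) (astar A x)"
  by (rule converges_le[OF _ _ _ convergesD(3)[OF assms(1)]])
    (use assms[THEN convergesD(1)] assms[THEN convergesD(2)] dist_star in auto)

lemma converges_mult:
  assumes s: "converges s x" and t: "converges t y"
  shows "converges (\<lambda>n. amult A (s n) (t n)) (amult A x y)"
proof (rule converges_le)
  note [simp] = convergesD(1,2)[OF s] convergesD(1,2)[OF t]
  \<comment> \<open>The norm of \<open>s n\<close> is replaced by \<open>d (s n) x\<close> plus the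
    norm of \<open>x\<close>, so that every term has a known limit.\<close>
  let ?u = "\<lambda>n. (d (s n) x + d x (azero A)) * d (t n) y + d (s n) x * d y (azero A)"
  have "?u \<longlonglongrightarrow> (0 + d x (azero A)) * 0 + 0 * d y (azero A)"
    by (intro tendsto_intros convergesD(3)[OF s] convergesD(3)[OF t])
  then show "?u \<longlonglongrightarrow> 0" by simp
  fix n
  have "d (amult A (s n) (t n)) (amult A x y)
      \<le> d (s n) (azero A) * d (t n) y + d (s n) x * d y (azero A)"
    by (rule dist_mult) simp_all
  also have "\<dots> \<le> ?u n"
    using triangle[of "s n" x "azero A"] by (intro add_right_mono mult_right_mono) simp_all
  finally show "d (amult A (s n) (t n)) (amult A x y) \<le> ?u n" .
qed (use s t convergesD in auto)

lemma converges_unique: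
  assumes "converges s x" "converges s y"
  shows "x = y"
proof -
  note [simp] = convergesD(1,2)[OF assms(1)] convergesD(2)[OF assms(2)]
  have "(\<lambda>n. d (s n) x + d (s n) y) \<longlonglongrightarrow> 0"
    using tendsto_add[OF convergesD(3)[OF assms(1)] convergesD(3)[OF assms(2)]] by simp
  then have "d x y \<le> 0"
    by (rule LIMSEQ_le_const) (use triangle''[of x _ y] in auto)
  then have "d x y = 0" using nonneg[of x y] by linarith
  then show ?thesis by simp
qed

lemma converges_const: "x \<in> carrier A \<Longrightarrow> converges (\<lambda>n. x) x"
  by (auto simp: converges_def)

lemma closure_of_iff_converges:
  assumes "S \<subseteq> carrier A"
  shows "x \<in> mtopology closure_of S \<longleftrightarrow> (\<exists>s. range s \<subseteq> S \<and> converges s x)"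
proof
  assume x: "x \<in> mtopology closure_of S"
  then have xA: "x \<in> carrier A" and "\<forall>n::nat. \<exists>y\<in>S. y \<in> mball x (inverse (Suc n))"
    by (auto simp: metric_closure_of)
  then obtain s where s: "\<And>n::nat. s n \<in> S" "\<And>n. d x (s n) < inverse (Suc n)"
    by (metis in_mball)
  have "d (s n) x \<le> inverse (Suc n)" for n
    using s(2)[of n] by (simp add: commute)
  then have "converges s x"
    by (rule converges_le[OF _ xA _ LIMSEQ_inverse_real_of_nat, rotated]) (use s assms in auto)
  then show "\<exists>s. range s \<subseteq> S \<and> converges s x" using s by blast
next
  assume "\<exists>s. range s \<subseteq> S \<and> converges s x"
  then obtain s where s: "range s \<subseteq> S" "converges s x" by blast
  have "\<exists>y\<in>S. y \<in> mball x r" if "r > 0" for r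
  proof -
    have "\<forall>\<^sub>F n in sequentially. d (s n) x < r"
      using order_tendstoD(2)[OF convergesD(3)[OF s(2)] that] .
    then obtain n where "d (s n) x < r" by (auto simp: eventually_sequentially)
    then have "s n \<in> mball x r" using convergesD[OF s(2)] by (simp add: commute)
    then show ?thesis using s(1) by blast
  qed
  then show "x \<in> mtopology closure_of S"
    using convergesD(2)[OF s(2)] by (simp add: metric_closure_of)
qed

lemma closedin_converges:
  assumes "closedin mtopology S" "range s \<subseteq> S" "converges s x"
  shows "x \<in> S"
  using assms closure_of_iff_converges[of S] closedin_subset[OF assms(1)]
  by (metis closure_of_closedin topspace_mtopology)

lemma MCauchy_converges:
  assumes "converges s x"
  shows "MCauchy s"
proof -
  have "limitin mtopology s x sequentially"
    using convergesD[OF assms] by (auto simp: limitin_metric_dist_null)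
  then show ?thesis using convergent_imp_MCauchy convergesD(1)[OF assms] by blast
qed

lemma mcomplete_converges:
  assumes "mcomplete" "MCauchy s"
  obtains x where "converges s x"
proof -
  obtain x where "limitin mtopology s x sequentially" using assms by (auto simp: mcomplete_def)
  then show ?thesis using assms(2) that[of x]
    by (auto simp: limitin_metric_dist_null converges_def MCauchy_def)
qed

end

text \<open>The graph of a contractive *-homomorphism before its single-valuedness is known.
  Contractivity for two pairs with the same first entry forces equal second entries.\<close>

locale contractive_star_relation =
  A: metric_star_algebra A dA + B: metric_star_algebra B dB
  for A :: "'a star_algebra" and dA and B :: "'b star_algebra" and dB +
  fixes G :: "('a \<times> 'b) set"
  assumes subset: "G \<subseteq> carrier A \<times> carrier B"
    and zero: "(azero A, azero B) \<in> G"
    and add: "\<lbrakk>(a, b) \<in> G; (a', b') \<in> G\<rbrakk> \<Longrightarrow> (aadd A a a', aadd B b b') \<in> G"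
    and scale: "(a, b) \<in> G \<Longrightarrow> (ascale A c a, ascale B c b) \<in> G"
    and mult: "\<lbrakk>(a, b) \<in> G; (a', b') \<in> G\<rbrakk> \<Longrightarrow> (amult A a a', amult B b b') \<in> G"
    and star: "(a, b) \<in> G \<Longrightarrow> (astar A a, astar B b) \<in> G"
    and contractive: "\<lbrakk>(a, b) \<in> G; (a', b') \<in> G\<rbrakk> \<Longrightarrow> dB b b' \<le> dA a a'"
    and complete: "B.mcomplete"
begin

abbreviation "Dom \<equiv> A.mtopology closure_of (fst ` G)"
abbreviation "Cod \<equiv> B.mtopology closure_of (snd ` G)"

text \<open>The closure of the graph in the product space, described by sequences.\<close>

definition Gbar :: "('a \<times> 'b) set" where
  "Gbar = {(a, b). \<exists>s t. (\<forall>n. (s n, t n) \<in> G) \<and> A.converges s a \<and> B.converges t b}"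

lemma GbarI: "\<lbrakk>\<And>n. (s n, t n) \<in> G; A.converges s a; B.converges t b\<rbrakk> \<Longrightarrow> (a, b) \<in> Gbar"
  by (auto simp: Gbar_def)

lemma GbarD:
  "(a, b) \<in> Gbar \<Longrightarrow> \<exists>s t. (\<forall>n. (s n, t n) \<in> G) \<and> A.converges s a \<and> B.converges t b"
  by (simp add: Gbar_def)

lemma G_subset_Gbar: "G \<subseteq> Gbar"
  using subset by (auto intro!: GbarI[of "\<lambda>n. _" "\<lambda>n. _"] A.converges_const B.converges_const)

lemma Gbar_subset: "Gbar \<subseteq> Dom \<times> Cod"
proof safe
  fix a b assume "(a, b) \<in> Gbar"
  then obtain s t where st: "\<And>n. (s n, t n) \<in> G" "A.converges s a" "B.converges t b"
    by (metis GbarD)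
  have r: "range s \<subseteq> fst ` G" "range t \<subseteq> snd ` G" using st(1) by force+
  have "fst ` G \<subseteq> carrier A" "snd ` G \<subseteq> carrier B" using subset by auto
  then show "a \<in> Dom" "b \<in> Cod"
    using A.closure_of_iff_converges[of "fst ` G" a] B.closure_of_iff_converges[of "snd ` G" b]
      r st(2,3) by metis+
qed

lemma dom_subset: "Dom \<subseteq> carrier A" and cod_subset: "Cod \<subseteq> carrier B"
  using closure_of_subset_topspace[of A.mtopology] closure_of_subset_topspace[of B.mtopology]
  by simp_all

lemma Gbar_contractive:
  assumes "(a, b) \<in> Gbar" "(a', b') \<in> Gbar"
  shows "dB b b' \<le> dA a a'"
proof -
  obtain s t where st: "\<And>n. (s n, t n) \<in> G" "A.converges s a" "B.converges t b"
    using assms(1) by (metis GbarD)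
  obtain s' t' where st': "\<And>n. (s' n, t' n) \<in> G" "A.converges s' a'" "B.converges t' b'"
    using assms(2) by (metis GbarD)
  note [simp] = A.convergesD(1,2)[OF st(2)] B.convergesD(1,2)[OF st(3)]
    A.convergesD(1,2)[OF st'(2)] B.convergesD(1,2)[OF st'(3)]
  \<comment> \<open>Going from \<open>b\<close> to \<open>b'\<close> through \<open>t n\<close> and
    \<open>t' n\<close> costs distances that vanish in the limit, except for
    \<open>dA a a'\<close>.\<close>
  have "(\<lambda>n. dB (t n) b + dA (s n) a + dA a a' + dA (s' n) a' + dB (t' n) b')
      \<longlonglongrightarrow> 0 + 0 + dA a a' + 0 + 0"
    by (intro tendsto_intros A.convergesD(3) B.convergesD(3) st st')
  moreover have "dB b b' \<le> dB (t n) b + dA (s n) a + dA a a' + dA (s' n) a' + dB (t' n) b'" for n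
  proof -
    have "dB b b' \<le> dB b (t n) + (dB (t n) (t' n) + dB (t' n) b')"
      using B.triangle[of b "t n" b'] B.triangle[of "t n" "t' n" b'] by simp
    moreover have "dB (t n) (t' n) \<le> dA (s n) (s' n)" using contractive st(1) st'(1) .
    moreover have "dA (s n) (s' n) \<le> dA (s n) a + (dA a a' + dA a' (s' n))"
      using A.triangle[of "s n" a "s' n"] A.triangle[of a a' "s' n"] by simp
    ultimately show ?thesis by (simp add: A.commute B.commute)
  qed
  ultimately show ?thesis by (auto intro: LIMSEQ_le_const)
qed

lemma Gbar_unique:
  assumes "(a, b) \<in> Gbar" "(a, b') \<in> Gbar"
  shows "b = b'"
proof -
  have "a \<in> carrier A" "b \<in> carrier B" "b' \<in> carrier B"
    using assms Gbar_subset dom_subset cod_subset by blast+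
  then show ?thesis
    using Gbar_contractive[OF assms] B.nonneg[of b b'] B.zero[of b b'] by simp
qed

text \<open>Contractivity makes the partners of a convergent sequence a Cauchy sequence, and
  \<open>B\<close> is complete.\<close>

lemma Gbar_total:
  assumes "a \<in> Dom"
  obtains b where "(a, b) \<in> Gbar"
proof -
  have "fst ` G \<subseteq> carrier A" using subset by auto
  then obtain s where s: "range s \<subseteq> fst ` G" "A.converges s a"
    using assms A.closure_of_iff_converges by blast
  then have "\<forall>n. \<exists>b. (s n, b) \<in> G" by force
  then obtain t where t: "\<And>n. (s n, t n) \<in> G" by metis
  have "B.MCauchy t"
    unfolding B.MCauchy_def
  proof (intro conjI allI impI)
    show "range t \<subseteq> carrier B" using t subset by auto
    fix e :: real assume "e > 0"
    then obtain N where N: "\<And>n m. \<lbrakk>n \<ge> N; m \<ge> N\<rbrakk> \<Longrightarrow> dA (s n) (s m) < e"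
      using A.MCauchy_converges[OF s(2)] unfolding A.MCauchy_def by metis
    then show "\<exists>N. \<forall>n m. N \<le> n \<longrightarrow> N \<le> m \<longrightarrow> dB (t n) (t m) < e"
      using contractive[OF t t] by (meson order_le_less_trans)
  qed
  then obtain b where "B.converges t b" using complete B.mcomplete_converges by blast
  then show ?thesis using that GbarI t s(2) by blast
qed

lemma Gbar_zero: "(azero A, azero B) \<in> Gbar"
  using zero G_subset_Gbar by blast

lemma Gbar_add:
  assumes "(a, b) \<in> Gbar" "(a', b') \<in> Gbar"
  shows "(aadd A a a', aadd B b b') \<in> Gbar"
proof -
  obtain s t where st: "\<And>n. (s n, t n) \<in> G" "A.converges s a" "B.converges t b"
    using GbarD[OF assms(1)] by blast
  obtain s' t' where st': "\<And>n. (s' n, t' n) \<in> G" "A.converges s' a'" "B.converges t' b'"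
    using GbarD[OF assms(2)] by blast
  show ?thesis
    by (rule GbarI[OF add[OF st(1) st'(1)] A.converges_add[OF st(2) st'(2)]
          B.converges_add[OF st(3) st'(3)]])
qed

lemma Gbar_scale:
  assumes "(a, b) \<in> Gbar"
  shows "(ascale A c a, ascale B c b) \<in> Gbar"
proof -
  obtain s t where st: "\<And>n. (s n, t n) \<in> G" "A.converges s a" "B.converges t b"
    using GbarD[OF assms] by blast
  show ?thesis
    by (rule GbarI[OF scale[OF st(1)] A.converges_scale[OF st(2)] B.converges_scale[OF st(3)]])
qed

lemma Gbar_mult:
  assumes "(a, b) \<in> Gbar" "(a', b') \<in> Gbar"
  shows "(amult A a a', amult B b b') \<in> Gbar"
proof -
  obtain s t where st: "\<And>n. (s n, t n) \<in> G" "A.converges s a" "B.converges t b"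
    using GbarD[OF assms(1)] by blast
  obtain s' t' where st': "\<And>n. (s' n, t' n) \<in> G" "A.converges s' a'" "B.converges t' b'"
    using GbarD[OF assms(2)] by blast
  show ?thesis
    by (rule GbarI[OF mult[OF st(1) st'(1)] A.converges_mult[OF st(2) st'(2)]
          B.converges_mult[OF st(3) st'(3)]])
qed

lemma Gbar_star:
  assumes "(a, b) \<in> Gbar"
  shows "(astar A a, astar B b) \<in> Gbar"
proof -
  obtain s t where st: "\<And>n. (s n, t n) \<in> G" "A.converges s a" "B.converges t b"
    using GbarD[OF assms] by blast
  show ?thesis
    by (rule GbarI[OF star[OF st(1)] A.converges_star[OF st(2)] B.converges_star[OF st(3)]])
qed

lemma Gbar_in_Dom: "(a, b) \<in> Gbar \<Longrightarrow> a \<in> Dom"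
  using Gbar_subset by auto

text \<open>The domain of a relation that is closed under the operations is itself closed under
  them. This is how the closures of the generated *-algebras are recognised as algebras.\<close>

lemma star_subalgebra_dom: "star_subalgebra A Dom"
proof -
  have "aadd A x y \<in> Dom \<and> amult A x y \<in> Dom \<and> ascale A c x \<in> Dom \<and> astar A x \<in> Dom"
    if xy: "x \<in> Dom" "y \<in> Dom" for x y c
  proof -
    obtain u where u: "(x, u) \<in> Gbar" using Gbar_total[OF xy(1)] by blast
    obtain v where v: "(y, v) \<in> Gbar" using Gbar_total[OF xy(2)] by blast
    show ?thesis
      using Gbar_in_Dom[OF Gbar_add[OF u v]] Gbar_in_Dom[OF Gbar_mult[OF u v]]
        Gbar_in_Dom[OF Gbar_scale[OF u]] Gbar_in_Dom[OF Gbar_star[OF u]] by simp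
  qed
  moreover have "azero A \<in> Dom" by (rule Gbar_in_Dom[OF Gbar_zero])
  ultimately show ?thesis using dom_subset by (auto simp: star_subalgebra_def)
qed

definition lift :: "'a \<Rightarrow> 'b" where
  "lift a = (THE b. (a, b) \<in> Gbar)"

lemma lift_eq: "(a, b) \<in> Gbar \<Longrightarrow> lift a = b"
  unfolding lift_def using Gbar_unique by blast

lemma lift_Gbar: "a \<in> Dom \<Longrightarrow> (a, lift a) \<in> Gbar"
  using Gbar_total lift_eq by metis

lemma lift_converges:
  assumes "range s \<subseteq> Dom" "A.converges s a"
  shows "a \<in> Dom" "B.converges (\<lambda>n. lift (s n)) (lift a)"
proof -
  show a: "a \<in> Dom" by (rule A.closedin_converges[OF closedin_closure_of assms])
  show "B.converges (\<lambda>n. lift (s n)) (lift a)"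
  proof (rule B.converges_le[OF _ _ _ A.convergesD(3)[OF assms(2)]])
    have G: "(s n, lift (s n)) \<in> Gbar" "(a, lift a) \<in> Gbar" for n
      using assms a lift_Gbar by auto
    then show "lift (s n) \<in> carrier B" "lift a \<in> carrier B"
      "dB (lift (s n)) (lift a) \<le> dA (s n) a" for n
      using Gbar_subset cod_subset Gbar_contractive by blast+
  qed
qed

text \<open>The target carrier \<open>C\<close> is left open: it is the closure of the image for
  \<open>phi\<close> and all of \<open>CC\<close> for \<open>gamma\<close>.\<close>

lemma lift_star_hom:
  assumes "A' = A\<lparr>carrier := Dom\<rparr>" "B' = B\<lparr>carrier := C\<rparr>" "Cod \<subseteq> C"
  shows "lift \<in> star_hom A' B'"
proof -
  have "lift x \<in> C" if "x \<in> Dom" for x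
    using lift_Gbar[OF that] Gbar_subset assms(3) by blast
  moreover have "lift (aadd A x y) = aadd B (lift x) (lift y)"
    "lift (amult A x y) = amult B (lift x) (lift y)" if "x \<in> Dom" "y \<in> Dom" for x y
    using that by (simp_all add: lift_eq Gbar_add Gbar_mult lift_Gbar)
  moreover have "lift (ascale A c x) = ascale B c (lift x)"
    "lift (astar A x) = astar B (lift x)" if "x \<in> Dom" for c x
    using that by (simp_all add: lift_eq Gbar_scale Gbar_star lift_Gbar)
  ultimately show ?thesis
    unfolding star_hom_def assms(1,2) by simp
qed

end

section \<open>Hilbert spaces\<close>

text \<open>Existence of adjoints is part of the locale. For \<open>ell2 X\<close> it is verified
  from matrix entries, in place of the Riesz representation theorem.\<close>

locale hilbert = prehilbert +
  assumes complete: "hmetric.mcomplete"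
    and adjoint_exists: "T \<in> bounded_ops H
      \<Longrightarrow> \<exists>S\<in>bounded_ops H. \<forall>x\<in>carrier H. \<forall>y\<in>carrier H. cinner H (T x) y = cinner H x (S y)"
begin

lemma adjoint_closed [simp]: "T \<in> bounded_ops H \<Longrightarrow> adjoint_op H T \<in> bounded_ops H"
  using adjoint_exists adjoint_eqI by metis

lemma cinner_adjoint:
  "\<lbrakk>T \<in> bounded_ops H; x \<in> carrier H; y \<in> carrier H\<rbrakk>
    \<Longrightarrow> cinner H (T x) y = cinner H x (adjoint_op H T y)"
  using adjoint_exists adjoint_eqI by metis

lemma cinner_adjoint':
  assumes "T \<in> bounded_ops H" "x \<in> carrier H" "y \<in> carrier H"
  shows "cinner H (adjoint_op H T x) y = cinner H x (T y)"
  using cinner_adjoint[OF assms(1,3,2)] assms cinner_commute op_closed adjoint_closed by metis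

lemma adjoint_adjoint [simp]: "T \<in> bounded_ops H \<Longrightarrow> adjoint_op H (adjoint_op H T) = T"
  by (rule adjoint_eqI) (auto simp: cinner_adjoint')

lemma adjoint_zero: "adjoint_op H (\<lambda>x\<in>carrier H. vzero H) = (\<lambda>x\<in>carrier H. vzero H)"
  by (rule adjoint_eqI[OF zero_op_closed]) simp

lemma adjoint_add:
  assumes "S \<in> bounded_ops H" "T \<in> bounded_ops H"
  shows "adjoint_op H (\<lambda>x\<in>carrier H. vadd H (S x) (T x)) =
    (\<lambda>x\<in>carrier H. vadd H (adjoint_op H S x) (adjoint_op H T x))"
  by (rule adjoint_eqI[OF add_op_closed])
    (use assms in \<open>simp_all add: op_closed cinner_adjoint\<close>)

lemma adjoint_scale:
  assumes "T \<in> bounded_ops H"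
  shows "adjoint_op H (\<lambda>x\<in>carrier H. vscale H c (T x)) =
    (\<lambda>x\<in>carrier H. vscale H (cnj c) (adjoint_op H T x))"
  by (rule adjoint_eqI[OF scale_op_closed])
    (use assms in \<open>simp_all add: op_closed cinner_adjoint\<close>)

lemma adjoint_compose:
  assumes "S \<in> bounded_ops H" "T \<in> bounded_ops H"
  shows "adjoint_op H (compose (carrier H) S T) =
    compose (carrier H) (adjoint_op H T) (adjoint_op H S)"
  by (rule adjoint_eqI[OF compose_op_closed])
    (use assms in \<open>simp_all add: op_closed cinner_adjoint compose_eq\<close>)

lemma op_dist_adjoint:
  assumes S: "S \<in> bounded_ops H" and T: "T \<in> bounded_ops H"
  shows "op_dist H (adjoint_op H S) (adjoint_op H T) \<le> op_dist H S T"
proof (rule op_dist_leI)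
  fix x assume x: "x \<in> carrier H"
  \<comment> \<open>With \<open>y\<close> the difference of the two adjoints at \<open>x\<close>,
    the squared norm of \<open>y\<close> is the inner product of \<open>S y - T y\<close> with
    \<open>x\<close>. Cauchy-Schwarz and division by the norm of \<open>y\<close> finish the
    estimate.\<close>
  define y where "y = vdiff H (adjoint_op H S x) (adjoint_op H T x)"
  have y: "y \<in> carrier H" using x S T by (simp add: y_def op_closed)
  show "hnorm H (vdiff H (adjoint_op H S x) (adjoint_op H T x)) \<le> op_dist H S T * hnorm H x"
  proof (cases "hnorm H y = 0")
    case True
    then show ?thesis using x by (simp flip: y_def del: hnorm_eq_0_iff)
  next
    case False
    then have pos: "hnorm H y > 0" using y hnorm_nonneg by (simp add: order_less_le del: hnorm_eq_0_iff)
    have "cinner H y y = cinner H y (adjoint_op H S x) - cinner H y (adjoint_op H T x)"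
      by (subst (2) y_def) (use x y S T in \<open>simp add: op_closed\<close>)
    also have "\<dots> = cinner H (vdiff H (S y) (T y)) x"
      using x y S T by (simp add: op_closed cinner_adjoint)
    finally have "(hnorm H y)\<^sup>2 = cmod (cinner H (vdiff H (S y) (T y)) x)"
      using cinner_self[OF y] by (metis abs_power2 norm_of_real)
    also have "\<dots> \<le> hnorm H (vdiff H (S y) (T y)) * hnorm H x"
      by (rule Cauchy_Schwarz) (use x y S T in \<open>simp_all add: op_closed\<close>)
    also have "\<dots> \<le> op_dist H S T * hnorm H y * hnorm H x"
      by (rule mult_right_mono) (use op_dist_bound[OF S T y] x in simp_all)
    finally have "hnorm H y * hnorm H y \<le> op_dist H S T * hnorm H x * hnorm H y"
      by (simp add: power2_eq_square mult_ac)
    then show ?thesis using pos by (simp flip: y_def)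
  qed
qed simp

lemma op_algebra_simps [simp]:
  "carrier (op_algebra H) = bounded_ops H"
  "azero (op_algebra H) = (\<lambda>x\<in>carrier H. vzero H)"
  "aadd (op_algebra H) S T = (\<lambda>x\<in>carrier H. vadd H (S x) (T x))"
  "ascale (op_algebra H) c T = (\<lambda>x\<in>carrier H. vscale H c (T x))"
  "amult (op_algebra H) S T = compose (carrier H) S T"
  "astar (op_algebra H) T = adjoint_op H T"
  by (simp_all add: op_algebra_def)

sublocale ops: metric_star_algebra "op_algebra H" "op_dist H"
  rewrites "carrier (op_algebra H) = bounded_ops H"
proof -
  show "metric_star_algebra (op_algebra H) (op_dist H)"
  proof (unfold_locales, unfold op_algebra_simps)
    show "star_subalgebra (op_algebra H) (bounded_ops H)"
      by (simp add: star_subalgebra_def zero_op_closed add_op_closed scale_op_closed compose_op_closed)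
  qed (use opmetric.commute opmetric.triangle op_dist_add op_dist_scale op_dist_compose
      op_dist_adjoint in auto)
qed simp

lemma mcomplete_ops: "opmetric.mcomplete"
  by (rule mcomplete_bounded_ops[OF complete])

end

section \<open>Square summable functions\<close>

context prehilbert
begin

definition hconverges :: "(nat \<Rightarrow> 'v) \<Rightarrow> 'v \<Rightarrow> bool" where
  "hconverges s x \<longleftrightarrow>
    (\<forall>n. s n \<in> carrier H) \<and> x \<in> carrier H \<and> (\<lambda>n. hnorm H (vdiff H (s n) x)) \<longlonglongrightarrow> 0"

lemma hconvergesD:
  assumes "hconverges s x"
  shows "s n \<in> carrier H" "x \<in> carrier H" "(\<lambda>n. hnorm H (vdiff H (s n) x)) \<longlonglongrightarrow> 0"
  using assms by (auto simp: hconverges_def)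

lemma hconverges_cinner:
  assumes "hconverges s x" "y \<in> carrier H"
  shows "(\<lambda>n. cinner H (s n) y) \<longlonglongrightarrow> cinner H x y"
proof (rule LIM_zero_cancel, rule Lim_null_comparison)
  note [simp] = hconvergesD(1,2)[OF assms(1)] assms(2)
  show "\<forall>\<^sub>F n in sequentially. norm (cinner H (s n) y - cinner H x y)
      \<le> hnorm H (vdiff H (s n) x) * hnorm H y"
    using Cauchy_Schwarz[of "vdiff H (s _) x" y] by simp
  show "(\<lambda>n. hnorm H (vdiff H (s n) x) * hnorm H y) \<longlonglongrightarrow> 0"
    using tendsto_mult_right[OF hconvergesD(3)[OF assms(1)]] by simp
qed

lemma hconverges_hnorm:
  assumes "hconverges s x"
  shows "(\<lambda>n. hnorm H (s n)) \<longlonglongrightarrow> hnorm H x"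
proof (rule LIM_zero_cancel, rule Lim_null_comparison[OF _ hconvergesD(3)[OF assms]])
  note [simp] = hconvergesD(1,2)[OF assms]
  have "\<bar>hnorm H (s n) - hnorm H x\<bar> \<le> hnorm H (vdiff H (s n) x)" for n
    using hnorm_le_vdiff[of "s n" x] hnorm_le_vdiff[of x "s n"]
    by (simp add: hnorm_vdiff_commute[of x] abs_le_iff)
  then show "\<forall>\<^sub>F n in sequentially. norm (hnorm H (s n) - hnorm H x) \<le> hnorm H (vdiff H (s n) x)"
    by simp
qed

lemma hconverges_op:
  assumes "hconverges s x" "T \<in> bounded_ops H"
  shows "hconverges (\<lambda>n. T (s n)) (T x)"
proof -
  note [simp] = hconvergesD(1,2)[OF assms(1)]
  have "(\<lambda>n. hnorm H (vdiff H (T (s n)) (T x))) \<longlonglongrightarrow> 0"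
  proof (rule Lim_null_comparison)
    show "\<forall>\<^sub>F n in sequentially. norm (hnorm H (vdiff H (T (s n)) (T x)))
        \<le> op_norm H T * hnorm H (vdiff H (s n) x)"
      using op_norm_bound[OF assms(2), of "vdiff H (s _) x"] assms(2) op_closed[OF assms(2)]
      by (simp add: op_vdiff)
    show "(\<lambda>n. op_norm H T * hnorm H (vdiff H (s n) x)) \<longlonglongrightarrow> 0"
      using tendsto_mult_left[OF hconvergesD(3)[OF assms(1)]] by simp
  qed
  then show ?thesis by (simp add: hconverges_def op_closed[OF assms(2)])
qed

lemma hconverges_unique:
  assumes "hconverges s x" "hconverges s y"
  shows "x = y"
proof (rule vec_eqI)
  fix w assume "w \<in> carrier H"
  then show "cinner H x w = cinner H y w"
    using LIMSEQ_unique assms hconverges_cinner by blast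
qed (use assms hconvergesD in auto)

lemma hconverges_add:
  assumes "hconverges s x" "hconverges t y"
  shows "hconverges (\<lambda>n. vadd H (s n) (t n)) (vadd H x y)"
proof -
  note [simp] = hconvergesD(1,2)[OF assms(1)] hconvergesD(1,2)[OF assms(2)]
  have "(\<lambda>n. hnorm H (vdiff H (s n) x) + hnorm H (vdiff H (t n) y)) \<longlonglongrightarrow> 0"
    using tendsto_add[OF hconvergesD(3)[OF assms(1)] hconvergesD(3)[OF assms(2)]] by simp
  then have "(\<lambda>n. hnorm H (vdiff H (vadd H (s n) (t n)) (vadd H x y))) \<longlonglongrightarrow> 0"
    by (rule real_tendsto_sandwich[OF _ _ tendsto_const, rotated -1])
      (auto simp: vdiff_add hnorm_triangle)
  then show ?thesis by (simp add: hconverges_def)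
qed

lemma hconverges_scale:
  assumes "hconverges s x"
  shows "hconverges (\<lambda>n. vscale H c (s n)) (vscale H c x)"
proof -
  note [simp] = hconvergesD(1,2)[OF assms]
  have "(\<lambda>n. hnorm H (vdiff H (vscale H c (s n)) (vscale H c x))) \<longlonglongrightarrow> 0"
    using tendsto_mult_left[OF hconvergesD(3)[OF assms], of "cmod c"] by (simp add: vdiff_scale)
  then show ?thesis by (simp add: hconverges_def)
qed

lemma hconverges_cinner2:
  assumes "hconverges s x" "hconverges t y"
  shows "(\<lambda>n. cinner H (s n) (t n)) \<longlonglongrightarrow> cinner H x y"
proof (rule LIM_zero_cancel, rule Lim_null_comparison)
  note [simp] = hconvergesD(1,2)[OF assms(1)] hconvergesD(1,2)[OF assms(2)]
  let ?b = "\<lambda>n. hnorm H (vdiff H (s n) x) * hnorm H (t n) + hnorm H x * hnorm H (vdiff H (t n) y)"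
  have "norm (cinner H (s n) (t n) - cinner H x y) \<le> ?b n" for n
  proof -
    have "cinner H (s n) (t n) - cinner H x y = cinner H (vdiff H (s n) x) (t n) + cinner H x (vdiff H (t n) y)"
      by simp
    also have "cmod \<dots> \<le> cmod (cinner H (vdiff H (s n) x) (t n)) + cmod (cinner H x (vdiff H (t n) y))"
      by (rule norm_triangle_ineq)
    also have "\<dots> \<le> ?b n" by (intro add_mono Cauchy_Schwarz) simp_all
    finally show ?thesis .
  qed
  then show "\<forall>\<^sub>F n in sequentially. norm (cinner H (s n) (t n) - cinner H x y) \<le> ?b n" by simp
  have "?b \<longlonglongrightarrow> 0 * hnorm H y + hnorm H x * 0"
    by (intro tendsto_intros hconvergesD(3)[OF assms(1)] hconvergesD(3)[OF assms(2)] hconverges_hnorm[OF assms(2)])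
  then show "?b \<longlonglongrightarrow> 0" by simp
qed

lemma hconverges_limitin: "(\<forall>n. s n \<in> carrier H) \<Longrightarrow> limitin (htopology H) s x sequentially \<longleftrightarrow> hconverges s x"
  by (auto simp: hmetric.limitin_metric_dist_null hconverges_def)

lemma hconverges_MCauchy: "hconverges s x \<Longrightarrow> hmetric.MCauchy s"
  using hmetric.convergent_imp_MCauchy[of s x] hconvergesD hconverges_limitin by blast

lemma mcomplete_hconverges:
  assumes "hmetric.mcomplete" "hmetric.MCauchy s"
  shows "\<exists>x. hconverges s x"
proof -
  have "\<forall>n. s n \<in> carrier H" using assms(2) by (auto simp: hmetric.MCauchy_def)
  then show ?thesis using assms hconverges_limitin unfolding hmetric.mcomplete_def by blast
qed

lemma hconverges_Suc: "hconverges s x \<Longrightarrow> hconverges (\<lambda>n. s (Suc n)) x"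
  unfolding hconverges_def using LIMSEQ_Suc by blast

lemma prehilbert_subspace:
  assumes "closed_subspace H W"
  shows "prehilbert (H\<lparr>carrier := W\<rparr>)"
proof -
  have W: "W \<subseteq> carrier H" using assms by (simp add: closed_subspace_def)
  note c = subsetD[OF W]
  have vd: "vdiff (H\<lparr>carrier := W\<rparr>) = vdiff H" by (simp add: vdiff_def fun_eq_iff)
  show ?thesis
    by unfold_locales
      (use assms c in \<open>auto simp: closed_subspace_def vd cinner_self_nonneg
        intro: cinner_commute eq_if_cinner_vdiff_0\<close>)
qed

end

section \<open>The inner product spaces of square summable functions\<close>

abbreviation l2 :: "(int \<Rightarrow> complex) set" where
  "l2 \<equiv> carrier (ell2 UNIV)"

lemma ell2_simps [simp]:
  "vzero (ell2 X) = (\<lambda>x. 0)"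
  "vadd (ell2 X) \<xi> \<eta> = (\<lambda>x. \<xi> x + \<eta> x)"
  "vscale (ell2 X) c \<xi> = (\<lambda>x. c * \<xi> x)"
  "vdiff (ell2 X) \<xi> \<eta> = (\<lambda>x. \<xi> x - \<eta> x)"
  by (simp_all add: ell2_def vdiff_def)

lemma cinner_ell2: "cinner (ell2 X) \<xi> \<eta> = (\<Sum>\<^sub>\<infinity>x\<in>X. \<xi> x * cnj (\<eta> x))"
  by (simp add: ell2_def)

lemma ell2_iff:
  "\<xi> \<in> carrier (ell2 X) \<longleftrightarrow>
    (\<forall>x. x \<notin> X \<longrightarrow> \<xi> x = 0) \<and> (\<lambda>x. (cmod (\<xi> x))\<^sup>2) summable_on X"
  by (simp add: ell2_def)

lemma ell2_iff_UNIV: "\<xi> \<in> carrier (ell2 X) \<longleftrightarrow> (\<forall>x. x \<notin> X \<longrightarrow> \<xi> x = 0) \<and> \<xi> \<in> l2"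
proof -
  have "(\<lambda>x. (cmod (\<xi> x))\<^sup>2) summable_on X \<longleftrightarrow> (\<lambda>x. (cmod (\<xi> x))\<^sup>2) summable_on UNIV"
    if "\<forall>x. x \<notin> X \<longrightarrow> \<xi> x = 0"
    by (rule summable_on_cong_neutral) (use that in auto)
  then show ?thesis by (auto simp: ell2_iff)
qed

lemma ell2_outside: "\<lbrakk>\<xi> \<in> carrier (ell2 X); x \<notin> X\<rbrakk> \<Longrightarrow> \<xi> x = 0"
  by (simp add: ell2_iff)

lemma ell2_in_l2: "\<xi> \<in> carrier (ell2 X) \<Longrightarrow> \<xi> \<in> l2"
  using ell2_iff_UNIV by blast

text \<open>All spaces \<open>ell2 X\<close> live in one type of functions on the integers, so
  \<open>ell2 \<nat>\<close> is literally a subspace of \<open>l2\<close>. Operators on the two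
  spaces can thus be compared on the same vectors without an inclusion map.\<close>

lemma cinner_ell2_UNIV:
  "\<xi> \<in> carrier (ell2 X) \<Longrightarrow> cinner (ell2 X) \<xi> \<eta> = cinner (ell2 UNIV) \<xi> \<eta>"
  unfolding cinner_ell2 by (rule infsum_cong_neutral) (auto simp: ell2_outside)

lemma hnorm_ell2_UNIV: "\<xi> \<in> carrier (ell2 X) \<Longrightarrow> hnorm (ell2 X) \<xi> = hnorm (ell2 UNIV) \<xi>"
  by (simp add: hnorm_def cinner_ell2_UNIV)

lemma ell2_summable_mult:
  assumes "\<xi> \<in> carrier (ell2 X)" "\<eta> \<in> carrier (ell2 X)"
  shows "(\<lambda>x. \<xi> x * cnj (\<eta> x)) summable_on X"
proof (rule Infinite_Sum.abs_summable_summable, rule Infinite_Sum.abs_summable_product)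
  show "(\<lambda>i. norm (\<xi> i * \<xi> i)) summable_on X" "(\<lambda>i. norm (cnj (\<eta> i) * cnj (\<eta> i))) summable_on X"
    using assms by (simp_all add: ell2_iff norm_mult power2_eq_square)
qed

lemma hnorm_ell2_sq:
  assumes "\<xi> \<in> carrier (ell2 X)"
  shows "(hnorm (ell2 X) \<xi>)\<^sup>2 = (\<Sum>\<^sub>\<infinity>x\<in>X. (cmod (\<xi> x))\<^sup>2)"
proof -
  have "Re (cinner (ell2 X) \<xi> \<xi>) = (\<Sum>\<^sub>\<infinity>x\<in>X. Re (\<xi> x * cnj (\<xi> x)))"
    unfolding cinner_ell2 by (rule infsum_Re[symmetric, OF ell2_summable_mult[OF assms assms]])
  also have "\<dots> = (\<Sum>\<^sub>\<infinity>x\<in>X. (cmod (\<xi> x))\<^sup>2)"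
    by (rule infsum_cong) (simp add: cmod_power2 flip: power2_eq_square)
  finally show ?thesis by (simp add: hnorm_def infsum_nonneg)
qed

lemma hnorm_ell2_nonneg: "\<xi> \<in> carrier (ell2 X) \<Longrightarrow> 0 \<le> hnorm (ell2 X) \<xi>"
proof -
  assume \<xi>: "\<xi> \<in> carrier (ell2 X)"
  have "Re (cinner (ell2 X) \<xi> \<xi>) = (\<Sum>\<^sub>\<infinity>x\<in>X. Re (\<xi> x * cnj (\<xi> x)))"
    unfolding cinner_ell2 by (rule infsum_Re[symmetric, OF ell2_summable_mult[OF \<xi> \<xi>]])
  also have "\<dots> \<ge> 0" by (rule infsum_nonneg) simp
  finally show ?thesis by (simp add: hnorm_def)
qed

lemma ell2_finite_sum_le:
  assumes "\<xi> \<in> carrier (ell2 X)" "finite F"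
  shows "(\<Sum>x\<in>F. (cmod (\<xi> x))\<^sup>2) \<le> (hnorm (ell2 X) \<xi>)\<^sup>2"
proof -
  have "(\<Sum>x\<in>F. (cmod (\<xi> x))\<^sup>2) = (\<Sum>x\<in>F \<inter> X. (cmod (\<xi> x))\<^sup>2)"
    using assms by (intro sum.mono_neutral_right) (auto simp: ell2_outside)
  also have "\<dots> \<le> (\<Sum>\<^sub>\<infinity>x\<in>X. (cmod (\<xi> x))\<^sup>2)"
    using assms by (intro finite_sum_le_infsum) (auto simp: ell2_iff)
  finally show ?thesis using hnorm_ell2_sq[OF assms(1)] by simp
qed

text \<open>Bounded finite partial sums give membership and the norm bound together. Truncations,
  translations, coordinatewise limits and adjoints are all handled in this way.\<close>

lemma ell2I:
  assumes "\<And>x. x \<notin> X \<Longrightarrow> \<xi> x = 0" "0 \<le> C"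
    "\<And>F. \<lbrakk>finite F; F \<subseteq> X\<rbrakk> \<Longrightarrow> (\<Sum>x\<in>F. (cmod (\<xi> x))\<^sup>2) \<le> C\<^sup>2"
  shows "\<xi> \<in> carrier (ell2 X)" "hnorm (ell2 X) \<xi> \<le> C"
proof -
  have s: "(\<lambda>x. (cmod (\<xi> x))\<^sup>2) summable_on X"
    by (rule nonneg_bdd_above_summable_on) (use assms(3) in \<open>auto intro!: bdd_aboveI2\<close>)
  then show \<xi>: "\<xi> \<in> carrier (ell2 X)" using assms(1) by (simp add: ell2_iff)
  have "(\<Sum>\<^sub>\<infinity>x\<in>X. (cmod (\<xi> x))\<^sup>2) \<le> C\<^sup>2"
    by (rule infsum_le_finite_sums[OF s]) (use assms(3) in auto)
  then have "(hnorm (ell2 X) \<xi>)\<^sup>2 \<le> C\<^sup>2" using hnorm_ell2_sq[OF \<xi>] by simp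
  then show "hnorm (ell2 X) \<xi> \<le> C" by (rule power2_le_imp_le) (rule assms(2))
qed

lemma ell2_add_closed:
  assumes "\<xi> \<in> carrier (ell2 X)" "\<eta> \<in> carrier (ell2 X)"
  shows "(\<lambda>x. \<xi> x + \<eta> x) \<in> carrier (ell2 X)"
proof (rule ell2I(1))
  let ?S = "2 * (hnorm (ell2 X) \<xi>)\<^sup>2 + 2 * (hnorm (ell2 X) \<eta>)\<^sup>2"
  fix F :: "int set" assume "finite F"
  have *: "(cmod (\<xi> x + \<eta> x))\<^sup>2 \<le> 2 * (cmod (\<xi> x))\<^sup>2 + 2 * (cmod (\<eta> x))\<^sup>2" for x
  proof -
    have "(cmod (\<xi> x + \<eta> x))\<^sup>2 \<le> (cmod (\<xi> x) + cmod (\<eta> x))\<^sup>2"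
      by (rule power_mono[OF norm_triangle_ineq]) simp
    also have "\<dots> \<le> 2 * (cmod (\<xi> x))\<^sup>2 + 2 * (cmod (\<eta> x))\<^sup>2"
      using sum_squares_bound[of "cmod (\<xi> x)" "cmod (\<eta> x)"] by (simp add: power2_sum)
    finally show ?thesis .
  qed
  have "(\<Sum>x\<in>F. (cmod (\<xi> x + \<eta> x))\<^sup>2) \<le> 2 * (\<Sum>x\<in>F. (cmod (\<xi> x))\<^sup>2) + 2 * (\<Sum>x\<in>F. (cmod (\<eta> x))\<^sup>2)"
    unfolding sum_distrib_left sum.distrib[symmetric] by (rule sum_mono) (rule *)
  also have "\<dots> \<le> ?S"
    using ell2_finite_sum_le[OF assms(1) \<open>finite F\<close>] ell2_finite_sum_le[OF assms(2) \<open>finite F\<close>]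
    by simp
  also have "\<dots> = (sqrt ?S)\<^sup>2" by simp
  finally show "(\<Sum>x\<in>F. (cmod (\<xi> x + \<eta> x))\<^sup>2) \<le> (sqrt ?S)\<^sup>2" .
qed (simp_all add: assms[THEN ell2_outside])

lemma ell2_zero_closed: "(\<lambda>x. 0) \<in> carrier (ell2 X)"
  by (simp add: ell2_iff)

lemma ell2_scale_closed:
  assumes "\<xi> \<in> carrier (ell2 X)"
  shows "(\<lambda>x. c * \<xi> x) \<in> carrier (ell2 X)"
  using assms by (auto simp: ell2_iff norm_mult power_mult_distrib intro: summable_on_cmult_right)

lemma prehilbert_ell2: "prehilbert (ell2 X)"
proof
  fix \<xi> \<eta> \<zeta> assume [simp]: "\<xi> \<in> carrier (ell2 X)" "\<eta> \<in> carrier (ell2 X)"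
  show "cinner (ell2 X) (vadd (ell2 X) \<xi> \<eta>) \<zeta> = cinner (ell2 X) \<xi> \<zeta> + cinner (ell2 X) \<eta> \<zeta>"
    if "\<zeta> \<in> carrier (ell2 X)"
    using that by (simp add: cinner_ell2 ring_distribs infsum_add ell2_summable_mult)
  show "cinner (ell2 X) (vscale (ell2 X) c \<xi>) \<eta> = c * cinner (ell2 X) \<xi> \<eta>" for c
    by (simp add: cinner_ell2 mult.assoc infsum_cmult_right')
  show "cinner (ell2 X) \<eta> \<xi> = cnj (cinner (ell2 X) \<xi> \<eta>)"
    by (simp add: cinner_ell2 mult.commute flip: infsum_cnj)
  assume 0: "cinner (ell2 X) (vdiff (ell2 X) \<xi> \<eta>) (vdiff (ell2 X) \<xi> \<eta>) = 0"
  have d: "(\<lambda>x. \<xi> x - \<eta> x) \<in> carrier (ell2 X)"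
    using ell2_add_closed[OF _ ell2_scale_closed[of \<eta> X "-1"], of \<xi>] by simp
  have "(hnorm (ell2 X) (\<lambda>x. \<xi> x - \<eta> x))\<^sup>2 = 0" using 0 by (simp add: hnorm_def)
  then have "(cmod (\<xi> x - \<eta> x))\<^sup>2 \<le> 0" for x
    using ell2_finite_sum_le[OF d, of "{x}"] by simp
  then show "\<xi> = \<eta>" by (simp add: fun_eq_iff)
next
  fix \<xi> assume \<xi>: "\<xi> \<in> carrier (ell2 X)"
  show "0 \<le> Re (cinner (ell2 X) \<xi> \<xi>)"
    using hnorm_ell2_nonneg[OF \<xi>] by (simp add: hnorm_def)
qed (simp_all add: ell2_zero_closed ell2_add_closed ell2_scale_closed cinner_ell2)

interpretation ell2: prehilbert "ell2 X" for X
  by (rule prehilbert_ell2)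

lemma ell2_diff_closed:
  "\<lbrakk>\<xi> \<in> carrier (ell2 X); \<eta> \<in> carrier (ell2 X)\<rbrakk> \<Longrightarrow> (\<lambda>x. \<xi> x - \<eta> x) \<in> carrier (ell2 X)"
  using ell2.vdiff_closed[of \<xi> X \<eta>] by simp

lemma ell2_coord_le: "\<xi> \<in> carrier (ell2 X) \<Longrightarrow> cmod (\<xi> x) \<le> hnorm (ell2 X) \<xi>"
  using ell2_finite_sum_le[of \<xi> X "{x}"] by (auto simp: hnorm_ell2_nonneg intro: power2_le_imp_le)

lemma cinner_ell2_delta:
  assumes "x \<in> X"
  shows "cinner (ell2 X) \<xi> (ell2_delta x) = \<xi> x"
proof -
  have "(\<Sum>\<^sub>\<infinity>y\<in>X. \<xi> y * cnj (ell2_delta x y)) = (\<Sum>\<^sub>\<infinity>y\<in>{x}. \<xi> y * cnj (ell2_delta x y))"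
    by (rule infsum_cong_neutral) (use assms in \<open>auto simp: ell2_delta_def\<close>)
  then show ?thesis by (simp add: cinner_ell2 ell2_delta_def)
qed

section \<open>Truncations, density and completeness\<close>

definition cut :: "int set \<Rightarrow> (int \<Rightarrow> complex) \<Rightarrow> (int \<Rightarrow> complex)" where
  "cut F \<xi> = (\<lambda>x. if x \<in> F then \<xi> x else 0)"

lemma cut_closed:
  assumes "\<xi> \<in> carrier (ell2 X)"
  shows "cut F \<xi> \<in> carrier (ell2 X)" "hnorm (ell2 X) (cut F \<xi>) \<le> hnorm (ell2 X) \<xi>"
proof -
  have "(\<Sum>x\<in>E. (cmod (cut F \<xi> x))\<^sup>2) \<le> (hnorm (ell2 X) \<xi>)\<^sup>2" if "finite E" for E
  proof -
    have "(\<Sum>x\<in>E. (cmod (cut F \<xi> x))\<^sup>2) \<le> (\<Sum>x\<in>E. (cmod (\<xi> x))\<^sup>2)"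
      by (rule sum_mono) (simp add: cut_def)
    then show ?thesis using ell2_finite_sum_le[OF assms that] by simp
  qed
  then show "cut F \<xi> \<in> carrier (ell2 X)" "hnorm (ell2 X) (cut F \<xi>) \<le> hnorm (ell2 X) \<xi>"
    using ell2I[of X "cut F \<xi>" "hnorm (ell2 X) \<xi>"] assms ell2_outside[OF assms]
    by (auto simp: cut_def hnorm_ell2_nonneg)
qed

lemma finite_support_ell2:
  assumes "finite F" "\<And>x. x \<notin> F \<inter> X \<Longrightarrow> \<xi> x = 0"
  shows "\<xi> \<in> carrier (ell2 X)" "(hnorm (ell2 X) \<xi>)\<^sup>2 = (\<Sum>x\<in>F. (cmod (\<xi> x))\<^sup>2)"
proof -
  have "(\<lambda>x. (cmod (\<xi> x))\<^sup>2) summable_on X \<longleftrightarrow> (\<lambda>x. (cmod (\<xi> x))\<^sup>2) summable_on F"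
    by (rule summable_on_cong_neutral) (use assms in auto)
  then show \<xi>: "\<xi> \<in> carrier (ell2 X)" using assms by (auto simp: ell2_iff)
  have "(\<Sum>\<^sub>\<infinity>x\<in>X. (cmod (\<xi> x))\<^sup>2) = (\<Sum>\<^sub>\<infinity>x\<in>F. (cmod (\<xi> x))\<^sup>2)"
    by (rule infsum_cong_neutral) (use assms in auto)
  then show "(hnorm (ell2 X) \<xi>)\<^sup>2 = (\<Sum>x\<in>F. (cmod (\<xi> x))\<^sup>2)"
    using assms by (simp add: hnorm_ell2_sq[OF \<xi>])
qed

text \<open>The estimate is claimed for every larger \<open>E\<close>, so that one set serves
  finitely many vectors at once and initial segments may be used.\<close>

lemma cut_approx:
  assumes "\<xi> \<in> carrier (ell2 X)" "e > 0"
  obtains F where "finite F" "F \<subseteq> X" "\<And>E. F \<subseteq> E \<Longrightarrow> hnorm (ell2 X) (\<lambda>x. cut E \<xi> x - \<xi> x) \<le> e"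
proof -
  obtain F where F: "finite F" "F \<subseteq> X"
    "dist (\<Sum>x\<in>F. (cmod (\<xi> x))\<^sup>2) (\<Sum>\<^sub>\<infinity>x\<in>X. (cmod (\<xi> x))\<^sup>2) \<le> e\<^sup>2"
    using infsum_finite_approximation[of "\<lambda>x. (cmod (\<xi> x))\<^sup>2" X "e\<^sup>2"] assms
    by (auto simp: ell2_iff)
  have *: "hnorm (ell2 X) (\<lambda>x. cut E \<xi> x - \<xi> x) \<le> e" if "F \<subseteq> E" for E
  proof (rule ell2I(2))
    fix B assume B: "finite B" "B \<subseteq> X"
    have "(\<Sum>x\<in>B. (cmod (cut E \<xi> x - \<xi> x))\<^sup>2) = (\<Sum>x\<in>B - E. (cmod (\<xi> x))\<^sup>2)"
      by (rule sum.mono_neutral_cong_right) (use B in \<open>auto simp: cut_def\<close>)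
    also have "\<dots> \<le> (\<Sum>x\<in>B - F. (cmod (\<xi> x))\<^sup>2)"
      by (rule sum_mono2) (use B that in auto)
    also have "\<dots> = (\<Sum>x\<in>B \<union> F. (cmod (\<xi> x))\<^sup>2) - (\<Sum>x\<in>F. (cmod (\<xi> x))\<^sup>2)"
      using sum_diff[of "B \<union> F" F "\<lambda>x. (cmod (\<xi> x))\<^sup>2"] B F by (simp add: Un_Diff)
    also have "\<dots> \<le> (\<Sum>\<^sub>\<infinity>x\<in>X. (cmod (\<xi> x))\<^sup>2) - (\<Sum>x\<in>F. (cmod (\<xi> x))\<^sup>2)"
      using B F assms by (intro diff_right_mono finite_sum_le_infsum) (auto simp: ell2_iff)
    also have "\<dots> \<le> e\<^sup>2" using F(3) by (simp add: dist_real_def)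
    finally show "(\<Sum>x\<in>B. (cmod (cut E \<xi> x - \<xi> x))\<^sup>2) \<le> e\<^sup>2" .
  qed (use assms ell2_outside[OF assms(1)] in \<open>auto simp: cut_def\<close>)
  show ?thesis by (rule that[OF F(1,2) *])
qed

lemma ell2_dense:
  assumes "\<xi> \<in> carrier (ell2 X)"
  obtains s where "\<And>n. finite {x. s n x \<noteq> 0}" "ell2.hconverges X s \<xi>"
proof -
  have "\<exists>\<eta>\<in>carrier (ell2 X). finite {x. \<eta> x \<noteq> 0} \<and>
      hnorm (ell2 X) (\<lambda>x. \<eta> x - \<xi> x) \<le> inverse (real (Suc n))" for n
  proof -
    have "inverse (real (Suc n)) > 0" by simp
    then obtain F where F: "finite F"
      "\<And>E. F \<subseteq> E \<Longrightarrow> hnorm (ell2 X) (\<lambda>x. cut E \<xi> x - \<xi> x) \<le> inverse (real (Suc n))"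
      using cut_approx[OF assms] by metis
    have "finite {x. cut F \<xi> x \<noteq> 0}"
      by (rule finite_subset[OF _ F(1)]) (auto simp: cut_def)
    then show ?thesis using F(2)[OF order_refl] cut_closed[OF assms] by blast
  qed
  then obtain s where s: "\<And>n. s n \<in> carrier (ell2 X)" "\<And>n. finite {x. s n x \<noteq> 0}"
    "\<And>n. hnorm (ell2 X) (\<lambda>x. s n x - \<xi> x) \<le> inverse (real (Suc n))"
    by metis
  have "(\<lambda>n. hnorm (ell2 X) (vdiff (ell2 X) (s n) \<xi>)) \<longlonglongrightarrow> 0"
    by (rule real_tendsto_sandwich[OF _ _ tendsto_const LIMSEQ_inverse_real_of_nat])
      (use s assms ell2.hnorm_nonneg[of "vdiff (ell2 X) (s _) \<xi>" X] in \<open>auto simp: ell2_diff_closed\<close>)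
  then show ?thesis using that[of s] s assms by (simp add: ell2.hconverges_def)
qed

text \<open>Coordinates converge; the Cauchy estimate on finitely many coordinates passes to the
  limit, and \<open>ell2I\<close> turns it into an estimate in norm.\<close>

lemma ell2_mcomplete: "ell2.hmetric.mcomplete X"
  unfolding ell2.hmetric.mcomplete_def
proof (intro allI impI)
  fix s assume C: "ell2.hmetric.MCauchy X s"
  have s [simp]: "s n \<in> carrier (ell2 X)" for n using C by (auto simp: ell2.hmetric.MCauchy_def)
  have sd [simp]: "(\<lambda>x. s n x - s m x) \<in> carrier (ell2 X)" for n m by (simp add: ell2_diff_closed)
  have N: "\<exists>N. \<forall>n m. N \<le> n \<longrightarrow> N \<le> m \<longrightarrow> hnorm (ell2 X) (\<lambda>x. s n x - s m x) < e" if "e > 0" for e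
    using C that unfolding ell2.hmetric.MCauchy_def by simp
  have "Cauchy (\<lambda>n. s n x)" for x
  proof (rule metric_CauchyI)
    fix e :: real assume "e > 0"
    then obtain N where "\<And>n m. \<lbrakk>N \<le> n; N \<le> m\<rbrakk> \<Longrightarrow> hnorm (ell2 X) (\<lambda>x. s n x - s m x) < e"
      using N by metis
    then show "\<exists>M. \<forall>m\<ge>M. \<forall>n\<ge>M. dist (s m x) (s n x) < e"
      using ell2_coord_le[OF sd, of _ x] unfolding dist_norm by (meson order_le_less_trans)
  qed
  then have "\<forall>x. \<exists>l. (\<lambda>n. s n x) \<longlonglongrightarrow> l" using Cauchy_convergent convergent_def by blast
  then obtain l where l: "\<And>x. (\<lambda>n. s n x) \<longlonglongrightarrow> l x" by metis
  have l0: "l x = 0" if "x \<notin> X" for x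
    using l[of x] ell2_outside[OF s that] by (simp add: LIMSEQ_const_iff)
  have lim: "(\<lambda>x. s n x - l x) \<in> carrier (ell2 X) \<and> hnorm (ell2 X) (\<lambda>x. s n x - l x) \<le> e"
    if e: "e > 0" and n: "n \<ge> N"
      and N: "\<And>n m. \<lbrakk>N \<le> n; N \<le> m\<rbrakk> \<Longrightarrow> hnorm (ell2 X) (\<lambda>x. s n x - s m x) < e" for e n N
  proof -
    have "(\<Sum>x\<in>F. (cmod (s n x - l x))\<^sup>2) \<le> e\<^sup>2" if F: "finite F" for F
    proof (rule LIMSEQ_le_const2)
      show "(\<lambda>m. \<Sum>x\<in>F. (cmod (s n x - s m x))\<^sup>2) \<longlonglongrightarrow> (\<Sum>x\<in>F. (cmod (s n x - l x))\<^sup>2)"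
        by (intro tendsto_intros l)
      have "(\<Sum>x\<in>F. (cmod (s n x - s m x))\<^sup>2) \<le> e\<^sup>2" if "m \<ge> N" for m
        using ell2_finite_sum_le[OF sd F, of n m]
          power_mono[OF less_imp_le[OF N[OF n that]] hnorm_ell2_nonneg[OF sd], of 2]
        by linarith
      then show "\<exists>N. \<forall>m\<ge>N. (\<Sum>x\<in>F. (cmod (s n x - s m x))\<^sup>2) \<le> e\<^sup>2" by blast
    qed
    then show ?thesis
      using ell2I[of X "\<lambda>x. s n x - l x" e] e l0 ell2_outside[OF s] by auto
  qed
  obtain M where M: "\<And>n m. \<lbrakk>M \<le> n; M \<le> m\<rbrakk> \<Longrightarrow> hnorm (ell2 X) (\<lambda>x. s n x - s m x) < 1"
    using N[of 1] by auto
  \<comment> \<open>The estimate provides membership for the difference \<open>s M - l\<close>; that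
    of \<open>l\<close> follows.\<close>
  have "l = (\<lambda>x. s M x - (s M x - l x))" by auto
  then have lc: "l \<in> carrier (ell2 X)"
    using ell2_diff_closed[OF s[of M], of "\<lambda>x. s M x - l x"] lim[OF zero_less_one order_refl M] by simp
  have "limitin (htopology (ell2 X)) s l sequentially"
    unfolding ell2.hmetric.limitin_metric
  proof (intro conjI lc allI impI)
    fix e :: real assume e: "e > 0"
    then obtain N where N: "\<And>n m. \<lbrakk>N \<le> n; N \<le> m\<rbrakk> \<Longrightarrow> hnorm (ell2 X) (\<lambda>x. s n x - s m x) < e / 2"
      using N[of "e/2"] by (metis half_gt_zero)
    have "hdist (ell2 X) (s n) l < e" if "n \<ge> N" for n
      using lim[OF _ that N] e lc by (simp add: ell2.hdist_eq)
    then show "\<forall>\<^sub>F n in sequentially. s n \<in> carrier (ell2 X) \<and> hdist (ell2 X) (s n) l < e"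
      by (auto simp: eventually_sequentially)
  qed
  then show "\<exists>l. limitin (htopology (ell2 X)) s l sequentially" by blast
qed

section \<open>Existence of adjoints\<close>

lemma op_ell2_finite_sum:
  assumes T: "T \<in> bounded_ops (ell2 X)" and y: "y \<in> carrier (ell2 X)"
    and F: "finite F" "F \<subseteq> X"
  shows "cinner (ell2 X) (T (cut F a)) y = (\<Sum>x\<in>F. a x * cinner (ell2 X) (T (ell2_delta x)) y)"
  using F
proof (induction F rule: finite_induct)
  case empty
  have "cut {} a = vzero (ell2 X)" by (simp add: cut_def)
  then show ?case using ell2.op_zero[OF T] y by (simp only: sum.empty ell2.cinner_zero_left)
next
  case (insert z F)
  have d: "ell2_delta z \<in> carrier (ell2 X)" using insert by (simp add: ell2_delta_in_carrier)
  have c: "cut F a \<in> carrier (ell2 X)"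
    by (rule finite_support_ell2(1)[OF insert(1)]) (use insert in \<open>auto simp: cut_def\<close>)
  have "cut (insert z F) a = vadd (ell2 X) (vscale (ell2 X) (a z) (ell2_delta z)) (cut F a)"
    using insert by (auto simp: cut_def ell2_delta_def fun_eq_iff)
  then show ?case
    using insert c d y ell2.op_closed[OF T]
    by (simp only: ell2.op_add[OF T] ell2.op_scale[OF T] ell2.cinner_add_left
        ell2.cinner_scale_left ell2.scale_closed sum.insert insert_subset simp_thms)
qed

text \<open>The coordinate of the adjoint at \<open>x\<close> is forced: pair \<open>y\<close> with
  \<open>T (ell2_delta x)\<close>. The point is square summability of the result.\<close>

lemma ell2_adjoint_exists:
  assumes T: "T \<in> bounded_ops (ell2 X)"
  shows "\<exists>S\<in>bounded_ops (ell2 X). \<forall>x\<in>carrier (ell2 X). \<forall>y\<in>carrier (ell2 X).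
    cinner (ell2 X) (T x) y = cinner (ell2 X) x (S y)"
proof -
  define S where "S = (\<lambda>y\<in>carrier (ell2 X). \<lambda>x.
    if x \<in> X then cinner (ell2 X) y (T (ell2_delta x)) else 0)"
  note Tc [simp] = ell2.op_closed[OF T] ell2_delta_in_carrier
  let ?C = "op_norm (ell2 X) T"
  have C: "0 \<le> ?C" by (rule ell2.op_norm_nonneg[OF T])
  have S: "S y \<in> carrier (ell2 X)" "hnorm (ell2 X) (S y) \<le> ?C * hnorm (ell2 X) y"
    if y: "y \<in> carrier (ell2 X)" for y
  proof -
    \<comment> \<open>Testing \<open>T\<close> on the truncated candidate bounds the square of
      \<open>\<parallel>cut F (S y)\<parallel>\<close> by \<open>?C * \<parallel>y\<parallel> *
      \<parallel>cut F (S y)\<parallel>\<close>. One factor cancels, and the bound is uniform in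
      \<open>F\<close>.\<close>
    have sum: "(\<Sum>x\<in>F. (cmod (S y x))\<^sup>2) \<le> (?C * hnorm (ell2 X) y)\<^sup>2" if F: "finite F" "F \<subseteq> X" for F
    proof -
      let ?s = "\<Sum>x\<in>F. (cmod (S y x))\<^sup>2"
      have z: "cut F (S y) x = 0" if "x \<notin> F \<inter> X" for x
        using F that by (auto simp: cut_def)
      have c: "cut F (S y) \<in> carrier (ell2 X)" "(hnorm (ell2 X) (cut F (S y)))\<^sup>2 = ?s"
        using finite_support_ell2[OF F(1) z] by (simp_all add: cut_def)
      have "cinner (ell2 X) (T (cut F (S y))) y = (\<Sum>x\<in>F. S y x * cinner (ell2 X) (T (ell2_delta x)) y)"
        by (rule op_ell2_finite_sum[OF T y F])
      also have "\<dots> = (\<Sum>x\<in>F. complex_of_real ((cmod (S y x))\<^sup>2))"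
        by (rule sum.cong[OF refl], unfold complex_norm_square)
          (use F y ell2.cinner_commute[OF y] in \<open>auto simp: S_def\<close>)
      finally have "?s = cmod (cinner (ell2 X) (T (cut F (S y))) y)"
        unfolding of_real_sum[symmetric] by (simp only: norm_of_real) (simp add: sum_nonneg)
      also have "\<dots> \<le> hnorm (ell2 X) (T (cut F (S y))) * hnorm (ell2 X) y"
        by (rule ell2.Cauchy_Schwarz) (use c y in simp_all)
      also have "\<dots> \<le> ?C * hnorm (ell2 X) (cut F (S y)) * hnorm (ell2 X) y"
        by (rule mult_right_mono) (use c y ell2.op_norm_bound[OF T] hnorm_ell2_nonneg in simp_all)
      finally have le: "(hnorm (ell2 X) (cut F (S y)))\<^sup>2 \<le>
          ?C * hnorm (ell2 X) y * hnorm (ell2 X) (cut F (S y))"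
        unfolding c(2)[symmetric] by (simp add: mult_ac)
      have "hnorm (ell2 X) (cut F (S y)) \<le> ?C * hnorm (ell2 X) y"
      proof (cases "hnorm (ell2 X) (cut F (S y)) = 0")
        case True
        then show ?thesis using C y by (simp add: hnorm_ell2_nonneg)
      next
        case False
        then have "0 < hnorm (ell2 X) (cut F (S y))"
          using hnorm_ell2_nonneg[OF c(1)] by linarith
        then show ?thesis using le by (simp add: power2_eq_square)
      qed
      then show ?thesis
        unfolding c(2)[symmetric] by (rule power_mono) (rule hnorm_ell2_nonneg[OF c(1)])
    qed
    show "S y \<in> carrier (ell2 X)" "hnorm (ell2 X) (S y) \<le> ?C * hnorm (ell2 X) y"
      by (rule ell2I[OF _ _ sum]; use y C in \<open>simp add: S_def hnorm_ell2_nonneg\<close>)+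
  qed
  have "S \<in> bounded_ops (ell2 X)"
  proof (rule ell2.bounded_opsI[OF S(1) _ _ _ S(2)])
    show "S \<in> extensional (carrier (ell2 X))" unfolding S_def by (rule restrict_extensional)
  next
    fix x y assume "x \<in> carrier (ell2 X)" "y \<in> carrier (ell2 X)"
    then show "S (vadd (ell2 X) x y) = vadd (ell2 X) (S x) (S y)"
      using ell2.cinner_add_left[of x X y] ell2.add_closed[of x X y]
      by (auto simp: S_def fun_eq_iff)
  next
    fix c x assume "x \<in> carrier (ell2 X)"
    then show "S (vscale (ell2 X) c x) = vscale (ell2 X) c (S x)"
      using ell2.cinner_scale_left[of x X _ c] ell2.scale_closed[of x X c]
      by (auto simp: S_def fun_eq_iff)
  qed
  moreover have "cinner (ell2 X) (T x) y = cinner (ell2 X) x (S y)"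
    if x: "x \<in> carrier (ell2 X)" and y: "y \<in> carrier (ell2 X)" for x y
  proof -
    obtain s where s: "\<And>n. finite {x. s n x \<noteq> 0}" "ell2.hconverges X s x"
      using ell2_dense[OF x] by blast
    have "cinner (ell2 X) (T (s n)) y = cinner (ell2 X) (s n) (S y)" for n
    proof -
      let ?F = "{x. s n x \<noteq> 0}"
      have sub: "?F \<subseteq> X" using ell2_outside[OF ell2.hconvergesD(1)[OF s(2)]] by blast
      have cut: "s n = cut ?F (s n)" by (auto simp: cut_def)
      have "cinner (ell2 X) (T (s n)) y = (\<Sum>x\<in>?F. s n x * cinner (ell2 X) (T (ell2_delta x)) y)"
        by (subst cut) (rule op_ell2_finite_sum[OF T y s(1) sub])
      also have "\<dots> = (\<Sum>x\<in>?F. s n x * cnj (S y x))"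
        by (rule sum.cong[OF refl]) (use sub y ell2.cinner_commute[OF y] in \<open>auto simp: S_def\<close>)
      also have "\<dots> = (\<Sum>\<^sub>\<infinity>x\<in>?F. s n x * cnj (S y x))" using s(1) by simp
      also have "\<dots> = cinner (ell2 X) (s n) (S y)"
        unfolding cinner_ell2 by (rule infsum_cong_neutral) (use sub in auto)
      finally show ?thesis .
    qed
    then show ?thesis
      using ell2.hconverges_cinner[OF ell2.hconverges_op[OF s(2) T] y]
        ell2.hconverges_cinner[OF s(2) S(1)[OF y]] LIMSEQ_unique by simp
  qed
  ultimately show ?thesis by blast
qed

interpretation ell2: hilbert "ell2 X" for X
  by unfold_locales (use ell2_mcomplete ell2_adjoint_exists in auto)

section \<open>The unit circle\<close>

lemma space_circle [simp]: "space circle_measure = unit_circle"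
  by (simp add: circle_measure_def space_restrict_space)

lemma sets_circle [measurable_cong, simp]:
  "sets circle_measure = sets (restrict_space borel unit_circle)"
  by (simp add: circle_measure_def)

lemma cis_measurable_circle [measurable]:
  "cis \<in> measurable (uniform_measure lborel {0..2*pi}) (restrict_space borel unit_circle)"
proof (rule measurable_restrict_space2)
  have "cis \<in> borel_measurable borel"
    by (intro borel_measurable_continuous_onI continuous_intros)
  then show "cis \<in> borel_measurable (uniform_measure lborel {0..2 * pi})" by simp
qed auto

lemma finite_measure_circle: "finite_measure circle_measure"
  and measure_circle [simp]: "measure circle_measure unit_circle = 1"
proof -
  have vim: "cis -` unit_circle = UNIV" by auto
  have "emeasure circle_measure unit_circle = emeasure (uniform_measure lborel {0..2*pi}) UNIV"
    unfolding circle_measure_def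
    by (subst emeasure_distr[OF cis_measurable_circle]) (auto simp: sets_restrict_space vim)
  also have "\<dots> = 1"
    by (subst emeasure_uniform_measure) (auto simp: divide_ennreal)
  finally have 1: "emeasure circle_measure unit_circle = 1" .
  then show "finite_measure circle_measure" by (intro finite_measureI) simp
  show "measure circle_measure unit_circle = 1" using 1 by (simp add: measure_def)
qed

interpretation circle: finite_measure circle_measure
  by (rule finite_measure_circle)

lemma continuous_circle_measurable:
  fixes f :: "complex \<Rightarrow> 'b::topological_space"
  shows "continuous_on unit_circle f \<Longrightarrow> f \<in> borel_measurable circle_measure"
  using borel_measurable_continuous_on_restrict
  by (simp add: measurable_cong_sets[OF sets_circle refl])

lemma continuous_circle_integrable:
  fixes f :: "complex \<Rightarrow> 'b::{banach,second_countable_topology}"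
  assumes "continuous_on unit_circle f"
  shows "integrable circle_measure f"
proof -
  have "bounded (f ` unit_circle)"
    by (rule compact_imp_bounded[OF compact_continuous_image[OF assms]]) simp
  then obtain B where "\<forall>w\<in>f ` unit_circle. norm w \<le> B" unfolding bounded_iff by blast
  then show ?thesis
    by (intro circle.integrable_const_bound[where B = B] continuous_circle_measurable assms) auto
qed

lemma continuous_on_powi_circle [continuous_intros]:
  "continuous_on unit_circle (\<lambda>z. z powi n)"
  by (intro continuous_on_power_int continuous_intros) auto

lemma cnj_powi_circle:
  assumes "z \<in> unit_circle"
  shows "cnj (z powi n) = z powi (- n)"
proof -
  have "z * cnj z = 1" using assms complex_norm_square[of z] by simp
  then have "cnj z = inverse z" by (metis inverse_unique)
  then show ?thesis by (simp add: power_int_minus power_int_inverse)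
qed

lemma norm_powi_circle [simp]: "z \<in> unit_circle \<Longrightarrow> cmod (z powi n) = 1"
  by (simp add: norm_power_int)

lemma integral_powi_circle:
  "(\<integral>z. z powi n \<partial>circle_measure) = (if n = 0 then 1 else 0)"
proof (cases "n = 0")
  case True
  then show ?thesis by simp
next
  case False
  \<comment> \<open>\<open>F\<close> is a primitive of \<open>cis (of_int n * t)\<close>. By
    periodicity its values at 0 and \<open>2*pi\<close> agree, so the integral vanishes for
    \<open>n \<noteq> 0\<close>.\<close>
  define F where "F t = cis (of_int n * t) / (\<i> * of_int n)" for t :: real
  have [measurable]: "(\<lambda>t. cis (of_int n * t)) \<in> borel_measurable borel"
    by (intro borel_measurable_continuous_onI continuous_intros)
  have dens: "uniform_measure lborel {0..2*pi} =
      density lborel (\<lambda>t. ennreal (indicator {0..2*pi} t / (2*pi)))"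
    unfolding uniform_measure_def
  proof (rule density_cong)
    have "1 / ennreal (2 * pi) = ennreal (1 / (2 * pi))"
      using divide_ennreal[of 1 "2 * pi"] by simp
    then show "AE t in lborel. indicator {0..2*pi} t / emeasure lborel {0..2*pi} =
        ennreal (indicator {0..2*pi} t / (2*pi))"
      by (auto simp: indicator_def)
  qed auto
  have "(\<integral>z. z powi n \<partial>circle_measure) = (\<integral>t. cis t powi n \<partial>uniform_measure lborel {0..2*pi})"
    unfolding circle_measure_def
    by (rule integral_distr[OF cis_measurable_circle])
      (rule borel_measurable_continuous_on_restrict[OF continuous_on_powi_circle])
  also have "\<dots> = (\<integral>t. cis (of_int n * t) \<partial>density lborel (\<lambda>t. ennreal (indicator {0..2*pi} t / (2*pi))))"
    unfolding dens cis_power_int ..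
  also have "\<dots> = (\<integral>t. (indicator {0..2*pi} t / (2*pi)) *\<^sub>R cis (of_int n * t) \<partial>lborel)"
    by (rule integral_density) auto
  also have "\<dots> = (\<integral>t. indicator {0..2*pi} t *\<^sub>R cis (of_int n * t) \<partial>lborel) /\<^sub>R (2*pi)"
  proof -
    have "(\<lambda>t. (indicator {0..2*pi} t / (2*pi)) *\<^sub>R cis (of_int n * t)) =
        (\<lambda>t. inverse (2*pi) *\<^sub>R (indicator {0..2*pi} t *\<^sub>R cis (of_int n * t)))"
      by (rule ext) (simp only: scaleR_scaleR divide_inverse mult.commute)
    then show ?thesis by (simp only: integral_scaleR_right)
  qed
  also have "(\<integral>t. indicator {0..2*pi} t *\<^sub>R cis (of_int n * t) \<partial>lborel) = F (2*pi) - F 0"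
  proof (rule integral_FTC_Icc)
    fix t :: real
    have "((\<lambda>w. exp (\<i> * (of_int n * w)) / (\<i> * of_int n)) has_field_derivative
        exp (\<i> * (of_int n * complex_of_real t))) (at (complex_of_real t))"
      using False by (auto intro!: derivative_eq_intros simp: mult_ac)
    from has_vector_derivative_real_field[OF this]
    show "(F has_vector_derivative cis (of_int n * t)) (at t within {0..2*pi})"
      by (simp add: F_def[abs_def] cis_conv_exp)
  qed (auto intro!: continuous_intros)
  also have "F (2*pi) = F 0"
    using cis_multiple_2pi[of "of_int n"] by (simp add: F_def mult.commute)
  finally show ?thesis using False by simp
qed

lemma integral_powi_cnj_circle:
  "(\<integral>z. z powi m * cnj (z powi n) \<partial>circle_measure) = (if m = n then 1 else 0)"
proof -
  have "(\<integral>z. z powi m * cnj (z powi n) \<partial>circle_measure) = (\<integral>z. z powi (m - n) \<partial>circle_measure)"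
  proof (rule Bochner_Integration.integral_cong[OF refl])
    fix z assume "z \<in> space circle_measure"
    then have z: "z \<in> unit_circle" by simp
    then have "z \<noteq> 0" by auto
    then show "z powi m * cnj (z powi n) = z powi (m - n)"
      unfolding cnj_powi_circle[OF z] by (simp flip: power_int_add)
  qed
  then show ?thesis by (simp add: integral_powi_circle)
qed

text \<open>Junk if the support of \<open>\<xi>\<close> is infinite, since the sum is then \<open>0\<close>.\<close>

definition trig :: "(int \<Rightarrow> complex) \<Rightarrow> complex \<Rightarrow> complex" where
  "trig \<xi> z = (\<Sum>x | \<xi> x \<noteq> 0. \<xi> x * z powi x)"

lemma trig_superset:
  assumes "finite F" "\<And>x. x \<notin> F \<Longrightarrow> \<xi> x = 0"
  shows "trig \<xi> z = (\<Sum>x\<in>F. \<xi> x * z powi x)"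
  unfolding trig_def by (rule sum.mono_neutral_left) (use assms in auto)

lemma continuous_on_trig [continuous_intros]: "continuous_on unit_circle (trig \<xi>)"
  unfolding trig_def by (intro continuous_intros)

text \<open>The sesquilinear extension of the orthonormality of the powers of
  \<open>z\<close>.\<close>

lemma trig_cinner:
  assumes "finite {x. \<xi> x \<noteq> 0}" "finite {x. \<eta> x \<noteq> 0}"
  shows "(\<integral>z. trig \<xi> z * cnj (trig \<eta> z) \<partial>circle_measure) = cinner (ell2 UNIV) \<xi> \<eta>"
proof -
  let ?F = "{x. \<xi> x \<noteq> 0}" and ?G = "{x. \<eta> x \<noteq> 0}"
  have int: "integrable circle_measure (\<lambda>z. \<xi> x * cnj (\<eta> y) * (z powi x * cnj (z powi y)))" for x y
    by (intro continuous_circle_integrable continuous_intros)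
  have "(\<integral>z. trig \<xi> z * cnj (trig \<eta> z) \<partial>circle_measure) =
      (\<integral>z. (\<Sum>x\<in>?F. \<Sum>y\<in>?G. \<xi> x * cnj (\<eta> y) * (z powi x * cnj (z powi y))) \<partial>circle_measure)"
    unfolding trig_def cnj_sum sum_product
    by (intro Bochner_Integration.integral_cong sum.cong refl) (simp add: mult_ac)
  also have "\<dots> = (\<Sum>x\<in>?F. \<Sum>y\<in>?G. \<xi> x * cnj (\<eta> y) * (if x = y then 1 else 0))"
    by (subst Bochner_Integration.integral_sum, intro Bochner_Integration.integrable_sum int,
        rule sum.cong[OF refl], subst Bochner_Integration.integral_sum, rule int,
        rule sum.cong[OF refl], subst integral_mult_right_zero, subst integral_powi_cnj_circle)
      (rule refl)
  also have "\<dots> = (\<Sum>x\<in>?F. \<xi> x * cnj (\<eta> x))"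
    using assms by (intro sum.cong refl) (simp add: if_distrib cong: if_cong)
  also have "\<dots> = (\<Sum>\<^sub>\<infinity>x\<in>?F. \<xi> x * cnj (\<eta> x))" using assms by simp
  also have "\<dots> = cinner (ell2 UNIV) \<xi> \<eta>"
    unfolding cinner_ell2 by (rule infsum_cong_neutral) auto
  finally show ?thesis .
qed

lemma Parseval_trig:
  assumes "finite {x. \<xi> x \<noteq> 0}"
  shows "(\<integral>z. (cmod (trig \<xi> z))\<^sup>2 \<partial>circle_measure) = (hnorm (ell2 UNIV) \<xi>)\<^sup>2"
proof -
  have "\<xi> \<in> l2" by (rule finite_support_ell2(1)[OF assms]) auto
  have "complex_of_real (\<integral>z. (cmod (trig \<xi> z))\<^sup>2 \<partial>circle_measure) =
      (\<integral>z. complex_of_real ((cmod (trig \<xi> z))\<^sup>2) \<partial>circle_measure)"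
    by (rule integral_complex_of_real[symmetric])
  also have "\<dots> = complex_of_real ((hnorm (ell2 UNIV) \<xi>)\<^sup>2)"
    unfolding complex_norm_square trig_cinner[OF assms assms]
    by (rule ell2.cinner_self) fact
  finally show ?thesis unfolding of_real_eq_iff .
qed

section \<open>Continuous functions on the circle\<close>

abbreviation CC where "CC \<equiv> continuous_circle_algebra"

lemma CC_simps [simp]:
  "azero CC = (\<lambda>z\<in>unit_circle. 0)"
  "aadd CC f g = (\<lambda>z\<in>unit_circle. f z + g z)"
  "ascale CC c f = (\<lambda>z\<in>unit_circle. c * f z)"
  "amult CC f g = (\<lambda>z\<in>unit_circle. f z * g z)"
  "astar CC f = (\<lambda>z\<in>unit_circle. cnj (f z))"
  by (simp_all add: continuous_circle_algebra_def)

lemma CC_carrier: "carrier CC = {f \<in> extensional unit_circle. continuous_on unit_circle f}"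
  by (simp add: continuous_circle_algebra_def)

lemma CC_restrictI: "continuous_on unit_circle f \<Longrightarrow> (\<lambda>z\<in>unit_circle. f z) \<in> carrier CC"
proof -
  assume "continuous_on unit_circle f"
  moreover have "continuous_on unit_circle (\<lambda>z\<in>unit_circle. f z) = continuous_on unit_circle f"
    by (rule continuous_on_cong) auto
  ultimately show ?thesis by (simp only: CC_carrier mem_Collect_eq restrict_extensional simp_thms)
qed

lemma CC_continuous: "f \<in> carrier CC \<Longrightarrow> continuous_on unit_circle f"
  by (simp add: CC_carrier)

lemma CC_eqI:
  "\<lbrakk>f \<in> carrier CC; g \<in> carrier CC; \<And>z. z \<in> unit_circle \<Longrightarrow> f z = g z\<rbrakk> \<Longrightarrow> f = g"
  unfolding CC_carrier by (blast intro: extensionalityI)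

text \<open>The value is 0 outside the carrier because \<open>Metric_space\<close> asks for
  nonnegativity and symmetry everywhere, while the supremum of an unbounded set is
  unspecified.\<close>

definition cdist :: "(complex \<Rightarrow> complex) \<Rightarrow> (complex \<Rightarrow> complex) \<Rightarrow> real" where
  "cdist f g = (if f \<in> carrier CC \<and> g \<in> carrier CC
    then (SUP z\<in>unit_circle. cmod (f z - g z)) else 0)"

lemma cdist_bound:
  assumes "f \<in> carrier CC" "g \<in> carrier CC" "z \<in> unit_circle"
  shows "cmod (f z - g z) \<le> cdist f g"
proof -
  have "continuous_on unit_circle (\<lambda>z. cmod (f z - g z))"
    using assms by (intro continuous_intros CC_continuous)
  then have "bdd_above ((\<lambda>z. cmod (f z - g z)) ` unit_circle)"
    by (intro bounded_imp_bdd_above compact_imp_bounded compact_continuous_image) simp_all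
  from cSUP_upper[OF assms(3) this] show ?thesis using assms by (simp add: cdist_def)
qed

lemma unit_circle_ne: "unit_circle \<noteq> {}"
  using norm_one by (metis (no_types) mem_sphere_0 empty_iff)

lemma cdist_leI:
  assumes "0 \<le> e" "\<And>z. \<lbrakk>f \<in> carrier CC; g \<in> carrier CC; z \<in> unit_circle\<rbrakk> \<Longrightarrow> cmod (f z - g z) \<le> e"
  shows "cdist f g \<le> e"
  unfolding cdist_def using assms unit_circle_ne by (auto intro!: cSUP_least)

lemma cdist_nonneg [simp]: "0 \<le> cdist f g"
proof (cases "f \<in> carrier CC \<and> g \<in> carrier CC")
  case True
  then show ?thesis
    using cdist_bound[of f g 1] norm_ge_zero[of "f 1 - g 1"] by (auto simp del: norm_ge_zero)
qed (auto simp: cdist_def)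

lemma Metric_space_CC: "Metric_space (carrier CC) cdist"
proof
  show "cdist f g = cdist g f" for f g
    by (simp add: cdist_def norm_minus_commute)
next
  fix f g assume fg: "f \<in> carrier CC" "g \<in> carrier CC"
  show "cdist f g = 0 \<longleftrightarrow> f = g"
  proof
    assume "cdist f g = 0"
    then have "f z = g z" if "z \<in> unit_circle" for z
      using cdist_bound[OF fg that] by simp
    then show "f = g" using CC_eqI fg by blast
  next
    assume "f = g"
    then have "cdist f g \<le> 0" by (intro cdist_leI) auto
    then show "cdist f g = 0" using cdist_nonneg[of f g] by linarith
  qed
next
  fix f g h assume fgh: "f \<in> carrier CC" "g \<in> carrier CC" "h \<in> carrier CC"
  show "cdist f h \<le> cdist f g + cdist g h"
  proof (rule cdist_leI)
    fix z assume z: "z \<in> unit_circle"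
    have "cmod (f z - h z) \<le> cmod (f z - g z) + cmod (g z - h z)"
      using norm_triangle_ineq[of "f z - g z" "g z - h z"] by simp
    then show "cmod (f z - h z) \<le> cdist f g + cdist g h"
      using cdist_bound[OF fgh(1,2) z] cdist_bound[OF fgh(2,3) z] by linarith
  qed simp
qed simp

lemma metric_star_algebra_CC: "metric_star_algebra CC cdist"
proof (intro metric_star_algebra.intro Metric_space_CC, unfold_locales)
  have c: "continuous_on unit_circle f" if "f \<in> carrier CC" for f using that by (rule CC_continuous)
  show "star_subalgebra CC (carrier CC)"
    unfolding star_subalgebra_def CC_simps
    by (safe; rule CC_restrictI; intro continuous_intros c; assumption)
  fix f g assume fg: "f \<in> carrier CC" "g \<in> carrier CC"
  show "cdist (ascale CC a f) (ascale CC a g) \<le> cmod a * cdist f g" for a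
    using mult_left_mono[OF cdist_bound[OF fg], of _ "cmod a"]
    by (intro cdist_leI) (auto simp: norm_mult simp flip: right_diff_distrib)
  show "cdist (astar CC f) (astar CC g) \<le> cdist f g"
    using cdist_bound[OF fg] by (intro cdist_leI) (auto simp flip: complex_cnj_diff)
  fix f' g' assume fg': "f' \<in> carrier CC" "g' \<in> carrier CC"
  show "cdist (aadd CC f g) (aadd CC f' g') \<le> cdist f f' + cdist g g'"
  proof (rule cdist_leI)
    fix z assume z: "z \<in> unit_circle"
    have "cmod ((f z - f' z) + (g z - g' z)) \<le> cmod (f z - f' z) + cmod (g z - g' z)"
      by (rule norm_triangle_ineq)
    also have "\<dots> \<le> cdist f f' + cdist g g'"
      using cdist_bound z fg fg' by (intro add_mono) auto
    finally show "cmod (aadd CC f g z - aadd CC f' g' z) \<le> cdist f f' + cdist g g'"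
      using z by (simp add: algebra_simps)
  qed simp
  have 0: "azero CC \<in> carrier CC"
    unfolding CC_simps by (rule CC_restrictI) (intro continuous_intros)
  show "cdist (amult CC f g) (amult CC f' g') \<le> cdist f (azero CC) * cdist g g' + cdist f f' * cdist g' (azero CC)"
  proof (rule cdist_leI)
    fix z assume z: "z \<in> unit_circle"
    have "cmod (f z * (g z - g' z) + (f z - f' z) * g' z) \<le>
        cmod (f z) * cmod (g z - g' z) + cmod (f z - f' z) * cmod (g' z)"
      using norm_triangle_ineq[of "f z * (g z - g' z)" "(f z - f' z) * g' z"] by (simp add: norm_mult)
    also have "\<dots> \<le> cdist f (azero CC) * cdist g g' + cdist f f' * cdist g' (azero CC)"
      using cdist_bound[OF _ _ z] cdist_bound[OF fg(1) 0 z] cdist_bound[OF fg'(2) 0 z] z fg fg'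
      by (intro add_mono mult_mono) auto
    finally show "cmod (amult CC f g z - amult CC f' g' z) \<le>
        cdist f (azero CC) * cdist g g' + cdist f f' * cdist g' (azero CC)"
      using z by (simp add: algebra_simps)
  qed simp
qed

interpretation CC: metric_star_algebra CC cdist
  by (rule metric_star_algebra_CC)

lemma CC_mcomplete: "CC.mcomplete"
  unfolding CC.mcomplete_def
proof (intro allI impI)
  fix s assume C: "CC.MCauchy s"
  have s: "s n \<in> carrier CC" for n using C by (auto simp: CC.MCauchy_def)
  have N: "\<exists>N. \<forall>n m. N \<le> n \<longrightarrow> N \<le> m \<longrightarrow> cdist (s n) (s m) < e" if "e > 0" for e
    using C that unfolding CC.MCauchy_def by simp
  have "uniformly_convergent_on unit_circle s"
  proof (rule Cauchy_uniformly_convergent, unfold uniformly_Cauchy_on_def, intro allI impI)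
    fix e :: real assume "e > 0"
    then obtain N where N: "\<And>n m. \<lbrakk>N \<le> n; N \<le> m\<rbrakk> \<Longrightarrow> cdist (s n) (s m) < e" using N by metis
    show "\<exists>M. \<forall>z\<in>unit_circle. \<forall>m\<ge>M. \<forall>n\<ge>M. dist (s m z) (s n z) < e"
      using cdist_bound[OF s s] N unfolding dist_norm by (meson order_le_less_trans)
  qed
  then obtain l where l: "uniform_limit unit_circle s l sequentially"
    unfolding uniformly_convergent_on_def by blast
  have "continuous_on unit_circle l"
    by (rule uniform_limit_theorem[OF _ l]) (use s CC_continuous in auto)
  define f where "f = (\<lambda>z\<in>unit_circle. l z)"
  have f: "f \<in> carrier CC" unfolding f_def by (rule CC_restrictI) fact
  have "limitin CC.mtopology s f sequentially"
    unfolding CC.limitin_metric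
  proof (intro conjI f allI impI)
    fix e :: real assume e: "e > 0"
    have "\<forall>\<^sub>F n in sequentially. \<forall>z\<in>unit_circle. dist (s n z) (l z) < e / 2"
      using l e unfolding uniform_limit_iff by (meson half_gt_zero)
    then show "\<forall>\<^sub>F n in sequentially. s n \<in> carrier CC \<and> cdist (s n) f < e"
    proof (rule eventually_mono)
      fix n assume "\<forall>z\<in>unit_circle. dist (s n z) (l z) < e / 2"
      then have "cdist (s n) f \<le> e / 2"
        using e by (intro cdist_leI) (auto simp: f_def dist_norm less_imp_le)
      then show "s n \<in> carrier CC \<and> cdist (s n) f < e" using e s by simp
    qed
  qed
  then show "\<exists>f. limitin CC.mtopology s f sequentially" by blast
qed

section \<open>Translations\<close>

text \<open>One of the two conditions in \<open>translation_op\<close> is absorbed by the convention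
  that elements of \<open>ell2 X\<close> vanish outside \<open>X\<close>.\<close>

lemma translation_op_apply:
  "\<xi> \<in> carrier (ell2 X) \<Longrightarrow> translation_op X n \<xi> = (\<lambda>y. if y \<in> X then \<xi> (y - n) else 0)"
  by (auto simp: translation_op_def ell2_outside fun_eq_iff)

lemma translation_op_bounded:
  assumes "\<xi> \<in> carrier (ell2 X)"
  shows "translation_op X n \<xi> \<in> carrier (ell2 X)"
    "hnorm (ell2 X) (translation_op X n \<xi>) \<le> hnorm (ell2 X) \<xi>"
proof -
  have "(\<Sum>y\<in>F. (cmod (translation_op X n \<xi> y))\<^sup>2) \<le> (hnorm (ell2 X) \<xi>)\<^sup>2" if F: "finite F" for F
  proof -
    have "(\<Sum>y\<in>F. (cmod (translation_op X n \<xi> y))\<^sup>2) \<le> (\<Sum>y\<in>F. (cmod (\<xi> (y - n)))\<^sup>2)"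
      by (rule sum_mono) (simp add: translation_op_apply[OF assms])
    also have "\<dots> = (\<Sum>y\<in>(\<lambda>y. y - n) ` F. (cmod (\<xi> y))\<^sup>2)"
      by (subst sum.reindex) (auto simp: inj_on_def)
    also have "\<dots> \<le> (hnorm (ell2 X) \<xi>)\<^sup>2"
      by (rule ell2_finite_sum_le[OF assms]) (simp add: F)
    finally show ?thesis .
  qed
  then show "translation_op X n \<xi> \<in> carrier (ell2 X)"
    "hnorm (ell2 X) (translation_op X n \<xi>) \<le> hnorm (ell2 X) \<xi>"
    using ell2I[of X "translation_op X n \<xi>" "hnorm (ell2 X) \<xi>"] assms
    by (simp_all add: translation_op_apply hnorm_ell2_nonneg)
qed

lemma translation_op_in_bounded_ops [simp]: "translation_op X n \<in> bounded_ops (ell2 X)"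
proof (rule ell2.bounded_opsI[where C = 1])
  show "translation_op X n \<in> extensional (carrier (ell2 X))"
    unfolding translation_op_def by (rule restrict_extensional)
  fix \<xi> \<eta> assume \<xi>: "\<xi> \<in> carrier (ell2 X)" "\<eta> \<in> carrier (ell2 X)"
  then show "translation_op X n (vadd (ell2 X) \<xi> \<eta>) =
      vadd (ell2 X) (translation_op X n \<xi>) (translation_op X n \<eta>)"
    by (simp add: translation_op_apply ell2_add_closed fun_eq_iff)
next
  fix c \<xi> assume \<xi>: "\<xi> \<in> carrier (ell2 X)"
  then show "translation_op X n (vscale (ell2 X) c \<xi>) = vscale (ell2 X) c (translation_op X n \<xi>)"
    by (simp add: translation_op_apply ell2_scale_closed fun_eq_iff)
qed (use translation_op_bounded in auto)

text \<open>Both inner products extend to sums over all integers, where they differ by a shift of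
  the summation variable.\<close>

lemma adjoint_translation_op:
  "adjoint_op (ell2 X) (translation_op X n) = translation_op X (- n)"
proof (rule ell2.adjoint_eqI)
  fix \<xi> \<eta> assume \<xi>: "\<xi> \<in> carrier (ell2 X)" and \<eta>: "\<eta> \<in> carrier (ell2 X)"
  have "cinner (ell2 X) (translation_op X n \<xi>) \<eta> = (\<Sum>\<^sub>\<infinity>y\<in>UNIV. \<xi> (y - n) * cnj (\<eta> y))"
    unfolding cinner_ell2
    by (rule infsum_cong_neutral) (use \<xi> \<eta> in \<open>auto simp: translation_op_apply ell2_outside\<close>)
  also have "\<dots> = (\<Sum>\<^sub>\<infinity>y\<in>UNIV. \<xi> (y + n - n) * cnj (\<eta> (y + n)))"
    by (rule infsum_reindex_bij_betw[symmetric])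
      (rule bij_betw_byWitness[where f' = "\<lambda>y. y - n"], auto)
  also have "\<dots> = cinner (ell2 X) \<xi> (translation_op X (- n) \<eta>)"
    unfolding cinner_ell2
    by (rule infsum_cong_neutral) (use \<xi> \<eta> in \<open>auto simp: translation_op_apply ell2_outside\<close>)
  finally show "cinner (ell2 X) (translation_op X n \<xi>) \<eta> =
      cinner (ell2 X) \<xi> (translation_op X (- n) \<eta>)" .
qed simp

lemma hnorm_translation_UNIV:
  assumes "\<xi> \<in> l2"
  shows "hnorm (ell2 UNIV) (translation_op UNIV n \<xi>) = hnorm (ell2 UNIV) \<xi>"
proof (rule antisym)
  have t: "translation_op UNIV n \<xi> \<in> l2" using translation_op_bounded[OF assms] by simp
  have "translation_op UNIV (- n) (translation_op UNIV n \<xi>) = \<xi>"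
    using translation_op_UNIV[OF t, of "- n"] translation_op_UNIV[OF assms, of n] by simp
  then show "hnorm (ell2 UNIV) \<xi> \<le> hnorm (ell2 UNIV) (translation_op UNIV n \<xi>)"
    using translation_op_bounded(2)[OF t, of "- n"] by simp
qed (use translation_op_bounded[OF assms] in simp)

section \<open>The graph of the symbol map on the algebras generated by translations\<close>

abbreviation AN where "AN \<equiv> op_algebra (ell2 \<nat>)"
abbreviation AZ where "AZ \<equiv> op_algebra (ell2 UNIV)"

abbreviation monomial :: "int \<Rightarrow> complex \<Rightarrow> complex" where
  "monomial n \<equiv> \<lambda>z\<in>unit_circle. z powi n"

text \<open>The three coordinates are generated together so that each comparison between them is one
  induction. Closure under adjoints is derived in \<open>trel_star\<close>, since the adjoint of a
  translation is a translation.\<close>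

inductive_set trel ::
  "(((int \<Rightarrow> complex) \<Rightarrow> int \<Rightarrow> complex) \<times> ((int \<Rightarrow> complex) \<Rightarrow> int \<Rightarrow> complex) \<times> (complex \<Rightarrow> complex)) set"
where
  gen: "(translation_op \<nat> n, translation_op UNIV n, monomial n) \<in> trel"
| zero: "(azero AN, azero AZ, azero CC) \<in> trel"
| add: "\<lbrakk>(T, A, f) \<in> trel; (T', A', f') \<in> trel\<rbrakk>
    \<Longrightarrow> (aadd AN T T', aadd AZ A A', aadd CC f f') \<in> trel"
| scale: "(T, A, f) \<in> trel \<Longrightarrow> (ascale AN c T, ascale AZ c A, ascale CC c f) \<in> trel"
| mult: "\<lbrakk>(T, A, f) \<in> trel; (T', A', f') \<in> trel\<rbrakk>
    \<Longrightarrow> (amult AN T T', amult AZ A A', amult CC f f') \<in> trel"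

lemma ops_closed:
  "azero (op_algebra (ell2 X)) \<in> bounded_ops (ell2 X)"
  "\<lbrakk>S \<in> bounded_ops (ell2 X); T \<in> bounded_ops (ell2 X)\<rbrakk>
    \<Longrightarrow> aadd (op_algebra (ell2 X)) S T \<in> bounded_ops (ell2 X)"
  "T \<in> bounded_ops (ell2 X) \<Longrightarrow> ascale (op_algebra (ell2 X)) c T \<in> bounded_ops (ell2 X)"
  "\<lbrakk>S \<in> bounded_ops (ell2 X); T \<in> bounded_ops (ell2 X)\<rbrakk>
    \<Longrightarrow> amult (op_algebra (ell2 X)) S T \<in> bounded_ops (ell2 X)"
  using ell2.ops.op_closeds by blast+

lemma trel_carrier:
  "(T, A, f) \<in> trel \<Longrightarrow> T \<in> bounded_ops (ell2 \<nat>) \<and> A \<in> bounded_ops (ell2 UNIV) \<and> f \<in> carrier CC"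
proof (induction rule: trel.induct)
  case (gen n)
  have "monomial n \<in> carrier CC" by (rule CC_restrictI) (rule continuous_on_powi_circle)
  then show ?case by (intro conjI translation_op_in_bounded_ops)
qed (auto simp only: ops_closed CC.op_closeds)

lemma op_apply:
  assumes "\<xi> \<in> carrier (ell2 X)"
  shows "azero (op_algebra (ell2 X)) \<xi> = (\<lambda>y. 0)"
    "aadd (op_algebra (ell2 X)) S T \<xi> = (\<lambda>y. S \<xi> y + T \<xi> y)"
    "ascale (op_algebra (ell2 X)) c T \<xi> = (\<lambda>y. c * T \<xi> y)"
    "amult (op_algebra (ell2 X)) S T \<xi> = S (T \<xi>)"
  using assms by (simp_all add: compose_eq)

lemma CC_apply:
  assumes "z \<in> unit_circle"
  shows "azero CC z = 0" "aadd CC f g z = f z + g z" "ascale CC c f z = c * f z"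
    "amult CC f g z = f z * g z" "monomial n z = z powi n"
  using assms by simp_all

text \<open>Locality: on a stretch where \<open>\<xi>\<close> is a generalised eigenvector \<open>k \<mapsto> z\<^sup>-\<^sup>k\<close>
  the operator acts by the value of its symbol. The case \<open>a = 0\<close> bounds the propagation.\<close>

definition local_symbol where
  "local_symbol A f d \<longleftrightarrow> (\<forall>z\<in>unit_circle. \<forall>\<xi>\<in>l2. \<forall>a y.
    (\<forall>k. \<bar>k - y\<bar> \<le> d \<longrightarrow> \<xi> k = a * z powi (- k)) \<longrightarrow> A \<xi> y = f z * (a * z powi (- y)))"

lemma local_symbolD:
  "\<lbrakk>local_symbol A f d; z \<in> unit_circle; \<xi> \<in> l2; \<And>k. \<bar>k - y\<bar> \<le> d \<Longrightarrow> \<xi> k = a * z powi (- k)\<rbrakk>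
    \<Longrightarrow> A \<xi> y = f z * (a * z powi (- y))"
  unfolding local_symbol_def by blast

lemma local_symbolI:
  "(\<And>z \<xi> a y. \<lbrakk>z \<in> unit_circle; \<xi> \<in> l2; \<And>k. \<bar>k - y\<bar> \<le> d \<Longrightarrow> \<xi> k = a * z powi (- k)\<rbrakk>
    \<Longrightarrow> A \<xi> y = f z * (a * z powi (- y))) \<Longrightarrow> local_symbol A f d"
  unfolding local_symbol_def by blast

text \<open>Radii combine like propagation: \<open>\<bar>n\<bar>\<close> for a translation, the
  maximum for a sum, and the sum of the radii for a product.\<close>

lemma trel_local: "(T, A, f) \<in> trel \<Longrightarrow> \<exists>d\<ge>0. local_symbol A f d"
proof (induction rule: trel.induct)
  case (gen n)
  have "local_symbol (translation_op UNIV n) (monomial n) \<bar>n\<bar>"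
  proof (rule local_symbolI)
    fix z \<xi> a y assume z: "z \<in> unit_circle" and \<xi>: "\<xi> \<in> l2"
      and *: "\<And>k. \<bar>k - y\<bar> \<le> \<bar>n\<bar> \<Longrightarrow> \<xi> k = a * z powi (- k)"
    have "z \<noteq> 0" using z by auto
    then have "z powi (n - y) = z powi n * z powi (- y)" by (simp flip: power_int_add)
    moreover have "\<xi> (y - n) = a * z powi (n - y)" using *[of "y - n"] by simp
    ultimately show "translation_op UNIV n \<xi> y = monomial n z * (a * z powi (- y))"
      using z \<xi> by (simp add: translation_op_UNIV)
  qed
  then show ?case by (intro exI[of _ "\<bar>n\<bar>"] conjI abs_ge_zero)
next
  case zero
  show ?case
    by (intro exI[of _ 0] conjI local_symbolI) (simp_all only: op_apply CC_apply, simp_all)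
next
  case (add T A f T' A' f')
  then obtain d d' where d: "d \<ge> 0" "local_symbol A f d" "d' \<ge> 0" "local_symbol A' f' d'" by blast
  have "local_symbol (aadd AZ A A') (aadd CC f f') (max d d')"
  proof (rule local_symbolI)
    fix z \<xi> a y assume z: "z \<in> unit_circle" and \<xi>: "\<xi> \<in> l2"
      and *: "\<And>k. \<bar>k - y\<bar> \<le> max d d' \<Longrightarrow> \<xi> k = a * z powi (- k)"
    have "A \<xi> y = f z * (a * z powi (- y))" "A' \<xi> y = f' z * (a * z powi (- y))"
      by (rule local_symbolD[OF d(2) z \<xi>]; use * in simp)
        (rule local_symbolD[OF d(4) z \<xi>]; use * in simp)
    then show "aadd AZ A A' \<xi> y = aadd CC f f' z * (a * z powi (- y))"
      unfolding op_apply[OF \<xi>] CC_apply[OF z] by (simp add: ring_distribs)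
  qed
  moreover have "0 \<le> max d d'" using d by auto
  ultimately show ?case by blast
next
  case (scale T A f c)
  then obtain d where d: "d \<ge> 0" "local_symbol A f d" by blast
  have "local_symbol (ascale AZ c A) (ascale CC c f) d"
  proof (rule local_symbolI)
    fix z \<xi> a y assume z: "z \<in> unit_circle" and \<xi>: "\<xi> \<in> l2"
      and *: "\<And>k. \<bar>k - y\<bar> \<le> d \<Longrightarrow> \<xi> k = a * z powi (- k)"
    show "ascale AZ c A \<xi> y = ascale CC c f z * (a * z powi (- y))"
      unfolding op_apply[OF \<xi>] CC_apply[OF z] using local_symbolD[OF d(2) z \<xi> *] by simp
  qed
  then show ?case using d by blast
next
  case (mult T A f T' A' f')
  then obtain d d' where d: "d \<ge> 0" "local_symbol A f d" "d' \<ge> 0" "local_symbol A' f' d'" by blast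
  have A': "A' \<in> bounded_ops (ell2 UNIV)" using trel_carrier[OF mult.hyps(2)] by simp
  have "local_symbol (amult AZ A A') (amult CC f f') (d + d')"
  proof (rule local_symbolI)
    fix z \<xi> a y assume z: "z \<in> unit_circle" and \<xi>: "\<xi> \<in> l2"
      and *: "\<And>k. \<bar>k - y\<bar> \<le> d + d' \<Longrightarrow> \<xi> k = a * z powi (- k)"
    \<comment> \<open>On the window of radius \<open>d\<close> the vector \<open>A' \<xi>\<close> is
      again exponential, with amplitude \<open>f' z * a\<close>. This is why
      \<open>local_symbol\<close> allows an arbitrary amplitude.\<close>
    have "A' \<xi> l = (f' z * a) * z powi (- l)" if "\<bar>l - y\<bar> \<le> d" for l
      using local_symbolD[OF d(4) z \<xi>, of l a] * that by (simp add: mult.assoc)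
    from local_symbolD[OF d(2) z ell2.op_closed[OF A' \<xi>] this]
    show "amult AZ A A' \<xi> y = amult CC f f' z * (a * z powi (- y))"
      unfolding op_apply[OF \<xi>] CC_apply[OF z] by (simp add: mult_ac)
  qed
  moreover have "0 \<le> d + d'" using d by auto
  ultimately show ?case by blast
qed

lemma trel_vanish:
  assumes "local_symbol A f d" "\<xi> \<in> l2" "\<And>k. \<bar>k - y\<bar> \<le> d \<Longrightarrow> \<xi> k = 0"
  shows "A \<xi> y = 0"
  using local_symbolD[OF assms(1) _ assms(2), of 1 y 0] assms(3) by simp

text \<open>The integers are commutative, so translations commute with one another, and the
  operators commuting with a given one form an algebra.\<close>

lemma trel_translation:
  "(T, A, f) \<in> trel \<Longrightarrow> \<xi> \<in> l2 \<Longrightarrow> A (translation_op UNIV n \<xi>) = translation_op UNIV n (A \<xi>)"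
proof (induction arbitrary: \<xi> rule: trel.induct)
  case (gen m)
  have t: "translation_op UNIV k \<xi> \<in> l2" for k using gen translation_op_bounded by blast
  show ?case
    unfolding translation_op_UNIV[OF t] unfolding translation_op_UNIV[OF gen]
    by (simp add: algebra_simps)
next
  case zero
  have t: "translation_op UNIV n \<xi> \<in> l2" using zero translation_op_bounded by blast
  show ?case
    unfolding op_apply[OF t] op_apply[OF zero] by (simp add: translation_op_UNIV ell2_zero_closed)
next
  case (add T A f T' A' f')
  have t: "translation_op UNIV n \<xi> \<in> l2" using add translation_op_bounded by blast
  have "A \<xi> \<in> l2" "A' \<xi> \<in> l2"
    using trel_carrier[OF add.hyps(1)] trel_carrier[OF add.hyps(2)] ell2.op_closed add.prems by auto
  then show ?case
    unfolding op_apply[OF t] op_apply[OF add.prems] add.IH[OF add.prems]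
    by (simp add: translation_op_UNIV ell2_add_closed)
next
  case (scale T A f c)
  have t: "translation_op UNIV n \<xi> \<in> l2" using scale translation_op_bounded by blast
  have "A \<xi> \<in> l2"
    using trel_carrier[OF scale.hyps] ell2.op_closed scale.prems by auto
  then show ?case
    unfolding op_apply[OF t] op_apply[OF scale.prems] scale.IH[OF scale.prems]
    by (simp add: translation_op_UNIV ell2_scale_closed)
next
  case (mult T A f T' A' f')
  have t: "translation_op UNIV n \<xi> \<in> l2" using mult translation_op_bounded by blast
  have "A' \<xi> \<in> l2"
    using trel_carrier[OF mult.hyps(2)] ell2.op_closed mult.prems by auto
  then show ?case
    unfolding op_apply[OF t] op_apply[OF mult.prems] by (simp add: mult.IH mult.prems)
qed

lemma Nats_int_iff: "(x :: int) \<in> \<nat> \<longleftrightarrow> 0 \<le> x"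
  by (metis Nats_cases int_nat_eq of_nat_0_le_iff of_nat_in_Nats)

lemma vanish_below_in_ell2_Nats:
  assumes "\<xi> \<in> l2" "d \<ge> 0" "\<And>x. x < d \<Longrightarrow> \<xi> x = 0"
  shows "\<xi> \<in> carrier (ell2 \<nat>)"
proof -
  have "\<xi> x = 0" if "x \<notin> \<nat>" for x
    using assms that by (cases "x < d") (auto simp: Nats_int_iff)
  then show ?thesis using assms(1) ell2_iff_UNIV by blast
qed

text \<open>\<open>T\<close> acts on \<open>ell2 \<nat>\<close> but is applied to functions on the
  integers. For \<open>d \<ge> 0\<close> a vector of \<open>l2\<close> vanishing below
  \<open>d\<close> does lie in \<open>ell2 \<nat>\<close>.\<close>

definition agree_from where
  "agree_from T A d \<longleftrightarrow> (\<forall>\<xi>\<in>l2. (\<forall>x<d. \<xi> x = 0) \<longrightarrow> T \<xi> = A \<xi>)"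

lemma agree_fromD: "\<lbrakk>agree_from T A d; \<xi> \<in> l2; \<And>x. x < d \<Longrightarrow> \<xi> x = 0\<rbrakk> \<Longrightarrow> T \<xi> = A \<xi>"
  unfolding agree_from_def by blast

lemma agree_fromI: "(\<And>\<xi>. \<lbrakk>\<xi> \<in> l2; \<And>x. x < d \<Longrightarrow> \<xi> x = 0\<rbrakk> \<Longrightarrow> T \<xi> = A \<xi>) \<Longrightarrow> agree_from T A d"
  unfolding agree_from_def by blast

lemma trel_agree: "(T, A, f) \<in> trel \<Longrightarrow> \<exists>d\<ge>0. agree_from T A d"
proof (induction rule: trel.induct)
  case (gen n)
  \<comment> \<open>Starting at \<open>\<bar>n\<bar>\<close> keeps the translated support inside
    \<open>\<nat>\<close> also when \<open>n\<close> is negative.\<close>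
  have "agree_from (translation_op \<nat> n) (translation_op UNIV n) \<bar>n\<bar>"
  proof (rule agree_fromI)
    fix \<xi> assume \<xi>: "\<xi> \<in> l2" "\<And>x. x < \<bar>n\<bar> \<Longrightarrow> \<xi> x = 0"
    have "\<xi> \<in> carrier (ell2 \<nat>)" by (rule vanish_below_in_ell2_Nats[OF \<xi>(1) abs_ge_zero \<xi>(2)])
    moreover have "\<xi> (y - n) = 0" if "y \<notin> \<nat>" for y
      using that by (intro \<xi>(2)) (auto simp: Nats_int_iff)
    ultimately show "translation_op \<nat> n \<xi> = translation_op UNIV n \<xi>"
      using \<xi> by (auto simp: translation_op_apply)
  qed
  then show ?case by (intro exI[of _ "\<bar>n\<bar>"] conjI abs_ge_zero)
next
  case zero
  have "agree_from (azero AN) (azero AZ) 0"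
  proof (rule agree_fromI)
    fix \<xi> :: "int \<Rightarrow> complex" assume \<xi>: "\<xi> \<in> l2" "\<And>x. x < 0 \<Longrightarrow> \<xi> x = 0"
    have N: "\<xi> \<in> carrier (ell2 \<nat>)" by (rule vanish_below_in_ell2_Nats[OF \<xi>(1) order_refl \<xi>(2)])
    show "azero AN \<xi> = azero AZ \<xi>" unfolding op_apply[OF N] op_apply[OF \<xi>(1)] ..
  qed
  then show ?case by blast
next
  case (add T A f T' A' f')
  then obtain d d' where d: "d \<ge> 0" "agree_from T A d" "d' \<ge> 0" "agree_from T' A' d'" by blast
  have "agree_from (aadd AN T T') (aadd AZ A A') (max d d')"
  proof (rule agree_fromI)
    fix \<xi> :: "int \<Rightarrow> complex" assume \<xi>: "\<xi> \<in> l2" "\<And>x. x < max d d' \<Longrightarrow> \<xi> x = 0"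
    have N: "\<xi> \<in> carrier (ell2 \<nat>)"
      by (rule vanish_below_in_ell2_Nats[OF \<xi>(1) _ \<xi>(2), rotated]) (use d in auto)
    show "aadd AN T T' \<xi> = aadd AZ A A' \<xi>"
      unfolding op_apply[OF N] op_apply[OF \<xi>(1)]
      using agree_fromD[OF d(2) \<xi>(1)] agree_fromD[OF d(4) \<xi>(1)] \<xi>(2) by simp
  qed
  moreover have "0 \<le> max d d'" using d by auto
  ultimately show ?case by blast
next
  case (scale T A f c)
  then obtain d where d: "d \<ge> 0" "agree_from T A d" by blast
  have "agree_from (ascale AN c T) (ascale AZ c A) d"
  proof (rule agree_fromI)
    fix \<xi> :: "int \<Rightarrow> complex" assume \<xi>: "\<xi> \<in> l2" "\<And>x. x < d \<Longrightarrow> \<xi> x = 0"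
    have N: "\<xi> \<in> carrier (ell2 \<nat>)" by (rule vanish_below_in_ell2_Nats[OF \<xi>(1) d(1) \<xi>(2)])
    show "ascale AN c T \<xi> = ascale AZ c A \<xi>"
      unfolding op_apply[OF N] op_apply[OF \<xi>(1)] using agree_fromD[OF d(2) \<xi>] by simp
  qed
  then show ?case using d by blast
next
  case (mult T A f T' A' f')
  then obtain d d' where d: "d \<ge> 0" "agree_from T A d" "d' \<ge> 0" "agree_from T' A' d'" by blast
  obtain w where w: "w \<ge> 0" "local_symbol A' f' w" using trel_local[OF mult.hyps(2)] by blast
  have A': "A' \<in> bounded_ops (ell2 UNIV)" using trel_carrier[OF mult.hyps(2)] by simp
  \<comment> \<open>\<open>A'\<close> may spread supports downwards by \<open>w\<close>. Vanishing
    of \<open>\<xi>\<close> below \<open>d + w\<close> ensures that \<open>A' \<xi>\<close> vanishes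
    below \<open>d\<close>, where \<open>T\<close> and \<open>A\<close> start to agree.\<close>
  have "agree_from (amult AN T T') (amult AZ A A') (max d' (d + w))"
  proof (rule agree_fromI)
    fix \<xi> :: "int \<Rightarrow> complex"
    assume \<xi>: "\<xi> \<in> l2" "\<And>x. x < max d' (d + w) \<Longrightarrow> \<xi> x = 0"
    have N: "\<xi> \<in> carrier (ell2 \<nat>)"
      by (rule vanish_below_in_ell2_Nats[OF \<xi>(1) _ \<xi>(2), rotated]) (use d w in auto)
    have "T' \<xi> = A' \<xi>" using agree_fromD[OF d(4) \<xi>(1)] \<xi>(2) by simp
    moreover have "T (A' \<xi>) = A (A' \<xi>)"
    proof (rule agree_fromD[OF d(2) ell2.op_closed[OF A' \<xi>(1)]])
      fix x assume "x < d"
      then show "A' \<xi> x = 0" by (intro trel_vanish[OF w(2) \<xi>(1)] \<xi>(2)) auto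
    qed
    ultimately show "amult AN T T' \<xi> = amult AZ A A' \<xi>"
      unfolding op_apply[OF N] op_apply[OF \<xi>(1)] by simp
  qed
  moreover have "0 \<le> max d' (d + w)" using d by auto
  ultimately show ?case by blast
qed

text \<open>Finite support is part of the claim: \<open>trig\<close> is meaningful only there, and
  in the product case the hypothesis for \<open>A\<close> is applied to
  \<open>A' \<xi>\<close>.\<close>

lemma trel_trig:
  "(T, A, f) \<in> trel \<Longrightarrow> finite {x. \<xi> x \<noteq> 0} \<Longrightarrow> z \<in> unit_circle
    \<Longrightarrow> finite {x. A \<xi> x \<noteq> 0} \<and> trig (A \<xi>) z = f z * trig \<xi> z"
proof (induction arbitrary: \<xi> rule: trel.induct)
  case (gen n)
  have \<xi>: "\<xi> \<in> l2" by (rule finite_support_ell2(1)[OF gen(1)]) auto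
  have supp: "{x. \<xi> (x - n) \<noteq> 0} = (\<lambda>x. x + n) ` {x. \<xi> x \<noteq> 0}"
    by (auto simp: image_iff) (metis diff_add_cancel)
  have "z \<noteq> 0" using gen by auto
  then have "trig (\<lambda>y. \<xi> (y - n)) z = z powi n * trig \<xi> z"
    unfolding trig_def supp sum_distrib_left
    by (subst sum.reindex) (auto simp: inj_on_def power_int_add mult_ac intro!: sum.cong)
  then show ?case
    using gen supp unfolding translation_op_UNIV[OF \<xi>] by (simp only: CC_apply finite_imageI simp_thms)
next
  case zero
  have \<xi>: "\<xi> \<in> l2" by (rule finite_support_ell2(1)[OF zero(1)]) auto
  show ?case unfolding op_apply[OF \<xi>] CC_apply[OF zero(2)] by (simp add: trig_def)
next
  case (add T A f T' A' f')
  have \<xi>: "\<xi> \<in> l2" by (rule finite_support_ell2(1)[OF add.prems(1)]) auto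
  let ?F = "{x. A \<xi> x \<noteq> 0} \<union> {x. A' \<xi> x \<noteq> 0}"
  have F: "finite ?F" using add.IH[OF add.prems] by simp
  have "finite {x. A \<xi> x + A' \<xi> x \<noteq> 0}" by (rule finite_subset[OF _ F]) auto
  moreover have "trig (\<lambda>x. A \<xi> x + A' \<xi> x) z = trig (A \<xi>) z + trig (A' \<xi>) z"
    by (subst (1 2 3) trig_superset[OF F]) (auto simp: ring_distribs sum.distrib)
  ultimately show ?case
    unfolding op_apply[OF \<xi>] CC_apply[OF add.prems(2)]
    using add.IH[OF add.prems] by (simp add: ring_distribs)
next
  case (scale T A f c)
  have \<xi>: "\<xi> \<in> l2" by (rule finite_support_ell2(1)[OF scale.prems(1)]) auto
  have F: "finite {x. A \<xi> x \<noteq> 0}" using scale.IH[OF scale.prems] by simp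
  have "finite {x. c * A \<xi> x \<noteq> 0}" by (rule finite_subset[OF _ F]) auto
  moreover have "trig (\<lambda>x. c * A \<xi> x) z = c * trig (A \<xi>) z"
    by (subst (1 2) trig_superset[OF F]) (auto simp: sum_distrib_left mult.assoc)
  ultimately show ?case
    unfolding op_apply[OF \<xi>] CC_apply[OF scale.prems(2)]
    using scale.IH[OF scale.prems] by simp
next
  case (mult T A f T' A' f')
  have \<xi>: "\<xi> \<in> l2" by (rule finite_support_ell2(1)[OF mult.prems(1)]) auto
  have 1: "finite {x. A' \<xi> x \<noteq> 0}" "trig (A' \<xi>) z = f' z * trig \<xi> z"
    using mult.IH(2)[OF mult.prems] by auto
  show ?case
    unfolding op_apply[OF \<xi>] CC_apply[OF mult.prems(2)]
    using mult.IH(1)[OF 1(1) mult.prems(2)] 1(2) by simp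
qed

lemma trel_star:
  "(T, A, f) \<in> trel \<Longrightarrow> (astar AN T, astar AZ A, astar CC f) \<in> trel"
proof (induction rule: trel.induct)
  case (gen n)
  have "astar CC (monomial n) = monomial (- n)"
    using cnj_powi_circle[of _ n] by (auto simp: fun_eq_iff)
  then show ?case using trel.gen[of "- n"] by (simp only: ell2.op_algebra_simps adjoint_translation_op)
next
  case zero
  have "astar CC (azero CC) = azero CC" by auto
  then show ?case using trel.zero ell2.adjoint_zero
    by (simp only: ell2.op_algebra_simps)
next
  case (add T A f T' A' f')
  have c: "T \<in> bounded_ops (ell2 \<nat>)" "T' \<in> bounded_ops (ell2 \<nat>)"
    "A \<in> bounded_ops (ell2 UNIV)" "A' \<in> bounded_ops (ell2 UNIV)"
    using trel_carrier add.hyps by blast+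
  have "astar CC (aadd CC f f') = aadd CC (astar CC f) (astar CC f')" by auto
  then show ?case
    using trel.add[OF add.IH] c by (simp only: ell2.op_algebra_simps ell2.adjoint_add)
next
  case (scale T A f c)
  have c: "T \<in> bounded_ops (ell2 \<nat>)" "A \<in> bounded_ops (ell2 UNIV)"
    using trel_carrier scale.hyps by blast+
  have "astar CC (ascale CC c f) = ascale CC (cnj c) (astar CC f)" by auto
  then show ?case
    using trel.scale[OF scale.IH, of "cnj c"] c by (simp only: ell2.op_algebra_simps ell2.adjoint_scale)
next
  case (mult T A f T' A' f')
  have c: "T \<in> bounded_ops (ell2 \<nat>)" "T' \<in> bounded_ops (ell2 \<nat>)"
    "A \<in> bounded_ops (ell2 UNIV)" "A' \<in> bounded_ops (ell2 UNIV)"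
    using trel_carrier mult.hyps by blast+
  \<comment> \<open>Adjunction reverses the factors of the operators; the third coordinate can
    follow because functions commute.\<close>
  have "astar CC (amult CC f f') = amult CC (astar CC f') (astar CC f)" by auto
  then show ?case
    using trel.mult[OF mult.IH(2,1)] c by (simp only: ell2.op_algebra_simps ell2.adjoint_compose)
qed

section \<open>Norm estimates\<close>

text \<open>Both sides are continuous in \<open>\<xi>\<close>. Finite support is what makes shifting
  far to the right and the use of \<open>trig\<close> possible.\<close>

lemma ell2_bound_by_density:
  assumes T: "T \<in> bounded_ops (ell2 X)" and Y: "\<And>\<xi>. \<xi> \<in> carrier (ell2 X) \<Longrightarrow> finite {x. \<xi> x \<noteq> 0}
      \<Longrightarrow> hnorm (ell2 X) (T \<xi>) \<le> C * hnorm (ell2 X) \<xi>"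
    and \<xi>: "\<xi> \<in> carrier (ell2 X)"
  shows "hnorm (ell2 X) (T \<xi>) \<le> C * hnorm (ell2 X) \<xi>"
proof -
  obtain s where s: "\<And>n. finite {x. s n x \<noteq> 0}" "ell2.hconverges X s \<xi>"
    using ell2_dense[OF \<xi>] by blast
  show ?thesis
  proof (rule LIMSEQ_le)
    show "(\<lambda>n. hnorm (ell2 X) (T (s n))) \<longlonglongrightarrow> hnorm (ell2 X) (T \<xi>)"
      by (rule ell2.hconverges_hnorm[OF ell2.hconverges_op[OF s(2) T]])
    show "(\<lambda>n. C * hnorm (ell2 X) (s n)) \<longlonglongrightarrow> C * hnorm (ell2 X) \<xi>"
      by (rule tendsto_mult_left[OF ell2.hconverges_hnorm[OF s(2)]])
  qed (use Y s ell2.hconvergesD(1)[OF s(2)] in auto)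
qed

text \<open>Far out, \<open>T\<close> and \<open>A\<close> agree, and \<open>A\<close> commutes with translations.\<close>

lemma trel_norm_le:
  assumes G: "(T, A, f) \<in> trel" and \<xi>: "\<xi> \<in> l2"
  shows "hnorm (ell2 UNIV) (A \<xi>) \<le> op_norm (ell2 \<nat>) T * hnorm (ell2 UNIV) \<xi>"
proof (rule ell2_bound_by_density[OF _ _ \<xi>])
  have T: "T \<in> bounded_ops (ell2 \<nat>)" and A: "A \<in> bounded_ops (ell2 UNIV)"
    using trel_carrier[OF G] by auto
  show "A \<in> bounded_ops (ell2 UNIV)" by fact
  fix \<eta> :: "int \<Rightarrow> complex" assume \<eta>: "\<eta> \<in> l2" and fin: "finite {x. \<eta> x \<noteq> 0}"
  obtain d where d: "d \<ge> 0" "agree_from T A d" using trel_agree[OF G] by blast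
  obtain m where m: "\<And>x. \<eta> x \<noteq> 0 \<Longrightarrow> m \<le> x"
    using bdd_below_finite[OF fin] by (auto simp: bdd_below_def)
  \<comment> \<open>\<open>m\<close> bounds the support of \<open>\<eta>\<close> from below, and the
    shift by \<open>d - m\<close> moves that support to where \<open>T\<close> and \<open>A\<close>
    agree.\<close>
  define \<zeta> where "\<zeta> = translation_op UNIV (d - m) \<eta>"
  have \<zeta>: "\<zeta> \<in> l2" using translation_op_bounded(1)[OF \<eta>] by (simp add: \<zeta>_def)
  have low: "\<zeta> x = 0" if "x < d" for x
    using m[of "x - (d - m)"] that by (auto simp: \<zeta>_def translation_op_UNIV[OF \<eta>])
  have N: "\<zeta> \<in> carrier (ell2 \<nat>)" by (rule vanish_below_in_ell2_Nats[OF \<zeta> d(1) low])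
  have A\<eta>: "A \<eta> \<in> l2" by (rule ell2.op_closed[OF A \<eta>])
  have "hnorm (ell2 UNIV) (A \<eta>) = hnorm (ell2 UNIV) (A \<zeta>)"
    unfolding \<zeta>_def trel_translation[OF G \<eta>] by (rule hnorm_translation_UNIV[OF A\<eta>, symmetric])
  also have "A \<zeta> = T \<zeta>" using agree_fromD[OF d(2) \<zeta> low] by simp
  also have "hnorm (ell2 UNIV) (T \<zeta>) = hnorm (ell2 \<nat>) (T \<zeta>)"
    by (rule hnorm_ell2_UNIV[OF ell2.op_closed[OF T N], symmetric])
  also have "\<dots> \<le> op_norm (ell2 \<nat>) T * hnorm (ell2 \<nat>) \<zeta>"
    by (rule ell2.op_norm_bound[OF T N])
  also have "hnorm (ell2 \<nat>) \<zeta> = hnorm (ell2 UNIV) \<eta>"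
    unfolding hnorm_ell2_UNIV[OF N] unfolding \<zeta>_def by (rule hnorm_translation_UNIV[OF \<eta>])
  finally show "hnorm (ell2 UNIV) (A \<eta>) \<le> op_norm (ell2 \<nat>) T * hnorm (ell2 UNIV) \<eta>" .
qed

text \<open>By Parseval the norms of \<open>\<eta>\<close> and \<open>A \<eta>\<close> are those of
  \<open>trig \<eta>\<close> and of its product with \<open>f\<close>, so the pointwise bound on
  \<open>f\<close> is simply integrated.\<close>

lemma trel_norm_le_symbol:
  assumes G: "(T, A, f) \<in> trel" and \<xi>: "\<xi> \<in> l2"
    and M: "0 \<le> M" "\<And>z. z \<in> unit_circle \<Longrightarrow> cmod (f z) \<le> M"
  shows "hnorm (ell2 UNIV) (A \<xi>) \<le> M * hnorm (ell2 UNIV) \<xi>"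
proof (rule ell2_bound_by_density[OF _ _ \<xi>])
  have A: "A \<in> bounded_ops (ell2 UNIV)"
    using trel_carrier[OF G] by auto
  show "A \<in> bounded_ops (ell2 UNIV)" by fact
  fix \<eta> :: "int \<Rightarrow> complex" assume \<eta>: "\<eta> \<in> l2" and fin: "finite {x. \<eta> x \<noteq> 0}"
  have int: "integrable circle_measure (\<lambda>z. (cmod (trig \<zeta> z))\<^sup>2)" for \<zeta>
    by (intro continuous_circle_integrable continuous_intros)
  have fin': "finite {x. A \<eta> x \<noteq> 0}" using trel_trig[OF G fin, of 1] by simp
  have "(hnorm (ell2 UNIV) (A \<eta>))\<^sup>2 = (\<integral>z. (cmod (trig (A \<eta>) z))\<^sup>2 \<partial>circle_measure)"
    by (rule Parseval_trig[OF fin', symmetric])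
  also have "\<dots> \<le> (\<integral>z. M\<^sup>2 * (cmod (trig \<eta> z))\<^sup>2 \<partial>circle_measure)"
  proof (rule integral_mono[OF int integrable_mult_right[OF int]])
    fix z assume "z \<in> space circle_measure"
    then have z: "z \<in> unit_circle" by simp
    have "trig (A \<eta>) z = f z * trig \<eta> z" using trel_trig[OF G fin z] by simp
    then show "(cmod (trig (A \<eta>) z))\<^sup>2 \<le> M\<^sup>2 * (cmod (trig \<eta> z))\<^sup>2"
      using power_mono[OF M(2)[OF z] norm_ge_zero, of 2]
      by (simp add: norm_mult power_mult_distrib mult_right_mono)
  qed
  also have "\<dots> = M\<^sup>2 * (\<integral>z. (cmod (trig \<eta> z))\<^sup>2 \<partial>circle_measure)" by simp
  also have "\<dots> = (M * hnorm (ell2 UNIV) \<eta>)\<^sup>2"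
    unfolding Parseval_trig[OF fin] by (simp add: power_mult_distrib)
  finally show "hnorm (ell2 UNIV) (A \<eta>) \<le> M * hnorm (ell2 UNIV) \<eta>"
    by (rule power2_le_imp_le) (simp add: M(1) hnorm_ell2_nonneg[OF \<eta>])
qed

text \<open>The truncations of \<open>k \<mapsto> z\<^sup>-\<^sup>k\<close> to \<open>{-N..N}\<close> are approximate eigenvectors of \<open>A\<close>.\<close>

lemma trel_symbol_le:
  assumes G: "(T, A, f) \<in> trel" and z: "z \<in> unit_circle"
  shows "cmod (f z) \<le> op_norm (ell2 UNIV) A"
proof (rule ccontr)
  define M where "M = op_norm (ell2 UNIV) A"
  assume "\<not> cmod (f z) \<le> op_norm (ell2 UNIV) A"
  then have less: "M < cmod (f z)" by (simp add: M_def)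
  have A: "A \<in> bounded_ops (ell2 UNIV)" using trel_carrier[OF G] by auto
  have M0: "0 \<le> M" unfolding M_def by (rule ell2.op_norm_nonneg[OF A])
  have sq: "M\<^sup>2 < (cmod (f z))\<^sup>2" using less M0 by (simp add: power_strict_mono)
  obtain d where d: "d \<ge> 0" "local_symbol A f d" using trel_local[OF G] by blast
  have key: "(cmod (f z))\<^sup>2 * (2 * real m + 1) \<le> M\<^sup>2 * (2 * (real m + real_of_int d) + 1)" for m :: nat
  proof -
    \<comment> \<open>With this \<open>N\<close> every window of radius \<open>d\<close> around a
      point of \<open>{- int m..int m}\<close> stays inside the truncation.\<close>
    define N where "N = int m + d"
    define \<xi> where "\<xi> = cut {-N..N} (\<lambda>k. z powi (- k))"
    have \<xi>: "\<xi> \<in> l2" "(hnorm (ell2 UNIV) \<xi>)\<^sup>2 = 2 * (real m + real_of_int d) + 1"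
    proof -
      have 0: "\<xi> x = 0" if "x \<notin> {-N..N} \<inter> UNIV" for x using that by (auto simp: \<xi>_def cut_def)
      have 1: "\<xi> \<in> l2" "(hnorm (ell2 UNIV) \<xi>)\<^sup>2 = (\<Sum>x\<in>{-N..N}. (cmod (\<xi> x))\<^sup>2)"
        by (rule finite_support_ell2[OF finite_atLeastAtMost_int 0]; simp)+
      have "(\<Sum>x\<in>{-N..N}. (cmod (\<xi> x))\<^sup>2) = (\<Sum>x\<in>{-N..N}. 1)"
        using z by (intro sum.cong refl) (simp add: \<xi>_def cut_def norm_power_int)
      also have "\<dots> = 2 * (real m + real_of_int d) + 1" using d(1) by (simp add: N_def)
      finally show "\<xi> \<in> l2" "(hnorm (ell2 UNIV) \<xi>)\<^sup>2 = 2 * (real m + real_of_int d) + 1"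
        using 1 by simp_all
    qed
    have eig: "A \<xi> y = f z * (1 * z powi (- y))" if "y \<in> {- int m..int m}" for y
    proof (rule local_symbolD[OF d(2) z \<xi>(1)])
      fix k assume "\<bar>k - y\<bar> \<le> d"
      then show "\<xi> k = 1 * z powi (- k)" using that by (auto simp: \<xi>_def cut_def N_def)
    qed
    have "(cmod (f z))\<^sup>2 * (2 * real m + 1) = (\<Sum>y\<in>{- int m..int m}. (cmod (f z))\<^sup>2)"
      by (simp add: algebra_simps)
    also have "\<dots> = (\<Sum>y\<in>{- int m..int m}. (cmod (A \<xi> y))\<^sup>2)"
      using z by (intro sum.cong refl) (simp only: eig, simp add: norm_mult norm_power_int)
    also have "\<dots> \<le> (hnorm (ell2 UNIV) (A \<xi>))\<^sup>2"
      by (rule ell2_finite_sum_le[OF ell2.op_closed[OF A \<xi>(1)]]) simp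
    also have "\<dots> \<le> (M * hnorm (ell2 UNIV) \<xi>)\<^sup>2"
      unfolding M_def
      by (intro power_mono ell2.op_norm_bound[OF A \<xi>(1)] hnorm_ell2_nonneg ell2.op_closed[OF A \<xi>(1)])
    finally show ?thesis by (simp add: power_mult_distrib \<xi>(2))
  qed
  \<comment> \<open>\<open>key\<close> keeps \<open>c * (2 * real m + 1)\<close> at most
    \<open>2 * d\<close> times the square of \<open>M\<close> for all \<open>m\<close>, which is
    impossible for \<open>c > 0\<close>.\<close>
  define c where "c = (cmod (f z))\<^sup>2 - M\<^sup>2"
  have "c > 0" using sq by (simp add: c_def)
  then obtain m :: nat where m: "M\<^sup>2 * (2 * real_of_int d) < real m * c"
    using reals_Archimedean3 by blast
  have "c * (2 * real m + 1) \<le> M\<^sup>2 * (2 * real_of_int d)"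
    using key[of m] by (simp add: c_def algebra_simps)
  moreover have "real m * c \<le> c * (2 * real m + 1)" using \<open>c > 0\<close> by (simp add: algebra_simps)
  ultimately show False using m by linarith
qed

text \<open>Turns distances into norms: the norm estimates above apply to the difference of two
  triples as to any other triple.\<close>

lemma trel_diff:
  assumes "(T, A, f) \<in> trel" "(T', A', f') \<in> trel"
  shows "(aadd AN T (ascale AN (-1) T'), aadd AZ A (ascale AZ (-1) A'), aadd CC f (ascale CC (-1) f')) \<in> trel"
  by (intro trel.add trel.scale assms)

lemma op_diff_apply:
  "\<xi> \<in> carrier (ell2 X) \<Longrightarrow> aadd (op_algebra (ell2 X)) S (ascale (op_algebra (ell2 X)) (-1) T) \<xi> =
    vdiff (ell2 X) (S \<xi>) (T \<xi>)"
  by (simp only: op_apply ell2_simps) (simp add: fun_eq_iff)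

lemma op_norm_diff:
  assumes "S \<in> bounded_ops (ell2 X)" "T \<in> bounded_ops (ell2 X)"
  shows "op_norm (ell2 X) (aadd (op_algebra (ell2 X)) S (ascale (op_algebra (ell2 X)) (-1) T)) =
    op_dist (ell2 X) S T"
proof -
  have "aadd (op_algebra (ell2 X)) S (ascale (op_algebra (ell2 X)) (-1) T) =
      (\<lambda>x\<in>carrier (ell2 X). vdiff (ell2 X) (S x) (T x))"
    by (rule ell2.op_eqI[OF ops_closed(2)[OF assms(1) ops_closed(3)[OF assms(2)]]
          ell2.vdiff_op_closed[OF assms]])
      (simp only: op_diff_apply restrict_apply if_True)
  then show ?thesis using assms unfolding op_dist_def by simp
qed

lemma trel_dist_le:
  assumes "(T, A, f) \<in> trel" "(T', A', f') \<in> trel"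
  shows "op_dist (ell2 UNIV) A A' \<le> op_dist (ell2 \<nat>) T T'"
proof (rule ell2.op_dist_leI)
  fix \<xi> :: "int \<Rightarrow> complex" assume \<xi>: "\<xi> \<in> l2"
  have "T \<in> bounded_ops (ell2 \<nat>)" "T' \<in> bounded_ops (ell2 \<nat>)" using assms trel_carrier by blast+
  then show "hnorm (ell2 UNIV) (vdiff (ell2 UNIV) (A \<xi>) (A' \<xi>)) \<le>
      op_dist (ell2 \<nat>) T T' * hnorm (ell2 UNIV) \<xi>"
    using trel_norm_le[OF trel_diff[OF assms] \<xi>] by (simp only: op_diff_apply[OF \<xi>] op_norm_diff)
qed simp

text \<open>Equality makes the relation between operators on the integers and functions contractive
  in both directions, so that it and its converse both extend to closures.\<close>

lemma trel_cdist_eq: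
  assumes "(T, A, f) \<in> trel" "(T', A', f') \<in> trel"
  shows "cdist f f' = op_dist (ell2 UNIV) A A'"
proof (rule antisym)
  have A: "A \<in> bounded_ops (ell2 UNIV)" "A' \<in> bounded_ops (ell2 UNIV)"
    and f: "f \<in> carrier CC" "f' \<in> carrier CC"
    using assms trel_carrier by blast+
  have d: "aadd CC f (ascale CC (-1) f') z = f z - f' z" if "z \<in> unit_circle" for z
    by (simp only: CC_apply[OF that]) simp
  show "cdist f f' \<le> op_dist (ell2 UNIV) A A'"
  proof (rule cdist_leI)
    fix z assume "z \<in> unit_circle"
    then show "cmod (f z - f' z) \<le> op_dist (ell2 UNIV) A A'"
      using trel_symbol_le[OF trel_diff[OF assms]] d A by (simp only: op_norm_diff)
  qed simp
  show "op_dist (ell2 UNIV) A A' \<le> cdist f f'"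
  proof (rule ell2.op_dist_leI)
    fix \<xi> :: "int \<Rightarrow> complex" assume \<xi>: "\<xi> \<in> l2"
    have "cmod (aadd CC f (ascale CC (-1) f') z) \<le> cdist f f'" if "z \<in> unit_circle" for z
      using cdist_bound[OF f that] by (simp only: d[OF that])
    from trel_norm_le_symbol[OF trel_diff[OF assms] \<xi> cdist_nonneg this]
    show "hnorm (ell2 UNIV) (vdiff (ell2 UNIV) (A \<xi>) (A' \<xi>)) \<le> cdist f f' * hnorm (ell2 UNIV) \<xi>"
      by (simp only: op_diff_apply[OF \<xi>])
  qed simp
qed

section \<open>The pairwise relations and their extension by continuity\<close>

definition relTA where "relTA = {(T, A). \<exists>f. (T, A, f) \<in> trel}"
definition relAf where "relAf = {(A, f). \<exists>T. (T, A, f) \<in> trel}"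
definition relfA where "relfA = {(f, A). \<exists>T. (T, A, f) \<in> trel}"

interpretation TA: contractive_star_relation AN "op_dist (ell2 \<nat>)" AZ "op_dist (ell2 UNIV)" relTA
  rewrites "carrier AN = bounded_ops (ell2 \<nat>)" and "carrier AZ = bounded_ops (ell2 UNIV)"
proof -
  show "contractive_star_relation AN (op_dist (ell2 \<nat>)) AZ (op_dist (ell2 UNIV)) relTA"
  proof (intro contractive_star_relation.intro ell2.ops.metric_star_algebra_axioms
      contractive_star_relation_axioms.intro)
    show "relTA \<subseteq> carrier AN \<times> carrier AZ" using trel_carrier by (auto simp: relTA_def)
  qed (auto simp only: relTA_def mem_Collect_eq case_prod_conv ell2.op_algebra_simps(1)
      intro: trel.zero trel.add trel.scale trel.mult trel_star trel_dist_le ell2.mcomplete_ops)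
qed simp_all

interpretation Af: contractive_star_relation AZ "op_dist (ell2 UNIV)" CC cdist relAf
  rewrites "carrier AZ = bounded_ops (ell2 UNIV)"
proof -
  show "contractive_star_relation AZ (op_dist (ell2 UNIV)) CC cdist relAf"
  proof (intro contractive_star_relation.intro ell2.ops.metric_star_algebra_axioms
      metric_star_algebra_CC contractive_star_relation_axioms.intro)
    show "relAf \<subseteq> carrier AZ \<times> carrier CC" using trel_carrier by (auto simp: relAf_def)
    show "cdist f f' \<le> op_dist (ell2 UNIV) A A'" if "(A, f) \<in> relAf" "(A', f') \<in> relAf" for A f A' f'
      using that trel_cdist_eq by (fastforce simp: relAf_def)
  qed (auto simp only: relAf_def mem_Collect_eq case_prod_conv
      intro: trel.zero trel.add trel.scale trel.mult trel_star CC_mcomplete)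
qed simp

interpretation fA: contractive_star_relation CC cdist AZ "op_dist (ell2 UNIV)" relfA
  rewrites "carrier AZ = bounded_ops (ell2 UNIV)"
proof -
  show "contractive_star_relation CC cdist AZ (op_dist (ell2 UNIV)) relfA"
  proof (intro contractive_star_relation.intro ell2.ops.metric_star_algebra_axioms
      metric_star_algebra_CC contractive_star_relation_axioms.intro)
    show "relfA \<subseteq> carrier CC \<times> carrier AZ" using trel_carrier by (auto simp: relfA_def)
    show "op_dist (ell2 UNIV) A A' \<le> cdist f f'" if "(f, A) \<in> relfA" "(f', A') \<in> relfA" for A f A' f'
      using that trel_cdist_eq by (fastforce simp: relfA_def)
  qed (auto simp only: relfA_def mem_Collect_eq case_prod_conv ell2.op_algebra_simps(1)
      intro: trel.zero trel.add trel.scale trel.mult trel_star ell2.mcomplete_ops)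
qed simp

section \<open>Compact operators on square summable functions\<close>

context Metric_space
begin

text \<open>\<open>mtotally_bounded\<close> wants the centres in \<open>S\<close> itself. Halving
  the radius allows centres anywhere in \<open>M\<close>: each centre near \<open>S\<close> is
  replaced by a point of \<open>S\<close> close to it.\<close>

lemma mtotally_bounded_if_nets:
  assumes "S \<subseteq> M" "\<And>e. e > 0 \<Longrightarrow> \<exists>K. finite K \<and> (\<forall>x\<in>S. \<exists>k\<in>K. k \<in> M \<and> d x k < e)"
  shows "mtotally_bounded S"
  unfolding mtotally_bounded_def
proof (intro allI impI)
  fix e :: real assume "e > 0"
  then obtain K where K: "finite K" "\<And>x. x \<in> S \<Longrightarrow> \<exists>k\<in>K. k \<in> M \<and> d x k < e / 2"
    using assms(2)[of "e / 2"] by auto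
  define h where "h k = (SOME x. x \<in> S \<and> d x k < e / 2)" for k
  define L where "L = {k \<in> K. k \<in> M \<and> (\<exists>x\<in>S. d x k < e / 2)}"
  have h: "h k \<in> S \<and> d (h k) k < e / 2" if k: "k \<in> L" for k
    unfolding h_def by (rule someI_ex) (use k in \<open>auto simp: L_def\<close>)
  have "S \<subseteq> (\<Union>x\<in>h ` L. mball x e)"
  proof
    fix x assume x: "x \<in> S"
    then obtain k where k: "k \<in> K" "k \<in> M" "d x k < e / 2" using K(2) by blast
    then have kL: "k \<in> L" using x by (auto simp: L_def)
    have "d (h k) x \<le> d (h k) k + d k x"
      by (rule triangle) (use h[OF kL] k x assms(1) in auto)
    then have "d (h k) x < e" using h[OF kL] k commute[of x k] by linarith
    then have "x \<in> mball (h k) e" using h[OF kL] x assms(1) by auto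
    then show "x \<in> (\<Union>x\<in>h ` L. mball x e)" using kL by blast
  qed
  moreover have "finite (h ` L)" "h ` L \<subseteq> S" using K(1) h by (auto simp: L_def)
  ultimately show "\<exists>K. finite K \<and> K \<subseteq> S \<and> S \<subseteq> (\<Union>x\<in>K. mball x e)" by blast
qed

end

abbreviation unit_ball :: "int set \<Rightarrow> (int \<Rightarrow> complex) set" where
  "unit_ball X \<equiv> {x \<in> carrier (ell2 X). hnorm (ell2 X) x \<le> 1}"

text \<open>Since the space is complete, compactness of the closure is total boundedness, which
  finite nets can deliver.\<close>

lemma compact_ops_ell2_iff:
  assumes T: "T \<in> bounded_ops (ell2 X)"
  shows "T \<in> compact_ops (ell2 X) \<longleftrightarrow> ell2.hmetric.mtotally_bounded X (T ` unit_ball X)"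
proof -
  have "T ` unit_ball X \<subseteq> carrier (ell2 X)" using ell2.op_closed[OF T] by auto
  then show ?thesis
    unfolding compact_ops_def using T ell2.hmetric.mtotally_bounded_eq_compact_closure_of[OF ell2_mcomplete]
    by blast
qed

text \<open>Operators with finitely many nonzero matrix entries. Their norm closure will turn out to
  be the compact operators.\<close>

definition fin_ops :: "int set \<Rightarrow> ((int \<Rightarrow> complex) \<Rightarrow> int \<Rightarrow> complex) set" where
  "fin_ops X = {T \<in> bounded_ops (ell2 X). \<exists>F. finite F \<and> F \<subseteq> X \<and>
    (\<forall>\<xi>\<in>carrier (ell2 X). T \<xi> = cut F (T (cut F \<xi>)))}"

abbreviation fin_closure :: "int set \<Rightarrow> ((int \<Rightarrow> complex) \<Rightarrow> int \<Rightarrow> complex) set" where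
  "fin_closure X \<equiv> op_topology (ell2 X) closure_of fin_ops X"

lemma fin_ops_subset: "fin_ops X \<subseteq> bounded_ops (ell2 X)"
  by (auto simp: fin_ops_def)

lemma fin_closureI:
  assumes "T \<in> bounded_ops (ell2 X)" "\<And>e. e > 0 \<Longrightarrow> \<exists>S\<in>fin_ops X. op_dist (ell2 X) T S \<le> e"
  shows "T \<in> fin_closure X"
  unfolding ell2.opmetric.metric_closure_of_alt
  using assms fin_ops_subset by (fastforce simp: subset_iff)

lemma fin_closureD:
  assumes "T \<in> fin_closure X"
  shows "T \<in> bounded_ops (ell2 X)" "e > 0 \<Longrightarrow> \<exists>S\<in>fin_ops X. op_dist (ell2 X) T S \<le> e"
  using assms unfolding ell2.opmetric.metric_closure_of_alt by auto

lemma fin_closure_closed: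
  assumes T: "T \<in> bounded_ops (ell2 X)"
    and Y: "\<And>e. e > 0 \<Longrightarrow> \<exists>S\<in>fin_closure X. op_dist (ell2 X) T S \<le> e"
  shows "T \<in> fin_closure X"
proof (rule fin_closureI[OF T])
  fix e :: real assume "e > 0"
  then obtain S where S: "S \<in> fin_closure X" "op_dist (ell2 X) T S \<le> e / 2"
    using Y[of "e/2"] by auto
  obtain R where R: "R \<in> fin_ops X" "op_dist (ell2 X) S R \<le> e / 2"
    using fin_closureD(2)[OF S(1), of "e/2"] \<open>e > 0\<close> by auto
  have "op_dist (ell2 X) T R \<le> op_dist (ell2 X) T S + op_dist (ell2 X) S R"
    by (rule ell2.opmetric.triangle) (use T fin_closureD(1)[OF S(1)] R fin_ops_subset in auto)
  then show "\<exists>S\<in>fin_ops X. op_dist (ell2 X) T S \<le> e" using S R by force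
qed

definition cut_op :: "int set \<Rightarrow> int set \<Rightarrow> (int \<Rightarrow> complex) \<Rightarrow> int \<Rightarrow> complex" where
  "cut_op X F = (\<lambda>\<xi>\<in>carrier (ell2 X). cut F \<xi>)"

lemma cut_op_apply: "\<xi> \<in> carrier (ell2 X) \<Longrightarrow> cut_op X F \<xi> = cut F \<xi>"
  by (simp add: cut_op_def)

lemma cut_op_bounded: "cut_op X F \<in> bounded_ops (ell2 X)"
proof (rule ell2.bounded_opsI[where C = 1])
  show "cut_op X F \<in> extensional (carrier (ell2 X))"
    unfolding cut_op_def by (rule restrict_extensional)
  fix \<xi> \<eta> assume "\<xi> \<in> carrier (ell2 X)" "\<eta> \<in> carrier (ell2 X)"
  then show "cut_op X F (vadd (ell2 X) \<xi> \<eta>) = vadd (ell2 X) (cut_op X F \<xi>) (cut_op X F \<eta>)"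
    by (simp add: cut_op_apply ell2_add_closed cut_def fun_eq_iff)
next
  fix c \<xi> assume "\<xi> \<in> carrier (ell2 X)"
  then show "cut_op X F (vscale (ell2 X) c \<xi>) = vscale (ell2 X) c (cut_op X F \<xi>)"
    by (simp add: cut_op_apply ell2_scale_closed cut_def fun_eq_iff)
qed (simp_all add: cut_op_apply cut_closed)

lemma adjoint_cut_op: "adjoint_op (ell2 X) (cut_op X F) = cut_op X F"
proof (rule ell2.adjoint_eqI[OF cut_op_bounded])
  fix \<xi> \<eta> assume "\<xi> \<in> carrier (ell2 X)" "\<eta> \<in> carrier (ell2 X)"
  then show "cinner (ell2 X) (cut_op X F \<xi>) \<eta> = cinner (ell2 X) \<xi> (cut_op X F \<eta>)"
    unfolding cinner_ell2 by (intro infsum_cong) (simp add: cut_op_apply cut_def)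
qed

lemma cut_cut [simp]: "cut E (cut F \<xi>) = cut (E \<inter> F) \<xi>"
  by (auto simp: cut_def)

lemma hnorm_op_cut_le:
  assumes D: "D \<in> bounded_ops (ell2 X)" and F: "finite F" "F \<subseteq> X"
  shows "hnorm (ell2 X) (D (cut F \<xi>)) \<le> (\<Sum>x\<in>F. cmod (\<xi> x) * hnorm (ell2 X) (D (ell2_delta x)))"
  using F
proof (induction F rule: finite_induct)
  case empty
  have "cut {} \<xi> = vzero (ell2 X)" by (simp add: cut_def)
  then show ?case using ell2.op_zero[OF D] by (simp only: ell2.hnorm_zero sum.empty order_refl)
next
  case (insert z F)
  have d: "ell2_delta z \<in> carrier (ell2 X)" using insert by (simp add: ell2_delta_in_carrier)
  have c: "cut F \<xi> \<in> carrier (ell2 X)"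
    by (rule finite_support_ell2(1)[OF insert(1)]) (use insert in \<open>auto simp: cut_def\<close>)
  note Dc = ell2.op_closed[OF D]
  have "cut (insert z F) \<xi> = vadd (ell2 X) (vscale (ell2 X) (\<xi> z) (ell2_delta z)) (cut F \<xi>)"
    using insert by (auto simp: cut_def ell2_delta_def fun_eq_iff)
  then have "D (cut (insert z F) \<xi>) =
      vadd (ell2 X) (vscale (ell2 X) (\<xi> z) (D (ell2_delta z))) (D (cut F \<xi>))"
    using c d by (simp only: ell2.op_add[OF D] ell2.op_scale[OF D] ell2.scale_closed)
  then have "hnorm (ell2 X) (D (cut (insert z F) \<xi>)) \<le>
      cmod (\<xi> z) * hnorm (ell2 X) (D (ell2_delta z)) + hnorm (ell2 X) (D (cut F \<xi>))"
    using ell2.hnorm_triangle[OF ell2.scale_closed[OF Dc[OF d]] Dc[OF c], of "\<xi> z"]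
    by (simp only: ell2.hnorm_scale[OF Dc[OF d]])
  then show ?case using insert by simp
qed

text \<open>Each of the finitely many columns is square summable, so a common finite set of rows
  captures all of them up to a small error.\<close>

lemma column_finite_in_fin_closure:
  assumes R: "R \<in> bounded_ops (ell2 X)" and F: "finite F"
    and RF: "\<And>\<xi>. \<xi> \<in> carrier (ell2 X) \<Longrightarrow> R \<xi> = R (cut F \<xi>)"
  shows "R \<in> fin_closure X"
proof (rule fin_closureI[OF R])
  fix e :: real assume e: "e > 0"
  \<comment> \<open>\<open>F\<close> may stick out of \<open>X\<close>, where there are no basis
    vectors to serve as columns.\<close>
  define G where "G = F \<inter> X"
  have G: "finite G" "G \<subseteq> X" using F by (auto simp: G_def)
  have cutG: "cut F \<xi> = cut G \<xi>" if "\<xi> \<in> carrier (ell2 X)" for \<xi>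
    using ell2_outside[OF that] by (auto simp: cut_def G_def)
  \<comment> \<open>The errors of \<open>card G\<close> columns add up; the added 1 keeps the
    divisor positive.\<close>
  define e' where "e' = e / (real (card G) + 1)"
  have e': "e' > 0" using e by (simp add: e'_def)
  note Rc = ell2.op_closed[OF R]
  have "\<forall>x\<in>G. \<exists>E. finite E \<and> E \<subseteq> X \<and> (\<forall>E'. E \<subseteq> E' \<longrightarrow> hnorm (ell2 X) (\<lambda>y. cut E' (R (ell2_delta x)) y - R (ell2_delta x) y) \<le> e')"
  proof
    fix x assume "x \<in> G"
    then have "R (ell2_delta x) \<in> carrier (ell2 X)" using G by (intro Rc ell2_delta_in_carrier) auto
    from cut_approx[OF this e'] show "\<exists>E. finite E \<and> E \<subseteq> X \<and> (\<forall>E'. E \<subseteq> E' \<longrightarrow> hnorm (ell2 X) (\<lambda>y. cut E' (R (ell2_delta x)) y - R (ell2_delta x) y) \<le> e')"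
      by metis
  qed
  then obtain E where E: "\<And>x. x \<in> G \<Longrightarrow> finite (E x) \<and> E x \<subseteq> X"
    "\<And>x E'. \<lbrakk>x \<in> G; E x \<subseteq> E'\<rbrakk> \<Longrightarrow> hnorm (ell2 X) (\<lambda>y. cut E' (R (ell2_delta x)) y - R (ell2_delta x) y) \<le> e'"
    by metis
  \<comment> \<open>\<open>B\<close> contains \<open>G\<close>, so that one set cuts rows and
    columns alike, as \<open>fin_ops\<close> demands.\<close>
  define B where "B = G \<union> \<Union> (E ` G)"
  have B: "finite B" "B \<subseteq> X" "G \<subseteq> B" using E(1) G by (auto simp: B_def)
  define S where "S = compose (carrier (ell2 X)) (cut_op X B) R"
  have S: "S \<in> bounded_ops (ell2 X)" unfolding S_def by (rule ell2.compose_op_closed[OF cut_op_bounded R])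
  have S_apply: "S \<xi> = cut B (R \<xi>)" if "\<xi> \<in> carrier (ell2 X)" for \<xi>
    using that by (simp add: S_def compose_eq cut_op_apply Rc)
  have "S \<in> fin_ops X"
    unfolding fin_ops_def
  proof (intro CollectI conjI exI[of _ B] S B ballI)
    fix \<xi> assume \<xi>: "\<xi> \<in> carrier (ell2 X)"
    have "R (cut B \<xi>) = R (cut F (cut B \<xi>))" by (rule RF[OF cut_closed(1)[OF \<xi>]])
    also have "cut F (cut B \<xi>) = cut G (cut B \<xi>)" by (rule cutG[OF cut_closed(1)[OF \<xi>]])
    also have "\<dots> = cut F \<xi>" using B(3) cutG[OF \<xi>] by (simp add: Int_absorb2)
    also have "R (cut F \<xi>) = R \<xi>" by (rule RF[OF \<xi>, symmetric])
    finally have "R (cut B \<xi>) = R \<xi>" .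
    then show "S \<xi> = cut B (S (cut B \<xi>))"
      by (simp add: S_apply[OF \<xi>] S_apply[OF cut_closed(1)[OF \<xi>]])
  qed
  moreover have "op_dist (ell2 X) R S \<le> e"
  proof (rule ell2.op_dist_leI)
    fix \<xi> assume \<xi>: "\<xi> \<in> carrier (ell2 X)"
    define D where "D = (\<lambda>x\<in>carrier (ell2 X). vdiff (ell2 X) (S x) (R x))"
    have D: "D \<in> bounded_ops (ell2 X)" unfolding D_def by (rule ell2.vdiff_op_closed[OF S R])
    have D_apply: "D x = vdiff (ell2 X) (S x) (R x)" if "x \<in> carrier (ell2 X)" for x
      using that unfolding D_def by (simp only: restrict_apply if_True)
    have cG: "cut G \<xi> \<in> carrier (ell2 X)" by (rule cut_closed(1)[OF \<xi>])
    have RG: "R \<xi> = R (cut G \<xi>)" using RF[OF \<xi>] cutG[OF \<xi>] by simp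
    then have SG: "S \<xi> = S (cut G \<xi>)" by (simp add: S_apply \<xi> cG)
    have "hnorm (ell2 X) (vdiff (ell2 X) (R \<xi>) (S \<xi>)) = hnorm (ell2 X) (D (cut G \<xi>))"
      unfolding D_apply[OF cG] RG[symmetric] SG[symmetric]
      by (rule ell2.hnorm_vdiff_commute[OF Rc[OF \<xi>] ell2.op_closed[OF S \<xi>]])
    also have "\<dots> \<le> (\<Sum>x\<in>G. cmod (\<xi> x) * hnorm (ell2 X) (D (ell2_delta x)))"
      by (rule hnorm_op_cut_le[OF D G])
    also have "\<dots> \<le> (\<Sum>x\<in>G. hnorm (ell2 X) \<xi> * e')"
    proof (rule sum_mono)
      fix x assume x: "x \<in> G"
      then have dx: "ell2_delta x \<in> carrier (ell2 X)" using G by (intro ell2_delta_in_carrier) auto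
      have "hnorm (ell2 X) (D (ell2_delta x)) \<le> e'"
        unfolding D_apply[OF dx] S_apply[OF dx] ell2_simps
        by (rule E(2)[OF x]) (use x in \<open>auto simp: B_def\<close>)
      then show "cmod (\<xi> x) * hnorm (ell2 X) (D (ell2_delta x)) \<le> hnorm (ell2 X) \<xi> * e'"
        by (intro mult_mono ell2_coord_le \<xi> hnorm_ell2_nonneg ell2.op_closed[OF D dx])
    qed
    also have "\<dots> = (real (card G) * e') * hnorm (ell2 X) \<xi>" by simp
    also have "\<dots> \<le> e * hnorm (ell2 X) \<xi>"
      using e by (intro mult_right_mono hnorm_ell2_nonneg \<xi>) (simp add: e'_def field_simps)
    finally show "hnorm (ell2 X) (vdiff (ell2 X) (R \<xi>) (S \<xi>)) \<le> e * hnorm (ell2 X) \<xi>" .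
  qed (use e in simp)
  ultimately show "\<exists>S\<in>fin_ops X. op_dist (ell2 X) R S \<le> e" by blast
qed

text \<open>Coordinate projections are self-adjoint, so truncation on both sides is a condition
  invariant under adjoints.\<close>

lemma fin_ops_adjoint:
  assumes "T \<in> fin_ops X"
  shows "adjoint_op (ell2 X) T \<in> fin_ops X"
proof -
  obtain F where T: "T \<in> bounded_ops (ell2 X)" and F: "finite F" "F \<subseteq> X"
    and TF: "\<And>\<xi>. \<xi> \<in> carrier (ell2 X) \<Longrightarrow> T \<xi> = cut F (T (cut F \<xi>))"
    using assms by (auto simp: fin_ops_def)
  let ?P = "cut_op X F" and ?c = "compose (carrier (ell2 X))"
  note Tc = ell2.op_closed[OF T] and PB = cut_op_bounded[of X F]
  have TP: "?c T ?P \<in> bounded_ops (ell2 X)" by (rule ell2.compose_op_closed[OF T PB])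
  have "T = ?c ?P (?c T ?P)"
  proof (rule ell2.op_eqI[OF T ell2.compose_op_closed[OF PB TP]])
    fix \<xi> assume \<xi>: "\<xi> \<in> carrier (ell2 X)"
    then show "T \<xi> = ?c ?P (?c T ?P) \<xi>"
      using TF[OF \<xi>] Tc[OF cut_closed(1)[OF \<xi>]] by (simp add: compose_eq cut_op_apply)
  qed
  then have "adjoint_op (ell2 X) T = adjoint_op (ell2 X) (?c ?P (?c T ?P))" by simp
  also have "\<dots> = ?c (?c ?P (adjoint_op (ell2 X) T)) ?P"
    by (simp only: ell2.adjoint_compose[OF PB TP] ell2.adjoint_compose[OF T PB] adjoint_cut_op)
  finally have eq: "adjoint_op (ell2 X) T = ?c (?c ?P (adjoint_op (ell2 X) T)) ?P" .
  have T': "adjoint_op (ell2 X) T \<in> bounded_ops (ell2 X)" by (rule ell2.adjoint_closed[OF T])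
  have "adjoint_op (ell2 X) T \<xi> = cut F (adjoint_op (ell2 X) T (cut F \<xi>))"
    if \<xi>: "\<xi> \<in> carrier (ell2 X)" for \<xi>
    by (subst eq) (use \<xi> cut_closed(1)[OF \<xi>, of F] ell2.op_closed[OF T'] in \<open>simp add: compose_eq cut_op_apply\<close>)
  then show ?thesis using T' F unfolding fin_ops_def by blast
qed

lemma fin_closure_adjoint:
  assumes "T \<in> fin_closure X"
  shows "adjoint_op (ell2 X) T \<in> fin_closure X"
proof (rule fin_closureI)
  have T: "T \<in> bounded_ops (ell2 X)" by (rule fin_closureD(1)[OF assms])
  then show "adjoint_op (ell2 X) T \<in> bounded_ops (ell2 X)" by simp
  fix e :: real assume "e > 0"
  then obtain S where S: "S \<in> fin_ops X" "op_dist (ell2 X) T S \<le> e"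
    using fin_closureD(2)[OF assms] by blast
  then have "op_dist (ell2 X) (adjoint_op (ell2 X) T) (adjoint_op (ell2 X) S) \<le> e"
    using ell2.op_dist_adjoint[OF T, of S] fin_ops_subset by force
  then show "\<exists>S\<in>fin_ops X. op_dist (ell2 X) (adjoint_op (ell2 X) T) S \<le> e"
    using fin_ops_adjoint[OF S(1)] by blast
qed

lemma finite_support_net:
  assumes "finite F" "F \<subseteq> X" "e > 0"
  shows "\<exists>K. finite K \<and> (\<forall>\<eta>. (\<forall>x. x \<notin> F \<longrightarrow> \<eta> x = 0) \<and> (\<forall>x. cmod (\<eta> x) \<le> C) \<longrightarrow>
    (\<exists>k\<in>K. k \<in> carrier (ell2 X) \<and> hnorm (ell2 X) (\<lambda>x. \<eta> x - k x) < e))"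
proof -
  \<comment> \<open>Each of the \<open>card F\<close> coordinates is off by at most
    \<open>r\<close>; this choice keeps the sum of the squared errors below the square of
    \<open>e\<close>.\<close>
  define r where "r = e / (real (card F) + 1)"
  have r: "r > 0" using assms by (simp add: r_def)
  obtain N where N: "finite N" "cball (0::complex) C \<subseteq> (\<Union>w\<in>N. ball w r)"
    using compact_eq_totally_bounded[THEN iffD1, OF compact_cball[of "0::complex" C]] r by blast
  define ext where "ext g = (\<lambda>x. if x \<in> F then g x else 0)" for g :: "int \<Rightarrow> complex"
  define K where "K = ext ` (PiE F (\<lambda>_. N))"
  have "finite K" unfolding K_def by (intro finite_imageI finite_PiE assms N)
  moreover have "\<exists>k\<in>K. k \<in> carrier (ell2 X) \<and> hnorm (ell2 X) (\<lambda>x. \<eta> x - k x) < e"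
    if \<eta>: "\<And>x. x \<notin> F \<Longrightarrow> \<eta> x = 0" "\<And>x. cmod (\<eta> x) \<le> C" for \<eta>
  proof -
    have "\<exists>w\<in>N. dist w (\<eta> x) < r" for x using N(2) \<eta>(2)[of x] by (auto simp: subset_iff)
    then obtain g where g: "\<And>x. g x \<in> N" "\<And>x. dist (g x) (\<eta> x) < r" by metis
    define k where "k = ext (restrict g F)"
    have kK: "k \<in> K" unfolding K_def k_def by (intro imageI) (use g in auto)
    have kF: "k x = (if x \<in> F then g x else 0)" for x by (simp add: k_def ext_def)
    have kc: "k \<in> carrier (ell2 X)"
      by (rule finite_support_ell2(1)[OF assms(1)]) (use assms in \<open>auto simp: kF\<close>)
    have z: "\<eta> x - k x = 0" if "x \<notin> F \<inter> X" for x using that assms \<eta>(1) by (auto simp: kF)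
    have "(hnorm (ell2 X) (\<lambda>x. \<eta> x - k x))\<^sup>2 = (\<Sum>x\<in>F. (cmod (\<eta> x - k x))\<^sup>2)"
      by (rule finite_support_ell2(2)[OF assms(1) z])
    also have "\<dots> \<le> (\<Sum>x\<in>F. r\<^sup>2)"
    proof (rule sum_mono)
      fix x assume "x \<in> F"
      then have "cmod (\<eta> x - k x) \<le> r"
        using g(2)[of x] by (simp add: kF dist_norm norm_minus_commute less_imp_le)
      then show "(cmod (\<eta> x - k x))\<^sup>2 \<le> r\<^sup>2" by (rule power_mono) simp
    qed
    also have "\<dots> = real (card F) * r\<^sup>2" by simp
    also have "\<dots> < (real (card F) + 1)\<^sup>2 * r\<^sup>2"
      using r by (intro mult_strict_right_mono) (auto simp: power2_sum intro!: add_nonneg_pos)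
    also have "\<dots> = e\<^sup>2" by (simp add: r_def flip: power_mult_distrib)
    finally have "hnorm (ell2 X) (\<lambda>x. \<eta> x - k x) < e"
      by (rule power_less_imp_less_base) (use assms in simp)
    then show ?thesis using kK kc by blast
  qed
  ultimately show ?thesis by blast
qed

text \<open>Up to \<open>e / 2\<close> the image of the unit ball is a bounded set of vectors
  supported in one finite set, and such sets have finite nets.\<close>

lemma fin_closure_subset_compact: "fin_closure X \<subseteq> compact_ops (ell2 X)"
proof
  fix T assume TK: "T \<in> fin_closure X"
  have T: "T \<in> bounded_ops (ell2 X)" by (rule fin_closureD(1)[OF TK])
  have "ell2.hmetric.mtotally_bounded X (T ` unit_ball X)"
  proof (rule ell2.hmetric.mtotally_bounded_if_nets)
    show "T ` unit_ball X \<subseteq> carrier (ell2 X)" using ell2.op_closed[OF T] by auto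
    fix e :: real assume e: "e > 0"
    then obtain S where S: "S \<in> fin_ops X" "op_dist (ell2 X) T S \<le> e / 2"
      using fin_closureD(2)[OF TK, of "e/2"] by auto
    then obtain F where SB: "S \<in> bounded_ops (ell2 X)" and F: "finite F" "F \<subseteq> X"
      and SF: "\<And>\<xi>. \<xi> \<in> carrier (ell2 X) \<Longrightarrow> S \<xi> = cut F (S (cut F \<xi>))"
      by (auto simp: fin_ops_def)
    obtain K where K: "finite K" "\<And>\<eta>. \<lbrakk>\<And>x. x \<notin> F \<Longrightarrow> \<eta> x = 0; \<And>x. cmod (\<eta> x) \<le> op_norm (ell2 X) S\<rbrakk> \<Longrightarrow>
        \<exists>k\<in>K. k \<in> carrier (ell2 X) \<and> hnorm (ell2 X) (\<lambda>x. \<eta> x - k x) < e / 2"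
      using finite_support_net[OF F, of "e/2" "op_norm (ell2 X) S"] e by auto
    have "\<exists>k\<in>K. k \<in> carrier (ell2 X) \<and> hdist (ell2 X) (T \<xi>) k < e" if \<xi>: "\<xi> \<in> unit_ball X" for \<xi>
    proof -
      have \<xi>c: "\<xi> \<in> carrier (ell2 X)" "hnorm (ell2 X) \<xi> \<le> 1" using \<xi> by auto
      note Sc = ell2.op_closed[OF SB \<xi>c(1)] and Tc = ell2.op_closed[OF T \<xi>c(1)]
      have z: "S \<xi> x = 0" if "x \<notin> F" for x
        using that by (subst SF[OF \<xi>c(1)]) (simp add: cut_def)
      have b: "cmod (S \<xi> x) \<le> op_norm (ell2 X) S" for x
      proof -
        have "cmod (S \<xi> x) \<le> op_norm (ell2 X) S * hnorm (ell2 X) \<xi>"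
          using ell2_coord_le[OF Sc, of x] ell2.op_norm_bound[OF SB \<xi>c(1)] by linarith
        also have "\<dots> \<le> op_norm (ell2 X) S * 1"
          by (rule mult_left_mono[OF \<xi>c(2) ell2.op_norm_nonneg[OF SB]])
        finally show ?thesis by simp
      qed
      obtain k where k: "k \<in> K" "k \<in> carrier (ell2 X)" "hnorm (ell2 X) (\<lambda>x. S \<xi> x - k x) < e / 2"
        using K(2)[of "S \<xi>"] z b by blast
      have "hnorm (ell2 X) (vdiff (ell2 X) (T \<xi>) (S \<xi>)) \<le> op_dist (ell2 X) T S * hnorm (ell2 X) \<xi>"
        by (rule ell2.op_dist_bound[OF T SB \<xi>c(1)])
      also have "\<dots> \<le> e / 2 * 1"
        by (rule mult_mono) (use S(2) \<xi>c e hnorm_ell2_nonneg in auto)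
      finally have "hnorm (ell2 X) (vdiff (ell2 X) (T \<xi>) (S \<xi>)) \<le> e / 2" by simp
      moreover have "hnorm (ell2 X) (vdiff (ell2 X) (T \<xi>) k) \<le>
          hnorm (ell2 X) (vdiff (ell2 X) (T \<xi>) (S \<xi>)) + hnorm (ell2 X) (vdiff (ell2 X) (S \<xi>) k)"
        by (rule ell2.hnorm_vdiff_triangle[OF Tc Sc k(2)])
      ultimately have "hdist (ell2 X) (T \<xi>) k < e"
        using k(3) unfolding ell2.hdist_eq[OF Tc k(2)] by simp
      then show ?thesis using k by blast
    qed
    then show "\<exists>K. finite K \<and> (\<forall>x\<in>T ` unit_ball X. \<exists>k\<in>K. k \<in> carrier (ell2 X) \<and> hdist (ell2 X) x k < e)"
      using K(1) by blast
  qed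
  then show "T \<in> compact_ops (ell2 X)" using compact_ops_ell2_iff[OF T] by blast
qed

text \<open>A finite net for the image of the unit ball can be truncated uniformly, so cutting the
  rows of \<open>T\<close> down to a finite set \<open>E\<close> changes \<open>T\<close> little in
  norm.\<close>

lemma compact_subset_fin_closure: "compact_ops (ell2 X) \<subseteq> fin_closure X"
proof
  fix T assume TK: "T \<in> compact_ops (ell2 X)"
  have T: "T \<in> bounded_ops (ell2 X)" using TK by (simp add: compact_ops_def)
  have tb: "ell2.hmetric.mtotally_bounded X (T ` unit_ball X)" using compact_ops_ell2_iff[OF T] TK by blast
  show "T \<in> fin_closure X"
  proof (rule fin_closure_closed[OF T])
    fix e :: real assume e: "e > 0"
    \<comment> \<open>Three errors occur: the truncation of \<open>T \<xi> - k\<close>, the change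
      of \<open>k\<close> under truncation, and \<open>k - T \<xi>\<close> itself.\<close>
    define r where "r = e / 3"
    have r: "r > 0" using e by (simp add: r_def)
    obtain K where K: "finite K" "K \<subseteq> T ` unit_ball X"
      "T ` unit_ball X \<subseteq> (\<Union>k\<in>K. ell2.hmetric.mball X k r)"
      using tb[unfolded ell2.hmetric.mtotally_bounded_def, rule_format, OF r] by blast
    have Kc: "k \<in> carrier (ell2 X)" if "k \<in> K" for k using that K(2) ell2.op_closed[OF T] by auto
    have "\<forall>k\<in>K. \<exists>F. finite F \<and> (\<forall>E. F \<subseteq> E \<longrightarrow> hnorm (ell2 X) (\<lambda>x. cut E k x - k x) \<le> r)"
    proof
      fix k assume k: "k \<in> K"
      from cut_approx[OF Kc[OF k] r]
      show "\<exists>F. finite F \<and> (\<forall>E. F \<subseteq> E \<longrightarrow> hnorm (ell2 X) (\<lambda>x. cut E k x - k x) \<le> r)"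
        by metis
    qed
    then obtain F where F: "\<And>k. k \<in> K \<Longrightarrow> finite (F k)"
      "\<And>k E. \<lbrakk>k \<in> K; F k \<subseteq> E\<rbrakk> \<Longrightarrow> hnorm (ell2 X) (\<lambda>x. cut E k x - k x) \<le> r" by metis
    define E where "E = \<Union> (F ` K)"
    have E: "finite E" using F(1) K(1) by (auto simp: E_def)
    define S where "S = compose (carrier (ell2 X)) (cut_op X E) T"
    have S: "S \<in> bounded_ops (ell2 X)" unfolding S_def by (rule ell2.compose_op_closed[OF cut_op_bounded T])
    have S_apply: "S \<xi> = cut E (T \<xi>)" if "\<xi> \<in> carrier (ell2 X)" for \<xi>
      using that by (simp add: S_def compose_eq cut_op_apply ell2.op_closed[OF T])
    \<comment> \<open>\<open>S\<close> has finitely many rows, so its adjoint has finitely many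
      columns and \<open>column_finite_in_fin_closure\<close> applies to the adjoint.\<close>
    have S': "adjoint_op (ell2 X) S = compose (carrier (ell2 X)) (adjoint_op (ell2 X) T) (cut_op X E)"
      by (simp only: S_def ell2.adjoint_compose[OF cut_op_bounded T] adjoint_cut_op)
    have "adjoint_op (ell2 X) S \<in> fin_closure X"
    proof (rule column_finite_in_fin_closure[OF ell2.adjoint_closed[OF S] E])
      fix \<xi> assume \<xi>: "\<xi> \<in> carrier (ell2 X)"
      then show "adjoint_op (ell2 X) S \<xi> = adjoint_op (ell2 X) S (cut E \<xi>)"
        using cut_closed(1)[OF \<xi>] by (simp add: S' compose_eq cut_op_apply)
    qed
    then have "S \<in> fin_closure X" using fin_closure_adjoint ell2.adjoint_adjoint[OF S] by metis
    moreover have "op_dist (ell2 X) T S \<le> e"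
      unfolding op_dist_def
    \<comment> \<open>The supremum is estimated on the unit ball directly, because the net covers
      only images of vectors of norm at most 1.\<close>
    proof (simp only: T S simp_thms if_True op_norm_def, rule cSUP_least)
      have z: "hnorm (ell2 X) (\<lambda>x. 0) = 0" by (rule ell2.hnorm_zero[of X, unfolded ell2_simps])
      have "(\<lambda>x. 0) \<in> unit_ball X"
        unfolding mem_Collect_eq z using ell2_zero_closed by (intro conjI zero_le_one)
      then show "unit_ball X \<noteq> {}" by blast
      fix \<xi> assume \<xi>: "\<xi> \<in> unit_ball X"
      then have \<xi>c: "\<xi> \<in> carrier (ell2 X)" by simp
      note Tc = ell2.op_closed[OF T \<xi>c]
      obtain k where k: "k \<in> K" "T \<xi> \<in> ell2.hmetric.mball X k r" using K(3) \<xi> by blast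
      have kd: "hnorm (ell2 X) (\<lambda>x. k x - T \<xi> x) < r"
        using k Kc[OF k(1)] Tc by (simp add: ell2.hmetric.in_mball)
      have "hnorm (ell2 X) (\<lambda>x. T \<xi> x - S \<xi> x) = hnorm (ell2 X) (vdiff (ell2 X) (S \<xi>) (T \<xi>))"
        using ell2.hnorm_vdiff_commute[OF Tc ell2.op_closed[OF S \<xi>c]] by simp
      also have "\<dots> \<le> hnorm (ell2 X) (vdiff (ell2 X) (S \<xi>) (cut E k)) + hnorm (ell2 X) (vdiff (ell2 X) (cut E k) (T \<xi>))"
        by (rule ell2.hnorm_vdiff_triangle[OF ell2.op_closed[OF S \<xi>c] cut_closed(1)[OF Kc[OF k(1)]] Tc])
      also have "hnorm (ell2 X) (vdiff (ell2 X) (cut E k) (T \<xi>)) \<le>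
          hnorm (ell2 X) (vdiff (ell2 X) (cut E k) k) + hnorm (ell2 X) (vdiff (ell2 X) k (T \<xi>))"
        by (rule ell2.hnorm_vdiff_triangle[OF cut_closed(1)[OF Kc[OF k(1)]] Kc[OF k(1)] Tc])
      also have "hnorm (ell2 X) (vdiff (ell2 X) (cut E k) k) \<le> r"
        using F(2)[OF k(1), of E] k(1) by (auto simp: E_def)
      also have "hnorm (ell2 X) (vdiff (ell2 X) (S \<xi>) (cut E k)) \<le> r"
      proof -
        have "vdiff (ell2 X) (S \<xi>) (cut E k) = cut E (vdiff (ell2 X) (T \<xi>) k)"
          unfolding S_apply[OF \<xi>c] by (auto simp: cut_def)
        then have "hnorm (ell2 X) (vdiff (ell2 X) (S \<xi>) (cut E k)) \<le> hnorm (ell2 X) (vdiff (ell2 X) (T \<xi>) k)"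
          using cut_closed(2)[OF ell2.vdiff_closed[OF Tc Kc[OF k(1)]], of E] by (simp only:)
        also have "\<dots> \<le> r"
          using kd ell2.hnorm_vdiff_commute[OF Tc Kc[OF k(1)]] by simp
        finally show ?thesis .
      qed
      finally show "hnorm (ell2 X) ((\<lambda>x\<in>carrier (ell2 X). vdiff (ell2 X) (T x) (S x)) \<xi>) \<le> e"
        using kd \<xi>c by (simp add: r_def)
    qed
    ultimately show "\<exists>S\<in>fin_closure X. op_dist (ell2 X) T S \<le> e" by blast
  qed
qed

lemma compact_ops_ell2: "compact_ops (ell2 X) = fin_closure X"
  using fin_closure_subset_compact compact_subset_fin_closure by blast

section \<open>The extension of the partial translation algebra\<close>

lemma trel_generated:
  assumes "(T, A, f) \<in> trel"
  shows "\<lbrakk>star_subalgebra AN B; range (translation_op \<nat>) \<subseteq> B\<rbrakk> \<Longrightarrow> T \<in> B"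
    and "\<lbrakk>star_subalgebra AZ B'; range (translation_op UNIV) \<subseteq> B'\<rbrakk> \<Longrightarrow> A \<in> B'"
  using assms by (induction rule: trel.induct) (auto simp only: star_subalgebra_def)

abbreviation "PTN \<equiv> op_topology (ell2 \<nat>) closure_of (fst ` relTA)"
abbreviation "PTZ \<equiv> op_topology (ell2 UNIV) closure_of (fst ` relAf)"

text \<open>The closure on the right is an algebra as the domain of the closed relation, and every
  admissible algebra contains the first coordinates by induction on \<open>trel\<close>.\<close>

lemma partial_translation_algebra_Nats:
  "partial_translation_algebra \<nat> = AN\<lparr>carrier := PTN\<rparr>"
proof -
  have "(\<lambda>B. star_subalgebra AN B \<and> closedin (op_topology (ell2 \<nat>)) B) hull
      range (translation_op \<nat>) = PTN"
  proof (rule hull_unique)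
    have "range (translation_op \<nat>) \<subseteq> fst ` relTA"
      unfolding relTA_def using trel.gen by force
    also have "\<dots> \<subseteq> PTN" by (rule closure_of_subset) (use TA.subset in auto)
    finally show "range (translation_op \<nat>) \<subseteq> PTN" .
    show "star_subalgebra AN PTN \<and> closedin (op_topology (ell2 \<nat>)) PTN"
      using TA.star_subalgebra_dom by simp
    fix B assume B: "range (translation_op \<nat>) \<subseteq> B"
      "star_subalgebra AN B \<and> closedin (op_topology (ell2 \<nat>)) B"
    have "fst ` relTA \<subseteq> B" using trel_generated(1) B by (force simp: relTA_def)
    then show "PTN \<subseteq> B" by (rule closure_of_minimal) (use B in simp)
  qed
  then show ?thesis by (simp add: partial_translation_algebra_def generated_cstar_algebra_def)
qed

lemma partial_translation_algebra_UNIV: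
  "partial_translation_algebra UNIV = AZ\<lparr>carrier := PTZ\<rparr>"
proof -
  have "(\<lambda>B. star_subalgebra AZ B \<and> closedin (op_topology (ell2 UNIV)) B) hull
      range (translation_op UNIV) = PTZ"
  proof (rule hull_unique)
    have "range (translation_op UNIV) \<subseteq> fst ` relAf"
      unfolding relAf_def using trel.gen by force
    also have "\<dots> \<subseteq> PTZ" by (rule closure_of_subset) (use Af.subset in auto)
    finally show "range (translation_op UNIV) \<subseteq> PTZ" .
    show "star_subalgebra AZ PTZ \<and> closedin (op_topology (ell2 UNIV)) PTZ"
      using Af.star_subalgebra_dom by simp
    fix B assume B: "range (translation_op UNIV) \<subseteq> B"
      "star_subalgebra AZ B \<and> closedin (op_topology (ell2 UNIV)) B"
    have "fst ` relAf \<subseteq> B" using trel_generated(2) B by (force simp: relAf_def)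
    then show "PTZ \<subseteq> B" by (rule closure_of_minimal) (use B in simp)
  qed
  then show ?thesis by (simp add: partial_translation_algebra_def generated_cstar_algebra_def)
qed

lemma TA_Cod: "op_topology (ell2 UNIV) closure_of (snd ` relTA) = PTZ"
proof -
  have "snd ` relTA = fst ` relAf" by (force simp: relTA_def relAf_def)
  then show ?thesis by simp
qed

definition phi where "phi = TA.lift"
definition gamma where "gamma = Af.lift"

lemma phi_star_hom: "phi \<in> star_hom (partial_translation_algebra \<nat>) (partial_translation_algebra UNIV)"
  unfolding phi_def
  by (rule TA.lift_star_hom[OF partial_translation_algebra_Nats partial_translation_algebra_UNIV])
    (simp only: TA_Cod subset_refl)

lemma phi_translation: "phi (translation_op \<nat> n) = translation_op UNIV n"
  unfolding phi_def
  by (rule TA.lift_eq, rule subsetD[OF TA.G_subset_Gbar]) (use trel.gen in \<open>auto simp only: relTA_def\<close>)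

subsection \<open>Finite matrices\<close>

text \<open>Elements of the uncompleted algebra with vanishing symbol. They form a two-sided ideal,
  so one rank-one projection yields all matrix units.\<close>

definition ktrel where "ktrel = {T. (T, azero AZ, azero CC) \<in> trel}"

lemma ktrel_add: "\<lbrakk>S \<in> ktrel; T \<in> ktrel\<rbrakk> \<Longrightarrow> aadd AN S T \<in> ktrel"
proof -
  assume "S \<in> ktrel" "T \<in> ktrel"
  then have "(aadd AN S T, aadd AZ (azero AZ) (azero AZ), aadd CC (azero CC) (azero CC)) \<in> trel"
    unfolding ktrel_def mem_Collect_eq by (rule trel.add)
  moreover have "aadd AZ (azero AZ) (azero AZ) = azero AZ" by (auto simp: fun_eq_iff)
  moreover have "aadd CC (azero CC) (azero CC) = azero CC" by auto
  ultimately show ?thesis by (simp only: ktrel_def mem_Collect_eq)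
qed

lemma ktrel_scale: "S \<in> ktrel \<Longrightarrow> ascale AN c S \<in> ktrel"
proof -
  assume "S \<in> ktrel"
  then have "(ascale AN c S, ascale AZ c (azero AZ), ascale CC c (azero CC)) \<in> trel"
    unfolding ktrel_def mem_Collect_eq by (rule trel.scale)
  moreover have "ascale AZ c (azero AZ) = azero AZ" by (auto simp: fun_eq_iff)
  moreover have "ascale CC c (azero CC) = azero CC" by auto
  ultimately show ?thesis by (simp only: ktrel_def mem_Collect_eq)
qed

lemma ktrel_mult:
  assumes T: "T \<in> ktrel" and S: "(S, A, f) \<in> trel"
  shows "amult AN S T \<in> ktrel" "amult AN T S \<in> ktrel"
proof -
  have A: "A \<in> bounded_ops (ell2 UNIV)" using trel_carrier[OF S] by simp
  have T': "(T, azero AZ, azero CC) \<in> trel" using T by (simp only: ktrel_def mem_Collect_eq)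
  have "amult AZ A (azero AZ) = azero AZ"
  proof (rule ell2.op_eqI[OF ops_closed(4)[OF A ops_closed(1)] ops_closed(1)])
    fix \<xi> assume "\<xi> \<in> l2"
    then show "amult AZ A (azero AZ) \<xi> = azero AZ \<xi>"
      using ell2.op_zero[OF A] by (simp only: op_apply ell2_simps)
  qed
  moreover have "amult AZ (azero AZ) A = azero AZ"
  proof (rule ell2.op_eqI[OF ops_closed(4)[OF ops_closed(1) A] ops_closed(1)])
    fix \<xi> assume "\<xi> \<in> l2"
    then show "amult AZ (azero AZ) A \<xi> = azero AZ \<xi>"
      using ell2.op_closed[OF A] by (simp only: op_apply)
  qed
  moreover have "amult CC f (azero CC) = azero CC" "amult CC (azero CC) f = azero CC" by auto
  ultimately show "amult AN S T \<in> ktrel" "amult AN T S \<in> ktrel"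
    using trel.mult[OF S T'] trel.mult[OF T' S] by (simp_all only: ktrel_def mem_Collect_eq)
qed

definition matrix_unit :: "int \<Rightarrow> int \<Rightarrow> (int \<Rightarrow> complex) \<Rightarrow> int \<Rightarrow> complex" where
  "matrix_unit i j = (\<lambda>\<xi>\<in>carrier (ell2 \<nat>). \<lambda>y. if y = i then \<xi> j else 0)"

text \<open>With \<open>S = t\<^sub>1\<close>, the projection onto \<open>\<delta>\<^sub>0\<close> is \<open>1 - S S\<^sup>*\<close>.\<close>

lemma matrix_unit_0: "matrix_unit 0 0 \<in> ktrel"
proof -
  let ?t = "\<lambda>X n. translation_op X n"
  have G: "(aadd AN (?t \<nat> 0) (ascale AN (-1) (amult AN (?t \<nat> 1) (?t \<nat> (-1)))),
      aadd AZ (?t UNIV 0) (ascale AZ (-1) (amult AZ (?t UNIV 1) (?t UNIV (-1)))),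
      aadd CC (monomial 0) (ascale CC (-1) (amult CC (monomial 1) (monomial (-1))))) \<in> trel"
    by (intro trel.intros)
  have "matrix_unit 0 0 = aadd AN (?t \<nat> 0) (ascale AN (-1) (amult AN (?t \<nat> 1) (?t \<nat> (-1))))"
    (is "_ = ?P")
  proof (rule extensionalityI[where A = "carrier (ell2 \<nat>)"])
    show "matrix_unit 0 0 \<in> extensional (carrier (ell2 \<nat>))"
      unfolding matrix_unit_def by (rule restrict_extensional)
    show "?P \<in> extensional (carrier (ell2 \<nat>))"
      by (rule ell2.op_extensional) (intro ops_closed translation_op_in_bounded_ops)
    fix \<xi> assume \<xi>: "\<xi> \<in> carrier (ell2 \<nat>)"
    show "matrix_unit 0 0 \<xi> = ?P \<xi>"
      using \<xi> translation_op_bounded(1)[OF \<xi>]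
      by (auto simp only: op_apply translation_op_apply)
        (auto simp: matrix_unit_def Nats_int_iff fun_eq_iff ell2_outside)
  qed
  \<comment> \<open>On the integers the shift is unitary, and on the circle \<open>z\<close> has
    inverse \<open>z powi (-1)\<close>; hence both symbols of the projection vanish.\<close>
  moreover have "aadd AZ (?t UNIV 0) (ascale AZ (-1) (amult AZ (?t UNIV 1) (?t UNIV (-1)))) = azero AZ"
    (is "?Q = _")
  proof (rule ell2.op_eqI[where X = UNIV])
    show "?Q \<in> bounded_ops (ell2 UNIV)" by (intro ops_closed translation_op_in_bounded_ops)
    fix \<xi> assume \<xi>: "\<xi> \<in> l2"
    show "?Q \<xi> = azero AZ \<xi>"
      using \<xi> translation_op_bounded(1)[OF \<xi>]
      by (simp only: op_apply translation_op_apply) (simp add: fun_eq_iff)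
  qed (rule ops_closed)
  moreover have "aadd CC (monomial 0) (ascale CC (-1) (amult CC (monomial 1) (monomial (-1)))) = azero CC"
    by (auto simp: fun_eq_iff power_int_minus) (metis norm_zero right_inverse zero_neq_one)
  ultimately show ?thesis using G by (simp only: ktrel_def mem_Collect_eq)
qed

lemma matrix_unit_ktrel:
  assumes "i \<in> \<nat>" "j \<in> \<nat>"
  shows "matrix_unit i j \<in> ktrel"
proof -
  let ?P = "amult AN (translation_op \<nat> i) (amult AN (matrix_unit 0 0) (translation_op \<nat> (- j)))"
  have k: "?P \<in> ktrel" by (rule ktrel_mult(1)[OF ktrel_mult(2)[OF matrix_unit_0 trel.gen] trel.gen])
  have "matrix_unit i j = ?P"
  proof (rule extensionalityI[where A = "carrier (ell2 \<nat>)"])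
    show "matrix_unit i j \<in> extensional (carrier (ell2 \<nat>))"
      unfolding matrix_unit_def by (rule restrict_extensional)
    show "?P \<in> extensional (carrier (ell2 \<nat>))"
      using k trel_carrier by (intro ell2.op_extensional) (auto simp only: ktrel_def)
    fix \<xi> assume \<xi>: "\<xi> \<in> carrier (ell2 \<nat>)"
    have m: "matrix_unit 0 0 \<eta> = (\<lambda>y. if y = 0 then \<eta> 0 else 0)" if "\<eta> \<in> carrier (ell2 \<nat>)" for \<eta>
      using that by (simp add: matrix_unit_def)
    have "matrix_unit 0 0 (translation_op \<nat> (- j) \<xi>) = (\<lambda>y. if y = 0 then \<xi> j else 0)"
      using assms by (subst m[OF translation_op_bounded(1)[OF \<xi>]]) (auto simp: translation_op_apply[OF \<xi>])
    moreover have "(\<lambda>y. if y = 0 then \<xi> j else 0) \<in> carrier (ell2 \<nat>)"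
      by (rule finite_support_ell2(1)[of "{0}"]) auto
    ultimately show "matrix_unit i j \<xi> = ?P \<xi>"
      using \<xi> assms
      by (simp only: op_apply translation_op_apply) (auto simp: matrix_unit_def fun_eq_iff)
  qed
  then show ?thesis using k by simp
qed

lemma finite_matrix_ktrel:
  assumes "finite P" "P \<subseteq> \<nat> \<times> \<nat>"
  shows "(\<lambda>\<xi>\<in>carrier (ell2 \<nat>). \<lambda>y. \<Sum>p\<in>P. if y = fst p then a p * \<xi> (snd p) else 0) \<in> ktrel"
  using assms
proof (induction P rule: finite_induct)
  case empty
  have "(\<lambda>\<xi>\<in>carrier (ell2 \<nat>). \<lambda>y. \<Sum>p\<in>{}. if y = fst p then a p * \<xi> (snd p) else 0) = azero AN"
    by (auto simp: fun_eq_iff)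
  then show ?case using trel.zero by (simp only: ktrel_def mem_Collect_eq)
next
  case (insert q P)
  let ?M = "\<lambda>P. (\<lambda>\<xi>\<in>carrier (ell2 \<nat>). \<lambda>y. \<Sum>p\<in>P. if y = fst p then a p * \<xi> (snd p) else 0)"
  have "?M (insert q P) = aadd AN (ascale AN (a q) (matrix_unit (fst q) (snd q))) (?M P)" (is "_ = ?R")
  proof (rule extensionalityI[where A = "carrier (ell2 \<nat>)"])
    show "?M (insert q P) \<in> extensional (carrier (ell2 \<nat>))" by (rule restrict_extensional)
    show "?R \<in> extensional (carrier (ell2 \<nat>))"
      unfolding ell2.op_algebra_simps by (rule restrict_extensional)
    fix \<xi> assume \<xi>: "\<xi> \<in> carrier (ell2 \<nat>)"
    show "?M (insert q P) \<xi> = ?R \<xi>"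
      using insert(1,2) \<xi>
      by (simp only: op_apply restrict_apply if_True) (simp add: fun_eq_iff matrix_unit_def \<xi>)
  qed
  moreover have "?R \<in> ktrel"
    by (intro ktrel_add ktrel_scale matrix_unit_ktrel insert.IH) (use insert.prems in auto)
  ultimately show ?case by (simp only:)
qed

text \<open>Expansion into matrix units. Finite matrices thus lie in the algebra before completion,
  with symbol exactly zero; limits are taken only in \<open>fin_closure_Gbar\<close>.\<close>

lemma fin_ops_ktrel:
  assumes "T \<in> fin_ops \<nat>"
  shows "T \<in> ktrel"
proof -
  obtain F where T: "T \<in> bounded_ops (ell2 \<nat>)" and F: "finite F" "F \<subseteq> \<nat>"
    and TF: "\<And>\<xi>. \<xi> \<in> carrier (ell2 \<nat>) \<Longrightarrow> T \<xi> = cut F (T (cut F \<xi>))"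
    using assms by (auto simp: fin_ops_def)
  let ?M = "\<lambda>\<xi>\<in>carrier (ell2 \<nat>). \<lambda>y. \<Sum>p\<in>F \<times> F. if y = fst p then T (ell2_delta (snd p)) (fst p) * \<xi> (snd p) else 0"
  have "T = ?M"
  proof (rule extensionalityI[OF ell2.op_extensional[OF T]])
    show "?M \<in> extensional (carrier (ell2 \<nat>))" by (rule restrict_extensional)
    fix \<xi> assume \<xi>: "\<xi> \<in> carrier (ell2 \<nat>)"
    have "T \<xi> y = (\<Sum>p\<in>F \<times> F. if y = fst p then T (ell2_delta (snd p)) (fst p) * \<xi> (snd p) else 0)" for y
    proof -
      have "(\<Sum>p\<in>F \<times> F. if y = fst p then T (ell2_delta (snd p)) (fst p) * \<xi> (snd p) else 0) =
          (\<Sum>i\<in>F. \<Sum>j\<in>F. if y = i then T (ell2_delta j) i * \<xi> j else 0)"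
        by (simp add: sum.cartesian_product case_prod_beta)
      also have "\<dots> = (\<Sum>i\<in>F. if y = i then (\<Sum>j\<in>F. T (ell2_delta j) i * \<xi> j) else 0)"
        by (intro sum.cong refl) simp
      also have "\<dots> = (if y \<in> F then (\<Sum>j\<in>F. T (ell2_delta j) y * \<xi> j) else 0)"
        using F by simp
      also have "\<dots> = cut F (T (cut F \<xi>)) y"
      proof (cases "y \<in> F")
        case True
        then have y: "y \<in> \<nat>" using F by blast
        have "T (cut F \<xi>) y = cinner (ell2 \<nat>) (T (cut F \<xi>)) (ell2_delta y)"
          by (rule cinner_ell2_delta[OF y, symmetric])
        also have "\<dots> = (\<Sum>j\<in>F. \<xi> j * cinner (ell2 \<nat>) (T (ell2_delta j)) (ell2_delta y))"
          by (rule op_ell2_finite_sum[OF T ell2_delta_in_carrier[OF y] F])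
        also have "\<dots> = (\<Sum>j\<in>F. T (ell2_delta j) y * \<xi> j)"
          by (simp only: cinner_ell2_delta[OF y] mult.commute)
        finally show ?thesis using True by (simp add: cut_def)
      qed (simp add: cut_def)
      also have "\<dots> = T \<xi> y" using TF[OF \<xi>] by simp
      finally show ?thesis by simp
    qed
    then show "T \<xi> = ?M \<xi>" using \<xi> by (simp only: restrict_apply if_True) (rule ext)
  qed
  moreover have "?M \<in> ktrel" by (rule finite_matrix_ktrel) (use F in auto)
  ultimately show ?thesis by simp
qed

lemma fin_closure_Gbar:
  assumes "K \<in> fin_closure \<nat>"
  shows "(K, azero AZ) \<in> TA.Gbar"
proof -
  obtain s where s: "range s \<subseteq> fin_ops \<nat>" "ell2.ops.converges \<nat> s K"
    using assms ell2.ops.closure_of_iff_converges[OF fin_ops_subset] by blast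
  have "(s n, azero AZ) \<in> relTA" for n
    using s(1) fin_ops_ktrel unfolding relTA_def ktrel_def by blast
  then show ?thesis
    by (rule TA.GbarI[OF _ s(2) ell2.ops.converges_const[OF ops_closed(1)]])
qed

subsection \<open>Compressions\<close>

text \<open>The Toeplitz operator with symbol \<open>A\<close>, seen on sequences. It is linear and
  contractive in \<open>A\<close>, though not multiplicative, and serves as a linear section of
  \<open>phi\<close>.\<close>

definition compress :: "((int \<Rightarrow> complex) \<Rightarrow> int \<Rightarrow> complex) \<Rightarrow> (int \<Rightarrow> complex) \<Rightarrow> int \<Rightarrow> complex" where
  "compress A = (\<lambda>\<xi>\<in>carrier (ell2 \<nat>). cut \<nat> (A \<xi>))"

lemma compress_apply: "\<xi> \<in> carrier (ell2 \<nat>) \<Longrightarrow> compress A \<xi> = cut \<nat> (A \<xi>)"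
  by (simp add: compress_def)

lemma cut_Nats:
  assumes "\<xi> \<in> l2"
  shows "cut \<nat> \<xi> \<in> carrier (ell2 \<nat>)" "hnorm (ell2 \<nat>) (cut \<nat> \<xi>) \<le> hnorm (ell2 UNIV) \<xi>"
proof -
  have "cut \<nat> \<xi> \<in> l2" by (rule cut_closed[OF assms])
  moreover have "\<forall>x. x \<notin> \<nat> \<longrightarrow> cut \<nat> \<xi> x = 0" by (simp add: cut_def)
  ultimately show c: "cut \<nat> \<xi> \<in> carrier (ell2 \<nat>)" using ell2_iff_UNIV by blast
  show "hnorm (ell2 \<nat>) (cut \<nat> \<xi>) \<le> hnorm (ell2 UNIV) \<xi>"
    unfolding hnorm_ell2_UNIV[OF c] by (rule cut_closed[OF assms])
qed

lemma compress_bounded: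
  assumes A: "A \<in> bounded_ops (ell2 UNIV)"
  shows "compress A \<in> bounded_ops (ell2 \<nat>)"
proof (rule ell2.bounded_opsI[where C = "op_norm (ell2 UNIV) A"])
  note Ac = ell2.op_closed[OF A]
  show "compress A \<in> extensional (carrier (ell2 \<nat>))"
    unfolding compress_def by (rule restrict_extensional)
  fix \<xi> assume \<xi>: "\<xi> \<in> carrier (ell2 \<nat>)"
  show "compress A \<xi> \<in> carrier (ell2 \<nat>)"
    using cut_Nats(1)[OF Ac[OF ell2_in_l2[OF \<xi>]]] by (simp add: compress_apply \<xi>)
  show "hnorm (ell2 \<nat>) (compress A \<xi>) \<le> op_norm (ell2 UNIV) A * hnorm (ell2 \<nat>) \<xi>"
    using cut_Nats(2)[OF Ac[OF ell2_in_l2[OF \<xi>]]] ell2.op_norm_bound[OF A ell2_in_l2[OF \<xi>]]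
    by (simp add: compress_apply \<xi> hnorm_ell2_UNIV[OF \<xi>])
  show "compress A (vscale (ell2 \<nat>) c \<xi>) = vscale (ell2 \<nat>) c (compress A \<xi>)" for c
    using ell2.op_scale[OF A ell2_in_l2[OF \<xi>], of c] ell2_scale_closed[OF \<xi>, of c] \<xi>
    by (auto simp: compress_apply cut_def)
  fix \<eta> assume \<eta>: "\<eta> \<in> carrier (ell2 \<nat>)"
  show "compress A (vadd (ell2 \<nat>) \<xi> \<eta>) = vadd (ell2 \<nat>) (compress A \<xi>) (compress A \<eta>)"
    using ell2.op_add[OF A ell2_in_l2[OF \<xi>] ell2_in_l2[OF \<eta>]] ell2_add_closed[OF \<xi> \<eta>] \<xi> \<eta>
    by (auto simp: compress_apply cut_def)
qed

lemma op_dist_compress: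
  assumes A: "A \<in> bounded_ops (ell2 UNIV)" and B: "B \<in> bounded_ops (ell2 UNIV)"
  shows "op_dist (ell2 \<nat>) (compress A) (compress B) \<le> op_dist (ell2 UNIV) A B"
proof (rule ell2.op_dist_leI)
  fix \<xi> assume \<xi>: "\<xi> \<in> carrier (ell2 \<nat>)"
  note \<xi>' = ell2_in_l2[OF \<xi>]
  have "vdiff (ell2 \<nat>) (compress A \<xi>) (compress B \<xi>) = cut \<nat> (vdiff (ell2 UNIV) (A \<xi>) (B \<xi>))"
    using \<xi> by (auto simp: compress_apply cut_def)
  then have "hnorm (ell2 \<nat>) (vdiff (ell2 \<nat>) (compress A \<xi>) (compress B \<xi>)) \<le>
      hnorm (ell2 UNIV) (vdiff (ell2 UNIV) (A \<xi>) (B \<xi>))"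
    using cut_Nats(2)[OF ell2.vdiff_closed[OF ell2.op_closed[OF A \<xi>'] ell2.op_closed[OF B \<xi>']]]
    by (simp only:)
  also have "\<dots> \<le> op_dist (ell2 UNIV) A B * hnorm (ell2 \<nat>) \<xi>"
    unfolding hnorm_ell2_UNIV[OF \<xi>] by (rule ell2.op_dist_bound[OF A B \<xi>'])
  finally show "hnorm (ell2 \<nat>) (vdiff (ell2 \<nat>) (compress A \<xi>) (compress B \<xi>)) \<le>
      op_dist (ell2 UNIV) A B * hnorm (ell2 \<nat>) \<xi>" .
qed simp

abbreviation defect where
  "defect T A \<equiv> aadd AN T (ascale AN (-1) (compress A))"

lemma defect_compact:
  assumes G: "(T, A, f) \<in> trel"
  shows "defect T A \<in> fin_closure \<nat>"
proof -
  have T: "T \<in> bounded_ops (ell2 \<nat>)" and A: "A \<in> bounded_ops (ell2 UNIV)"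
    using trel_carrier[OF G] by auto
  obtain d where d: "d \<ge> 0" "agree_from T A d" using trel_agree[OF G] by blast
  have R: "defect T A \<in> bounded_ops (ell2 \<nat>)" by (intro ops_closed T compress_bounded A)
  show ?thesis
  proof (rule column_finite_in_fin_closure[OF R, of "{0..<d}"])
    fix \<xi> assume \<xi>: "\<xi> \<in> carrier (ell2 \<nat>)"
    \<comment> \<open>\<open>\<eta>\<close> is the part of \<open>\<xi>\<close> supported from
      \<open>d\<close> on. The defect annihilates it, so that only the columns in
      \<open>{0..<d}\<close> survive.\<close>
    define \<eta> where "\<eta> = vdiff (ell2 \<nat>) \<xi> (cut {0..<d} \<xi>)"
    have c: "cut {0..<d} \<xi> \<in> carrier (ell2 \<nat>)" by (rule cut_closed[OF \<xi>])
    have \<eta>: "\<eta> \<in> carrier (ell2 \<nat>)" unfolding \<eta>_def by (rule ell2.vdiff_closed[OF \<xi> c])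
    have "\<eta> x = 0" if "x < d" for x
      using that ell2_outside[OF \<xi>, of x] by (auto simp: \<eta>_def cut_def Nats_int_iff)
    from agree_fromD[OF d(2) ell2_in_l2[OF \<eta>] this] have TA: "T \<eta> = A \<eta>" by simp
    have "cut \<nat> (T \<eta>) = T \<eta>"
      using ell2_outside[OF ell2.op_closed[OF T \<eta>]] by (auto simp: cut_def)
    then have "defect T A \<eta> = vzero (ell2 \<nat>)"
      unfolding op_diff_apply[OF \<eta>] compress_apply[OF \<eta>] TA[symmetric] by simp
    then have "vdiff (ell2 \<nat>) (defect T A \<xi>) (defect T A (cut {0..<d} \<xi>)) = vzero (ell2 \<nat>)"
      unfolding \<eta>_def ell2.op_vdiff[OF R \<xi> c] .
    then show "defect T A \<xi> = defect T A (cut {0..<d} \<xi>)"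
      using ell2.vdiff_eq_zero_iff[OF ell2.op_closed[OF R \<xi>] ell2.op_closed[OF R c]] by blast
  qed simp
qed

text \<open>\<open>compress A\<close> is \<open>T\<close> minus the defect, and the defect, being a
  limit of finite matrices, is related to zero.\<close>

lemma compress_Gbar_trel:
  assumes G: "(T, A, f) \<in> trel"
  shows "(compress A, A) \<in> TA.Gbar"
proof -
  have T: "T \<in> bounded_ops (ell2 \<nat>)" and A: "A \<in> bounded_ops (ell2 UNIV)"
    using trel_carrier[OF G] by auto
  have "(T, A) \<in> TA.Gbar" using G TA.G_subset_Gbar by (auto simp: relTA_def)
  from TA.Gbar_add[OF this TA.Gbar_scale[OF fin_closure_Gbar[OF defect_compact[OF G]]], of "-1"]
  have "(aadd AN T (ascale AN (-1) (defect T A)), aadd AZ A (ascale AZ (-1) (azero AZ))) \<in> TA.Gbar" .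
  moreover have "aadd AN T (ascale AN (-1) (defect T A)) = compress A"
  proof (rule ell2.op_eqI[where X = "\<nat>"])
    show "aadd AN T (ascale AN (-1) (defect T A)) \<xi> = compress A \<xi>" if "\<xi> \<in> carrier (ell2 \<nat>)" for \<xi>
      using that by (simp only: op_apply) simp
  qed (intro ops_closed T compress_bounded A)+
  moreover have "aadd AZ A (ascale AZ (-1) (azero AZ)) = A"
  proof (rule ell2.op_eqI[where X = UNIV])
    show "aadd AZ A (ascale AZ (-1) (azero AZ)) \<xi> = A \<xi>" if "\<xi> \<in> l2" for \<xi>
      using that by (simp only: op_apply) simp
  qed (intro ops_closed A)+
  ultimately show ?thesis by (simp only:)
qed

text \<open>Compression is contractive, so the identity passes from the dense algebra to its
  closure. It exhibits a preimage of every \<open>A\<close>, from which surjectivity of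
  \<open>phi\<close> is read off.\<close>

lemma compress_lift:
  assumes "A \<in> PTZ"
  shows "compress A \<in> PTN" "TA.lift (compress A) = A"
proof -
  have sub: "fst ` relAf \<subseteq> bounded_ops (ell2 UNIV)" using Af.subset by auto
  obtain s where s: "range s \<subseteq> fst ` relAf" "ell2.ops.converges UNIV s A"
    using assms ell2.ops.closure_of_iff_converges[OF sub] by blast
  note sB = ell2.ops.convergesD(1)[OF s(2)] and AB = ell2.ops.convergesD(2)[OF s(2)]
  have g: "(compress (s n), s n) \<in> TA.Gbar" for n
  proof -
    have "s n \<in> fst ` relAf" using s(1) by auto
    then obtain T f where "(T, s n, f) \<in> trel" by (auto simp: relAf_def)
    then show ?thesis by (rule compress_Gbar_trel)
  qed
  have l: "TA.lift (compress (s n)) = s n" and D: "compress (s n) \<in> PTN" for n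
    by (rule TA.lift_eq[OF g], rule TA.Gbar_in_Dom[OF g])
  have c: "ell2.ops.converges \<nat> (\<lambda>n. compress (s n)) (compress A)"
    by (rule ell2.ops.converges_le[OF compress_bounded[OF sB] compress_bounded[OF AB]
          op_dist_compress[OF sB AB] ell2.ops.convergesD(3)[OF s(2)]])
  have r: "range (\<lambda>n. compress (s n)) \<subseteq> PTN" using D by blast
  show "compress A \<in> PTN" by (rule TA.lift_converges(1)[OF r c])
  have "ell2.ops.converges UNIV s (TA.lift (compress A))"
    using TA.lift_converges(2)[OF r c] by (simp only: l)
  then show "TA.lift (compress A) = A" using s(2) by (rule ell2.ops.converges_unique)
qed

lemma phi_surj: "phi ` carrier (partial_translation_algebra \<nat>) = carrier (partial_translation_algebra UNIV)"
proof
  show "phi ` carrier (partial_translation_algebra \<nat>) \<subseteq> carrier (partial_translation_algebra UNIV)"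
    using phi_star_hom by (auto simp: star_hom_def)
  show "carrier (partial_translation_algebra UNIV) \<subseteq> phi ` carrier (partial_translation_algebra \<nat>)"
  proof
    fix A assume "A \<in> carrier (partial_translation_algebra UNIV)"
    then have "A \<in> PTZ" by (simp add: partial_translation_algebra_UNIV)
    from compress_lift[OF this] show "A \<in> phi ` carrier (partial_translation_algebra \<nat>)"
      by (simp add: phi_def partial_translation_algebra_Nats image_iff) metis
  qed
qed

text \<open>If \<open>s n\<close> tends to \<open>T\<close> while its image \<open>t n\<close> tends
  to zero, the compressions of \<open>t n\<close> tend to zero as well. Hence \<open>T\<close> is
  the limit of the defects, which are compact.\<close>

lemma phi_kernel:
  "star_kernel (partial_translation_algebra \<nat>) (partial_translation_algebra UNIV) phi = compact_ops (ell2 \<nat>)"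
proof -
  have "star_kernel (partial_translation_algebra \<nat>) (partial_translation_algebra UNIV) phi =
      {T \<in> PTN. TA.lift T = azero AZ}"
    unfolding star_kernel_def partial_translation_algebra_Nats partial_translation_algebra_UNIV phi_def
    by (simp del: ell2.op_algebra_simps)
  also have "\<dots> = fin_closure \<nat>"
  proof (intro equalityI subsetI)
    fix K assume "K \<in> fin_closure \<nat>"
    then have "(K, azero AZ) \<in> TA.Gbar" by (rule fin_closure_Gbar)
    then show "K \<in> {T \<in> PTN. TA.lift T = azero AZ}" using TA.lift_eq TA.Gbar_in_Dom by blast
  next
    fix T assume "T \<in> {T \<in> PTN. TA.lift T = azero AZ}"
    then have "(T, azero AZ) \<in> TA.Gbar" using TA.lift_Gbar[of T] by auto
    from TA.GbarD[OF this] obtain s t where st: "\<forall>n. (s n, t n) \<in> relTA"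
      "ell2.ops.converges \<nat> s T" "ell2.ops.converges UNIV t (azero AZ)" by blast
    note sB = ell2.ops.convergesD(1)[OF st(2)] and TB = ell2.ops.convergesD(2)[OF st(2)]
      and tB = ell2.ops.convergesD(1)[OF st(3)]
    have K: "defect (s n) (t n) \<in> fin_closure \<nat>" for n
      using st(1) defect_compact unfolding relTA_def by blast
    have le: "op_dist (ell2 \<nat>) T (defect (s n) (t n)) \<le>
        op_dist (ell2 \<nat>) (s n) T + op_dist (ell2 UNIV) (t n) (azero AZ)" for n
    proof -
      have "op_dist (ell2 \<nat>) T (defect (s n) (t n)) \<le>
          op_dist (ell2 \<nat>) T (s n) + op_dist (ell2 \<nat>) (s n) (defect (s n) (t n))"
        by (rule ell2.opmetric.triangle[OF TB sB fin_closureD(1)[OF K]])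
      also have "op_dist (ell2 \<nat>) (s n) (defect (s n) (t n)) \<le> op_dist (ell2 UNIV) (t n) (azero AZ)"
      proof (rule ell2.op_dist_leI)
        fix \<xi> assume \<xi>: "\<xi> \<in> carrier (ell2 \<nat>)"
        have "vdiff (ell2 \<nat>) (s n \<xi>) (defect (s n) (t n) \<xi>) = cut \<nat> (t n \<xi>)"
          unfolding op_diff_apply[OF \<xi>] compress_apply[OF \<xi>] by simp
        then have "hnorm (ell2 \<nat>) (vdiff (ell2 \<nat>) (s n \<xi>) (defect (s n) (t n) \<xi>)) \<le> hnorm (ell2 UNIV) (t n \<xi>)"
          using cut_Nats(2)[OF ell2.op_closed[OF tB ell2_in_l2[OF \<xi>]]] by (simp only:)
        also have "\<dots> \<le> op_dist (ell2 UNIV) (t n) (azero AZ) * hnorm (ell2 \<nat>) \<xi>"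
          unfolding hnorm_ell2_UNIV[OF \<xi>] ell2.op_algebra_simps
          by (rule ell2.op_dist_zero_bound[OF tB ell2_in_l2[OF \<xi>]])
        finally show "hnorm (ell2 \<nat>) (vdiff (ell2 \<nat>) (s n \<xi>) (defect (s n) (t n) \<xi>)) \<le>
            op_dist (ell2 UNIV) (t n) (azero AZ) * hnorm (ell2 \<nat>) \<xi>" .
      qed simp
      finally show ?thesis by (simp only: ell2.opmetric.commute)
    qed
    show "T \<in> fin_closure \<nat>"
    proof (rule fin_closure_closed[OF TB])
      fix e :: real assume "e > 0"
      moreover have "(\<lambda>n. op_dist (ell2 \<nat>) (s n) T + op_dist (ell2 UNIV) (t n) (azero AZ)) \<longlonglongrightarrow> 0"
        using tendsto_add[OF ell2.ops.convergesD(3)[OF st(2)] ell2.ops.convergesD(3)[OF st(3)]] by simp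
      ultimately have "\<forall>\<^sub>F n in sequentially. op_dist (ell2 \<nat>) (s n) T + op_dist (ell2 UNIV) (t n) (azero AZ) < e"
        by (rule order_tendstoD(2)[rotated])
      then obtain n where "op_dist (ell2 \<nat>) (s n) T + op_dist (ell2 UNIV) (t n) (azero AZ) < e"
        unfolding eventually_sequentially by blast
      then have "op_dist (ell2 \<nat>) T (defect (s n) (t n)) \<le> e" using le[of n] by linarith
      then show "\<exists>S\<in>fin_closure \<nat>. op_dist (ell2 \<nat>) T S \<le> e" using K by blast
    qed
  qed
  finally show ?thesis by (simp only: compact_ops_ell2)
qed

lemma phi_extension:
  "star_extension (compact_algebra (ell2 \<nat>)) (\<lambda>k. k) (partial_translation_algebra \<nat>)
     phi (partial_translation_algebra UNIV)"
proof -
  have "compact_ops (ell2 \<nat>) \<subseteq> carrier (partial_translation_algebra \<nat>)"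
    using phi_kernel by (auto simp: star_kernel_def)
  then have "(\<lambda>k. k) \<in> star_hom (compact_algebra (ell2 \<nat>)) (partial_translation_algebra \<nat>)"
    by (auto simp: star_hom_def compact_algebra_def partial_translation_algebra_Nats
        simp del: ell2.op_algebra_simps)
  moreover have "carrier (compact_algebra (ell2 \<nat>)) = compact_ops (ell2 \<nat>)"
    by (simp add: compact_algebra_def)
  ultimately show ?thesis
    unfolding star_extension_def using phi_star_hom phi_surj phi_kernel by simp
qed

section \<open>The symbol isomorphism\<close>

definition symbols where "symbols = {f. \<exists>T A. (T, A, f) \<in> trel}"

lemma symbols_carrier: "symbols \<subseteq> carrier CC"
  using trel_carrier by (auto simp: symbols_def)

lemma symbols_ops:
  "f \<in> symbols \<Longrightarrow> g \<in> symbols \<Longrightarrow> (\<lambda>z\<in>unit_circle. f z + g z) \<in> symbols"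
  "f \<in> symbols \<Longrightarrow> g \<in> symbols \<Longrightarrow> (\<lambda>z\<in>unit_circle. f z * g z) \<in> symbols"
  "f \<in> symbols \<Longrightarrow> (\<lambda>z\<in>unit_circle. c * f z) \<in> symbols"
  "monomial n \<in> symbols"
proof -
  show "f \<in> symbols \<Longrightarrow> g \<in> symbols \<Longrightarrow> (\<lambda>z\<in>unit_circle. f z + g z) \<in> symbols"
    unfolding symbols_def CC_simps(2)[symmetric] using trel.add by blast
  show "f \<in> symbols \<Longrightarrow> g \<in> symbols \<Longrightarrow> (\<lambda>z\<in>unit_circle. f z * g z) \<in> symbols"
    unfolding symbols_def CC_simps(4)[symmetric] using trel.mult by blast
  show "f \<in> symbols \<Longrightarrow> (\<lambda>z\<in>unit_circle. c * f z) \<in> symbols"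
    unfolding symbols_def CC_simps(3)[symmetric] using trel.scale by blast
  show "monomial n \<in> symbols" using trel.gen by (auto simp only: symbols_def)
qed

text \<open>On the circle \<open>Re z = (z + z\<^sup>-\<^sup>1) / 2\<close> and \<open>Im z = (z - z\<^sup>-\<^sup>1) / 2\<i>\<close>.\<close>

lemma real_polynomial_symbols:
  "real_polynomial_function p \<Longrightarrow> (\<lambda>z\<in>unit_circle. complex_of_real (p z)) \<in> symbols"
proof (induction rule: real_polynomial_function.induct)
  case (linear h)
  define a b where "a = complex_of_real (h 1)" and "b = complex_of_real (h \<i>)"
  have hz: "h z = Re z * h 1 + Im z * h \<i>" for z
  proof -
    have "z = Re z *\<^sub>R 1 + Im z *\<^sub>R \<i>" by (simp add: complex_eq_iff)
    then have "h z = h (Re z *\<^sub>R 1 + Im z *\<^sub>R \<i>)" by simp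
    also have "\<dots> = Re z * h 1 + Im z * h \<i>"
      unfolding linear_add[OF bounded_linear.linear[OF linear]]
        linear_cmul[OF bounded_linear.linear[OF linear]] by simp
    finally show ?thesis .
  qed
  have h: "complex_of_real (h z) = of_real (Re z) * a + of_real (Im z) * b" for z
    unfolding a_def b_def hz[of z] by simp
  have eq: "complex_of_real (h z) = (a / 2 - \<i> * b / 2) * monomial 1 z + (a / 2 + \<i> * b / 2) * monomial (- 1) z"
    if z: "z \<in> unit_circle" for z
  proof -
    have m: "monomial 1 z = z" "monomial (-1) z = cnj z" using cnj_powi_circle[OF z, of 1] z by simp_all
    have re: "complex_of_real (Re z) = (z + cnj z) / 2"
      and im: "complex_of_real (Im z) = - \<i> * (z - cnj z) / 2" by (simp_all add: complex_eq_iff)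
    show ?thesis unfolding h m re im by (simp add: field_simps)
  qed
  let ?u = "\<lambda>z\<in>unit_circle. (a / 2 - \<i> * b / 2) * monomial 1 z"
  let ?v = "\<lambda>z\<in>unit_circle. (a / 2 + \<i> * b / 2) * monomial (- 1) z"
  have "(\<lambda>z\<in>unit_circle. ?u z + ?v z) \<in> symbols"
    by (intro symbols_ops)
  moreover have "(\<lambda>z\<in>unit_circle. ?u z + ?v z) = (\<lambda>z\<in>unit_circle. complex_of_real (h z))"
    by (rule restrict_ext) (simp only: restrict_apply if_True eq)
  ultimately show ?case by (simp only:)
next
  case (const c)
  have "(\<lambda>z\<in>unit_circle. of_real c * monomial 0 z) \<in> symbols" by (intro symbols_ops)
  moreover have "(\<lambda>z\<in>unit_circle. complex_of_real c * monomial 0 z) = (\<lambda>z\<in>unit_circle. complex_of_real c)"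
    by (rule restrict_ext) simp
  ultimately show ?case by (simp only:)
next
  case (add f g)
  let ?f = "\<lambda>z\<in>unit_circle. complex_of_real (f z)" and ?g = "\<lambda>z\<in>unit_circle. complex_of_real (g z)"
  have "(\<lambda>z\<in>unit_circle. ?f z + ?g z) \<in> symbols" by (intro symbols_ops add.IH)
  moreover have "(\<lambda>z\<in>unit_circle. ?f z + ?g z) = (\<lambda>z\<in>unit_circle. complex_of_real (f z + g z))"
    by (rule restrict_ext) simp
  ultimately show ?case by (simp only:)
next
  case (mult f g)
  let ?f = "\<lambda>z\<in>unit_circle. complex_of_real (f z)" and ?g = "\<lambda>z\<in>unit_circle. complex_of_real (g z)"
  have "(\<lambda>z\<in>unit_circle. ?f z * ?g z) \<in> symbols" by (intro symbols_ops mult.IH)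
  moreover have "(\<lambda>z\<in>unit_circle. ?f z * ?g z) = (\<lambda>z\<in>unit_circle. complex_of_real (f z * g z))"
    by (rule restrict_ext) simp
  ultimately show ?case by (simp only:)
qed

text \<open>On the complex plane \<open>polynomial_function\<close> means polynomial in the real and
  imaginary parts of \<open>z\<close>, so conjugates are included. The approximant is split into its
  real and imaginary components to reach \<open>real_polynomial_symbols\<close>.\<close>

lemma symbols_dense: "CC.mtopology closure_of symbols = carrier CC"
proof
  show "CC.mtopology closure_of symbols \<subseteq> carrier CC"
    using closure_of_subset_topspace[of CC.mtopology] by simp
  show "carrier CC \<subseteq> CC.mtopology closure_of symbols"
  proof
    fix f assume f: "f \<in> carrier CC"
    have "\<exists>g\<in>symbols. g \<in> CC.mcball f e" if e: "e > 0" for e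
    proof -
      obtain p :: "complex \<Rightarrow> complex" where p: "polynomial_function p"
        "\<And>z. z \<in> unit_circle \<Longrightarrow> norm (f z - p z) < e"
        using Stone_Weierstrass_polynomial_function[OF _ CC_continuous[OF f] e] by auto
      have re: "real_polynomial_function (\<lambda>z. Re (p z))" "real_polynomial_function (\<lambda>z. Im (p z))"
        using p(1) bounded_linear_Re bounded_linear_Im
        unfolding polynomial_function_def o_def by blast+
      define g where "g = (\<lambda>z\<in>unit_circle. (\<lambda>z\<in>unit_circle. complex_of_real (Re (p z))) z +
          (\<lambda>z\<in>unit_circle. \<i> * (\<lambda>z\<in>unit_circle. complex_of_real (Im (p z))) z) z)"
      have g: "g \<in> symbols"
        unfolding g_def by (intro symbols_ops real_polynomial_symbols re)
      have "g z = p z" if "z \<in> unit_circle" for z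
        using that by (simp add: g_def complex_eq_iff)
      then have "cdist f g \<le> e"
        using p(2) e by (intro cdist_leI) (auto simp: less_imp_le)
      then show ?thesis using g f symbols_carrier by auto
    qed
    then show "f \<in> CC.mtopology closure_of symbols"
      unfolding CC.metric_closure_of_alt using f by auto
  qed
qed

lemma Gbar_converse: "(A, f) \<in> Af.Gbar \<longleftrightarrow> (f, A) \<in> fA.Gbar"
proof -
  have "(A, f) \<in> relAf \<longleftrightarrow> (f, A) \<in> relfA" for A f by (simp add: relAf_def relfA_def)
  then show ?thesis unfolding Af.Gbar_def fA.Gbar_def by auto
qed

text \<open>The inverse is the extension of the converse relation: its uniqueness gives injectivity,
  its totality on the closure of the symbols gives surjectivity.\<close>

lemma gamma_star_iso: "gamma \<in> star_iso (partial_translation_algebra UNIV) CC"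
proof -
  have "CC.mtopology closure_of (snd ` relAf) \<subseteq> carrier CC"
    using closure_of_subset_topspace[of CC.mtopology] by simp
  then have hom: "gamma \<in> star_hom (partial_translation_algebra UNIV) CC"
    unfolding gamma_def by (rule Af.lift_star_hom[OF partial_translation_algebra_UNIV, rotated]) simp
  have "inj_on gamma PTZ"
  proof (rule inj_onI)
    fix A B assume "A \<in> PTZ" "B \<in> PTZ" "gamma A = gamma B"
    then have "(gamma A, A) \<in> fA.Gbar" "(gamma A, B) \<in> fA.Gbar"
      using Af.lift_Gbar Gbar_converse unfolding gamma_def by metis+
    then show "A = B" by (rule fA.Gbar_unique)
  qed
  moreover have "carrier CC \<subseteq> gamma ` PTZ"
  proof
    fix f assume "f \<in> carrier CC"
    moreover have "fst ` relfA = symbols" by (force simp: relfA_def symbols_def)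
    ultimately have "f \<in> CC.mtopology closure_of (fst ` relfA)" by (simp add: symbols_dense)
    then obtain A where "(f, A) \<in> fA.Gbar" by (rule fA.Gbar_total)
    then have "(A, f) \<in> Af.Gbar" by (simp add: Gbar_converse)
    then have "gamma A = f" "A \<in> PTZ" unfolding gamma_def by (rule Af.lift_eq, rule Af.Gbar_in_Dom)
    then show "f \<in> gamma ` PTZ" by blast
  qed
  moreover have "gamma ` PTZ \<subseteq> carrier CC"
    using hom by (auto simp: star_hom_def partial_translation_algebra_UNIV)
  ultimately show ?thesis
    using hom by (auto simp: star_iso_def bij_betw_def partial_translation_algebra_UNIV)
qed

lemma gamma_translation: "gamma (translation_op UNIV n) = monomial n"
  unfolding gamma_def
  by (rule Af.lift_eq, rule subsetD[OF Af.G_subset_Gbar]) (use trel.gen in \<open>auto simp only: relAf_def\<close>)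

section \<open>Transport along unitaries\<close>

lemma isometry_homeomorphic_map:
  assumes M: "Metric_space M d" and M': "Metric_space M' d'" and g: "bij_betw g M M'"
    and iso: "\<And>x y. \<lbrakk>x \<in> M; y \<in> M\<rbrakk> \<Longrightarrow> d' (g x) (g y) = d x y"
  shows "homeomorphic_map (Metric_space.mtopology M d) (Metric_space.mtopology M' d') g"
proof -
  interpret M: Metric_space M d by fact
  interpret M': Metric_space M' d' by fact
  define h where "h = inv_into M g"
  have h: "h y \<in> M" "g (h y) = y" if "y \<in> M'" for y
    using that g by (auto simp: h_def bij_betw_def inv_into_into f_inv_into_f)
  have hg: "h (g x) = x" if "x \<in> M" for x
    using that g by (simp add: h_def bij_betw_def)
  have gM: "g x \<in> M'" if "x \<in> M" for x using that g by (auto simp: bij_betw_def)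
  have iso': "d (h x) (h y) = d' x y" if "x \<in> M'" "y \<in> M'" for x y
    using iso[OF h(1)[OF that(1)] h(1)[OF that(2)]] h(2) that by simp
  have "continuous_map M.mtopology M'.mtopology g"
    unfolding M.metric_continuous_map[OF M'] using gM iso by (metis image_subsetI)
  moreover have "continuous_map M'.mtopology M.mtopology h"
    unfolding M'.metric_continuous_map[OF M] using h(1) iso' by (metis image_subsetI)
  ultimately have "homeomorphic_maps M.mtopology M'.mtopology g h"
    unfolding homeomorphic_maps_def using h(2) hg by simp
  then show ?thesis by (rule homeomorphic_maps_imp_map)
qed

locale unitary = H: prehilbert H + K: prehilbert K
  for H :: "'v hilbert" and K :: "'w hilbert" +
  fixes U :: "'v \<Rightarrow> 'w"
  assumes bij: "bij_betw U (carrier H) (carrier K)"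
    and U_add: "\<lbrakk>x \<in> carrier H; y \<in> carrier H\<rbrakk> \<Longrightarrow> U (vadd H x y) = vadd K (U x) (U y)"
    and U_scale: "x \<in> carrier H \<Longrightarrow> U (vscale H c x) = vscale K c (U x)"
    and U_cinner: "\<lbrakk>x \<in> carrier H; y \<in> carrier H\<rbrakk> \<Longrightarrow> cinner K (U x) (U y) = cinner H x y"
begin

definition V :: "'w \<Rightarrow> 'v" where "V = inv_into (carrier H) U"

lemma U_closed [simp]: "x \<in> carrier H \<Longrightarrow> U x \<in> carrier K"
  using bij by (auto simp: bij_betw_def)

lemma V_closed [simp]: "y \<in> carrier K \<Longrightarrow> V y \<in> carrier H"
  using bij by (auto simp: V_def bij_betw_def inv_into_into)

lemma UV [simp]: "y \<in> carrier K \<Longrightarrow> U (V y) = y"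
  using bij by (auto simp: V_def bij_betw_def f_inv_into_f)

lemma VU [simp]: "x \<in> carrier H \<Longrightarrow> V (U x) = x"
  using bij by (auto simp: V_def bij_betw_def)

lemma hnorm_U: "x \<in> carrier H \<Longrightarrow> hnorm K (U x) = hnorm H x"
  by (simp add: hnorm_def U_cinner)

lemma U_vdiff: "\<lbrakk>x \<in> carrier H; y \<in> carrier H\<rbrakk> \<Longrightarrow> U (vdiff H x y) = vdiff K (U x) (U y)"
  by (simp add: vdiff_def U_add U_scale)

lemma U_zero: "U (vzero H) = vzero K"
  using U_vdiff[of "vzero H" "vzero H"] by simp

lemma unitary_V: "unitary K H V"
proof
  show "bij_betw V (carrier K) (carrier H)"
    unfolding V_def by (rule bij_betw_inv_into[OF bij])
  show "V (vadd K x y) = vadd H (V x) (V y)" if "x \<in> carrier K" "y \<in> carrier K" for x y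
    using that U_add[of "V x" "V y"] VU[of "vadd H (V x) (V y)"] by simp
  show "V (vscale K c x) = vscale H c (V x)" if "x \<in> carrier K" for c x
    using that U_scale[of "V x" c] VU[of "vscale H c (V x)"] by simp
  show "cinner H (V x) (V y) = cinner K x y" if "x \<in> carrier K" "y \<in> carrier K" for x y
    using that U_cinner[of "V x" "V y"] by simp
qed

definition Ad :: "('v \<Rightarrow> 'v) \<Rightarrow> 'w \<Rightarrow> 'w" where
  "Ad T = (\<lambda>y\<in>carrier K. U (T (V y)))"

lemma Ad_apply: "y \<in> carrier K \<Longrightarrow> Ad T y = U (T (V y))"
  by (simp add: Ad_def)

lemma Ad_U: "x \<in> carrier H \<Longrightarrow> Ad T (U x) = U (T x)"
  by (simp add: Ad_def)

lemma Ad_closed: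
  assumes T: "T \<in> bounded_ops H"
  shows "Ad T \<in> bounded_ops K"
proof (rule K.bounded_opsI[where C = "op_norm H T"])
  note [simp] = H.op_closed[OF T]
  interpret V: unitary K H V by (rule unitary_V)
  show "Ad T \<in> extensional (carrier K)" unfolding Ad_def by (rule restrict_extensional)
  fix x assume x: "x \<in> carrier K"
  show "Ad T x \<in> carrier K" using x by (simp add: Ad_apply)
  show "hnorm K (Ad T x) \<le> op_norm H T * hnorm K x"
    using H.op_norm_bound[OF T, of "V x"] x by (simp add: Ad_apply hnorm_U V.hnorm_U)
  show "Ad T (vscale K c x) = vscale K c (Ad T x)" for c
    using x by (simp add: Ad_apply V.U_scale H.op_scale[OF T] U_scale)
  show "Ad T (vadd K x y) = vadd K (Ad T x) (Ad T y)" if "y \<in> carrier K" for y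
    using x that by (simp add: Ad_apply V.U_add H.op_add[OF T] U_add)
qed

end

lemma (in unitary) Ad_inverse:
  assumes T: "T \<in> bounded_ops H"
  shows "unitary.Ad K H V (Ad T) = T"
proof -
  interpret V: unitary K H V by (rule unitary_V)
  \<comment> \<open>\<open>V\<close> and \<open>V.V\<close> are both inverses by choice, so
    \<open>V.V\<close> and \<open>U\<close> can be compared only on the carrier.\<close>
  have VV: "V.V x = U x" if "x \<in> carrier H" for x
    using that V.UV[of x] UV[of "V.V x"] V.V_closed[of x] by simp
  show ?thesis
  proof (rule H.op_eqI[OF V.Ad_closed[OF Ad_closed[OF T]] T])
    fix x assume "x \<in> carrier H"
    then show "V.Ad (Ad T) x = T x"
      using H.op_closed[OF T] by (simp add: V.Ad_apply VV Ad_U)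
  qed
qed

context unitary
begin

lemma Ad_bij: "bij_betw Ad (bounded_ops H) (bounded_ops K)"
proof -
  interpret V: unitary K H V by (rule unitary_V)
  have VV: "V.V x = U x" if "x \<in> carrier H" for x
    using that V.UV[of x] UV[of "V.V x"] V.V_closed[of x] by simp
  have "Ad (V.Ad S) = S" if S: "S \<in> bounded_ops K" for S
  proof (rule K.op_eqI[OF Ad_closed[OF V.Ad_closed[OF S]] S])
    fix y assume "y \<in> carrier K"
    then show "Ad (V.Ad S) y = S y"
      using K.op_closed[OF S] by (simp add: V.Ad_apply VV Ad_apply)
  qed
  then show ?thesis
    by (intro bij_betw_byWitness[where f' = V.Ad]) (auto simp: Ad_inverse Ad_closed V.Ad_closed)
qed

lemma Ad_add:
  "\<lbrakk>S \<in> bounded_ops H; T \<in> bounded_ops H\<rbrakk>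
    \<Longrightarrow> Ad (aadd (op_algebra H) S T) = aadd (op_algebra K) (Ad S) (Ad T)"
  by (auto simp: op_algebra_def Ad_def fun_eq_iff U_add H.op_closed)

lemma Ad_scale:
  "T \<in> bounded_ops H \<Longrightarrow> Ad (ascale (op_algebra H) c T) = ascale (op_algebra K) c (Ad T)"
  by (auto simp: op_algebra_def Ad_def fun_eq_iff U_scale H.op_closed)

lemma Ad_zero: "Ad (azero (op_algebra H)) = azero (op_algebra K)"
  by (auto simp: op_algebra_def Ad_def fun_eq_iff U_zero)

lemma Ad_mult:
  "\<lbrakk>S \<in> bounded_ops H; T \<in> bounded_ops H\<rbrakk>
    \<Longrightarrow> Ad (amult (op_algebra H) S T) = amult (op_algebra K) (Ad S) (Ad T)"
  by (auto simp: op_algebra_def Ad_def fun_eq_iff compose_def H.op_closed)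

lemma Ad_dist_le:
  assumes S: "S \<in> bounded_ops H" and T: "T \<in> bounded_ops H"
  shows "op_dist K (Ad S) (Ad T) \<le> op_dist H S T"
proof (rule K.op_dist_leI)
  interpret V: unitary K H V by (rule unitary_V)
  fix y assume y: "y \<in> carrier K"
  then show "hnorm K (vdiff K (Ad S y) (Ad T y)) \<le> op_dist H S T * hnorm K y"
    using H.op_dist_bound[OF S T, of "V y"] H.op_closed[OF S] H.op_closed[OF T]
    by (simp add: Ad_apply V.hnorm_U hnorm_U flip: U_vdiff)
qed simp

lemma Ad_dist:
  assumes S: "S \<in> bounded_ops H" and T: "T \<in> bounded_ops H"
  shows "op_dist K (Ad S) (Ad T) = op_dist H S T"
proof -
  interpret V: unitary K H V by (rule unitary_V)
  show ?thesis
    using Ad_dist_le[OF S T] V.Ad_dist_le[OF Ad_closed[OF S] Ad_closed[OF T]]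
    by (simp add: Ad_inverse S T)
qed

lemma homeomorphic_U: "homeomorphic_map (htopology H) (htopology K) U"
  by (rule isometry_homeomorphic_map[OF H.hmetric.Metric_space_axioms K.hmetric.Metric_space_axioms bij])
    (simp add: hnorm_U flip: U_vdiff)

lemma homeomorphic_Ad: "homeomorphic_map (op_topology H) (op_topology K) Ad"
  by (rule isometry_homeomorphic_map[OF H.opmetric.Metric_space_axioms K.opmetric.Metric_space_axioms Ad_bij])
    (rule Ad_dist)

text \<open>\<open>U\<close> is a homeomorphism and maps the unit ball onto the unit ball, so the
  closures of the two images correspond.\<close>

lemma Ad_compact_iff:
  assumes T: "T \<in> bounded_ops H"
  shows "Ad T \<in> compact_ops K \<longleftrightarrow> T \<in> compact_ops H"
proof -
  interpret V: unitary K H V by (rule unitary_V)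
  let ?B = "{x \<in> carrier H. hnorm H x \<le> 1}"
  have ball: "{y \<in> carrier K. hnorm K y \<le> 1} = U ` ?B"
  proof safe
    fix y assume y: "y \<in> carrier K" "hnorm K y \<le> 1"
    then have "V y \<in> ?B" by (simp add: V.hnorm_U)
    then show "y \<in> U ` ?B" using UV[OF y(1)] by (metis image_eqI)
  qed (simp_all add: hnorm_U)
  have sub: "T ` ?B \<subseteq> topspace (htopology H)" using H.op_closed[OF T] by auto
  have "Ad T ` U ` ?B = U ` T ` ?B"
    unfolding image_image by (rule image_cong) (simp_all add: Ad_U)
  then have "htopology K closure_of (Ad T ` U ` ?B) = U ` (htopology H closure_of (T ` ?B))"
    using homeomorphic_map_closure_of[OF homeomorphic_U sub] by simp
  moreover have "compactin (htopology K) (U ` (htopology H closure_of (T ` ?B))) \<longleftrightarrow>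
      compactin (htopology H) (htopology H closure_of (T ` ?B))"
    by (rule homeomorphic_map_compactness[OF homeomorphic_U closure_of_subset_topspace])
  ultimately show ?thesis
    using T Ad_closed[OF T] by (simp add: compact_ops_def ball)
qed

lemma Ad_surj: "S \<in> bounded_ops K \<Longrightarrow> \<exists>T\<in>bounded_ops H. S = Ad T"
  using Ad_bij by (auto simp: bij_betw_def)

lemma Ad_compact_ops: "Ad ` compact_ops H = compact_ops K"
proof (intro equalityI subsetI)
  fix S assume "S \<in> Ad ` compact_ops H"
  then obtain T where T: "T \<in> compact_ops H" "S = Ad T" by blast
  then have "T \<in> bounded_ops H" by (simp add: compact_ops_def)
  then show "S \<in> compact_ops K" using Ad_compact_iff T by simp
next
  fix S assume S: "S \<in> compact_ops K"
  then have "S \<in> bounded_ops K" by (simp add: compact_ops_def)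
  then obtain T where T: "T \<in> bounded_ops H" "S = Ad T" using Ad_surj by blast
  then show "S \<in> Ad ` compact_ops H" using Ad_compact_iff[OF T(1)] S by simp
qed

lemma closedin_Ad_iff:
  "B \<subseteq> bounded_ops H \<Longrightarrow> closedin (op_topology K) (Ad ` B) \<longleftrightarrow> closedin (op_topology H) B"
  using homeomorphic_map_closedness[OF homeomorphic_Ad, of B] by simp

end

text \<open>Adjoints on \<open>K\<close> are obtained by conjugating those on \<open>H\<close>, so
  completeness is asked of \<open>H\<close> only.\<close>

locale unitary_hilbert = unitary H K U + H: hilbert H
  for H :: "'v hilbert" and K :: "'w hilbert" and U
begin

lemma Ad_star:
  assumes T: "T \<in> bounded_ops H"
  shows "Ad (astar (op_algebra H) T) = astar (op_algebra K) (Ad T)"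
proof -
  have "adjoint_op K (Ad T) = Ad (adjoint_op H T)"
  proof (rule K.adjoint_eqI[OF Ad_closed[OF H.adjoint_closed[OF T]]])
    fix x y assume xy: "x \<in> carrier K" "y \<in> carrier K"
    have "cinner K (U (T (V x))) (U (V y)) = cinner K (U (V x)) (U (adjoint_op H T (V y)))"
      using xy H.op_closed[OF T] H.op_closed[OF H.adjoint_closed[OF T]] H.cinner_adjoint[OF T]
      by (simp only: U_cinner V_closed)
    then show "cinner K (Ad T x) y = cinner K x (Ad (adjoint_op H T) y)"
      using xy by (simp add: Ad_apply)
  qed
  then show ?thesis by (simp add: op_algebra_def)
qed

lemma star_subalgebra_Ad:
  assumes B: "B \<subseteq> bounded_ops H"
  shows "star_subalgebra (op_algebra K) (Ad ` B) \<longleftrightarrow> star_subalgebra (op_algebra H) B"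
proof -
  have inj: "Ad S \<in> Ad ` B \<longleftrightarrow> S \<in> B" if "S \<in> bounded_ops H" for S
    using Ad_bij B that inj_on_image_mem_iff[of Ad "bounded_ops H" S B] by (auto simp: bij_betw_def)
  have c: "S \<in> bounded_ops H" if "S \<in> B" for S using that B by blast
  have K: "carrier (op_algebra K) = bounded_ops K" by (simp add: op_algebra_def)
  have Bsub: "Ad ` B \<subseteq> bounded_ops K" using c Ad_closed by blast
  note cl = H.ops.op_closeds
  show ?thesis
    unfolding star_subalgebra_def K H.op_algebra_simps(1) ball_simps image_iff[symmetric]
    using B Bsub
    by (simp only: ball_simps Ad_zero[symmetric] Ad_add[symmetric] Ad_scale[symmetric] Ad_mult[symmetric]
        Ad_star[symmetric] c cl inj cong: ball_cong)
qed

lemma Ad_star_iso: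
  assumes "C \<subseteq> bounded_ops H"
  shows "Ad \<in> star_iso (op_algebra H\<lparr>carrier := C\<rparr>) (op_algebra K\<lparr>carrier := Ad ` C\<rparr>)"
proof -
  have c: "S \<in> bounded_ops H" if "S \<in> C" for S using that assms by blast
  have "inj_on Ad C" using Ad_bij assms inj_on_subset by (auto simp: bij_betw_def)
  then show ?thesis
    unfolding star_iso_def star_hom_def
    by (auto simp: bij_betw_def Ad_add Ad_scale Ad_mult Ad_star c simp del: H.op_algebra_simps)
qed

text \<open>\<open>C\<close> is described by minimality over \<open>S\<close> instead of as a hull:
  it will be the algebra defined from all translations, while \<open>S\<close> contains just the
  shift.\<close>

lemma hull_Ad:
  assumes P: "star_subalgebra (op_algebra H) C" "closedin (op_topology H) C" "S \<subseteq> C"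
    and min: "\<And>B. \<lbrakk>star_subalgebra (op_algebra H) B; closedin (op_topology H) B; S \<subseteq> B\<rbrakk> \<Longrightarrow> C \<subseteq> B"
  shows "generated_cstar_algebra K (Ad ` S) = op_algebra K\<lparr>carrier := Ad ` C\<rparr>"
proof -
  have CB: "C \<subseteq> bounded_ops H" using P(1) by (simp add: star_subalgebra_def)
  have "(\<lambda>B. star_subalgebra (op_algebra K) B \<and> closedin (op_topology K) B) hull (Ad ` S) = Ad ` C"
  proof (rule hull_unique)
    show "Ad ` S \<subseteq> Ad ` C" using P(3) by blast
    show "star_subalgebra (op_algebra K) (Ad ` C) \<and> closedin (op_topology K) (Ad ` C)"
      using star_subalgebra_Ad[OF CB] closedin_Ad_iff[OF CB] P by blast
    fix B' assume B': "Ad ` S \<subseteq> B'"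
      "star_subalgebra (op_algebra K) B' \<and> closedin (op_topology K) B'"
    define B where "B = {T \<in> bounded_ops H. Ad T \<in> B'}"
    have "B' \<subseteq> bounded_ops K" using B'(2) by (simp add: star_subalgebra_def op_algebra_def)
    then have AdB: "Ad ` B = B'" using Ad_bij by (auto simp: B_def bij_betw_def)
    have B: "B \<subseteq> bounded_ops H" by (auto simp: B_def)
    have "S \<subseteq> B" using B'(1) P(3) CB by (auto simp: B_def)
    then have "C \<subseteq> B"
      using min[of B] star_subalgebra_Ad[OF B] closedin_Ad_iff[OF B] B'(2) AdB by blast
    then show "Ad ` C \<subseteq> B'" using AdB by blast
  qed
  then show ?thesis by (simp add: generated_cstar_algebra_def)
qed

end

section \<open>Square integrable functions\<close>

lemma borel_measurable_cnj [measurable]: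
  "g \<in> borel_measurable M \<Longrightarrow> (\<lambda>x. cnj (g x)) \<in> borel_measurable M"
  by (rule borel_measurable_continuous_on[OF continuous_on_cnj[OF continuous_on_id]])

lemma L2_funD:
  assumes "f \<in> L2_fun M"
  shows "f \<in> borel_measurable M" "integrable M (\<lambda>x. (cmod (f x))\<^sup>2)"
  using assms by (auto simp: L2_fun_def)

lemma L2_fun_integrable_mult:
  assumes "f \<in> L2_fun M" "g \<in> L2_fun M"
  shows "integrable M (\<lambda>x. f x * cnj (g x))"
proof (rule Bochner_Integration.integrable_bound)
  note [measurable] = L2_funD(1)[OF assms(1)] L2_funD(1)[OF assms(2)]
  show "integrable M (\<lambda>x. (cmod (f x))\<^sup>2 + (cmod (g x))\<^sup>2)"
    using assms by (intro Bochner_Integration.integrable_add L2_funD)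
  show "(\<lambda>x. f x * cnj (g x)) \<in> borel_measurable M" by measurable
  have "cmod (f x) * cmod (g x) \<le> (cmod (f x))\<^sup>2 + (cmod (g x))\<^sup>2" for x
    using sum_squares_bound[of "cmod (f x)" "cmod (g x)"] mult_nonneg_nonneg[of "cmod (f x)" "cmod (g x)"]
    unfolding mult.assoc by (simp del: mult_nonneg_nonneg)
  then show "AE x in M. norm (f x * cnj (g x)) \<le> norm ((cmod (f x))\<^sup>2 + (cmod (g x))\<^sup>2)"
    by (intro AE_I2) (simp add: norm_mult)
qed

lemma L2_fun_add:
  assumes "f \<in> L2_fun M" "g \<in> L2_fun M"
  shows "(\<lambda>x. f x + g x) \<in> L2_fun M"
proof -
  note [measurable] = L2_funD(1)[OF assms(1)] L2_funD(1)[OF assms(2)]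
  have "integrable M (\<lambda>x. (cmod (f x + g x))\<^sup>2)"
  proof (rule Bochner_Integration.integrable_bound)
    show "integrable M (\<lambda>x. 2 * (cmod (f x))\<^sup>2 + 2 * (cmod (g x))\<^sup>2)"
      using assms by (intro Bochner_Integration.integrable_add integrable_mult_right L2_funD)
    show "(\<lambda>x. (cmod (f x + g x))\<^sup>2) \<in> borel_measurable M" by measurable
    have "(cmod (f x + g x))\<^sup>2 \<le> 2 * (cmod (f x))\<^sup>2 + 2 * (cmod (g x))\<^sup>2" for x
    proof -
      have "(cmod (f x + g x))\<^sup>2 \<le> (cmod (f x) + cmod (g x))\<^sup>2"
        by (rule power_mono[OF norm_triangle_ineq]) simp
      also have "\<dots> \<le> 2 * (cmod (f x))\<^sup>2 + 2 * (cmod (g x))\<^sup>2"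
        using sum_squares_bound[of "cmod (f x)" "cmod (g x)"] by (simp add: power2_sum)
      finally show ?thesis .
    qed
    then show "AE x in M. norm ((cmod (f x + g x))\<^sup>2) \<le> norm (2 * (cmod (f x))\<^sup>2 + 2 * (cmod (g x))\<^sup>2)"
      by (intro AE_I2) simp
  qed
  then show ?thesis by (simp add: L2_fun_def)
qed

lemma L2_fun_scale: "f \<in> L2_fun M \<Longrightarrow> (\<lambda>x. c * f x) \<in> L2_fun M"
  unfolding L2_fun_def by (auto simp: norm_mult power_mult_distrib intro: borel_measurable_times)

lemma L2_fun_zero: "(\<lambda>x. 0) \<in> L2_fun M"
  by (simp add: L2_fun_def)

lemma L2_fun_diff: "\<lbrakk>f \<in> L2_fun M; g \<in> L2_fun M\<rbrakk> \<Longrightarrow> (\<lambda>x. f x - g x) \<in> L2_fun M"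
  using L2_fun_add[OF _ L2_fun_scale[of g M "-1"], of f] by simp

lemma L2_class_self: "f \<in> L2_fun M \<Longrightarrow> f \<in> L2_class M f"
  by (simp add: L2_class_def)

lemma L2_class_cong:
  assumes "AE x in M. f x = g x"
  shows "L2_class M f = L2_class M g"
proof -
  have "(AE x in M. h x = f x) \<longleftrightarrow> (AE x in M. h x = g x)" for h
  proof
    assume "AE x in M. h x = f x"
    with assms show "AE x in M. h x = g x" by eventually_elim simp
  next
    assume "AE x in M. h x = g x"
    with assms show "AE x in M. h x = f x" by eventually_elim simp
  qed
  then show ?thesis by (simp add: L2_class_def)
qed

lemma L2_rep_class:
  assumes "f \<in> L2_fun M"
  shows "L2_rep (L2_class M f) \<in> L2_fun M" "AE x in M. L2_rep (L2_class M f) x = f x"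
proof -
  have "L2_rep (L2_class M f) \<in> L2_class M f"
    unfolding L2_rep_def by (rule someI[of "\<lambda>g. g \<in> L2_class M f"]) (rule L2_class_self[OF assms])
  then show "L2_rep (L2_class M f) \<in> L2_fun M" "AE x in M. L2_rep (L2_class M f) x = f x"
    by (auto simp: L2_class_def)
qed

lemma L2_carrier: "u \<in> carrier (L2_space M) \<longleftrightarrow> (\<exists>f\<in>L2_fun M. u = L2_class M f)"
  by (auto simp: L2_space_def)

lemma L2_class_in_carrier: "f \<in> L2_fun M \<Longrightarrow> L2_class M f \<in> carrier (L2_space M)"
  by (auto simp: L2_carrier)

lemma L2_rep:
  assumes "u \<in> carrier (L2_space M)"
  shows "L2_rep u \<in> L2_fun M" "L2_class M (L2_rep u) = u"
proof -
  obtain f where f: "f \<in> L2_fun M" "u = L2_class M f" using assms by (auto simp: L2_carrier)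
  show "L2_rep u \<in> L2_fun M" "L2_class M (L2_rep u) = u"
    unfolding f(2) by (rule L2_rep_class[OF f(1)], rule L2_class_cong, rule L2_rep_class[OF f(1)])
qed

text \<open>Together with its companions below this shows independence of the chosen
  representatives: operations may be computed with any square integrable function in the
  class.\<close>

lemma L2_add:
  assumes "f \<in> L2_fun M" "g \<in> L2_fun M"
  shows "vadd (L2_space M) (L2_class M f) (L2_class M g) = L2_class M (\<lambda>x. f x + g x)"
  unfolding L2_space_def hilbert.simps
  by (rule L2_class_cong)
    (use L2_rep_class(2)[OF assms(1)] L2_rep_class(2)[OF assms(2)] in eventually_elim, simp)

lemma L2_scale:
  assumes "f \<in> L2_fun M"
  shows "vscale (L2_space M) c (L2_class M f) = L2_class M (\<lambda>x. c * f x)"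
  unfolding L2_space_def hilbert.simps
  by (rule L2_class_cong) (use L2_rep_class(2)[OF assms(1)] in eventually_elim, simp)

lemma L2_vdiff:
  assumes "f \<in> L2_fun M" "g \<in> L2_fun M"
  shows "vdiff (L2_space M) (L2_class M f) (L2_class M g) = L2_class M (\<lambda>x. f x - g x)"
  unfolding vdiff_def L2_scale[OF assms(2)] L2_add[OF assms(1) L2_fun_scale[OF assms(2)]] by simp

lemma L2_zero: "vzero (L2_space M) = L2_class M (\<lambda>x. 0)"
  by (simp add: L2_space_def)

lemma L2_cinner:
  assumes "f \<in> L2_fun M" "g \<in> L2_fun M"
  shows "cinner (L2_space M) (L2_class M f) (L2_class M g) = (\<integral>x. f x * cnj (g x) \<partial>M)"
proof -
  note f = L2_rep_class[OF assms(1)] and g = L2_rep_class[OF assms(2)]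
  note [measurable] = L2_funD(1)[OF f(1)] L2_funD(1)[OF g(1)] L2_funD(1)[OF assms(1)] L2_funD(1)[OF assms(2)]
  show ?thesis
    unfolding L2_space_def hilbert.simps
  proof (rule integral_cong_AE)
    show "AE x in M. L2_rep (L2_class M f) x * cnj (L2_rep (L2_class M g) x) = f x * cnj (g x)"
      using f(2) g(2) by eventually_elim simp
  qed measurable
qed

lemma L2_hnorm_sq:
  assumes "f \<in> L2_fun M"
  shows "(hnorm (L2_space M) (L2_class M f))\<^sup>2 = (\<integral>x. (cmod (f x))\<^sup>2 \<partial>M)"
proof -
  have "cinner (L2_space M) (L2_class M f) (L2_class M f) = (\<integral>x. complex_of_real ((cmod (f x))\<^sup>2) \<partial>M)"
    unfolding L2_cinner[OF assms assms] complex_norm_square ..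
  also have "\<dots> = complex_of_real (\<integral>x. (cmod (f x))\<^sup>2 \<partial>M)" by (rule integral_complex_of_real)
  finally show ?thesis by (simp add: hnorm_def)
qed

lemma prehilbert_L2: "prehilbert (L2_space M)"
proof
  show "vzero (L2_space M) \<in> carrier (L2_space M)"
    unfolding L2_zero by (rule L2_class_in_carrier[OF L2_fun_zero])
  fix u v assume "u \<in> carrier (L2_space M)" "v \<in> carrier (L2_space M)"
  then obtain f g where f: "f \<in> L2_fun M" and u: "u = L2_class M f"
    and g: "g \<in> L2_fun M" and v: "v = L2_class M g" by (auto simp: L2_carrier)
  show "vadd (L2_space M) u v \<in> carrier (L2_space M)"
    unfolding u v L2_add[OF f g] by (rule L2_class_in_carrier[OF L2_fun_add[OF f g]])
  show "cinner (L2_space M) (vscale (L2_space M) c u) v = c * cinner (L2_space M) u v" for c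
    unfolding u v L2_scale[OF f] L2_cinner[OF L2_fun_scale[OF f] g] L2_cinner[OF f g]
    by (simp add: mult.assoc)
  show "cinner (L2_space M) v u = cnj (cinner (L2_space M) u v)"
    unfolding u v L2_cinner[OF g f] L2_cinner[OF f g] Bochner_Integration.integral_cnj[symmetric]
    by (rule Bochner_Integration.integral_cong) (simp_all add: mult.commute)
  show "cinner (L2_space M) (vadd (L2_space M) u v) w = cinner (L2_space M) u w + cinner (L2_space M) v w"
    if wc: "w \<in> carrier (L2_space M)" for w
  proof -
    obtain h where h: "h \<in> L2_fun M" and w: "w = L2_class M h" using wc by (auto simp: L2_carrier)
    show ?thesis
      unfolding u v w L2_add[OF f g] L2_cinner[OF L2_fun_add[OF f g] h] L2_cinner[OF f h] L2_cinner[OF g h]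
      using L2_fun_integrable_mult[OF f h] L2_fun_integrable_mult[OF g h]
      by (simp add: ring_distribs)
  qed
  assume 0: "cinner (L2_space M) (vdiff (L2_space M) u v) (vdiff (L2_space M) u v) = 0"
  note d = L2_fun_diff[OF f g]
  have "(\<integral>x. (cmod (f x - g x))\<^sup>2 \<partial>M) = 0"
    using 0 L2_hnorm_sq[OF d] unfolding u v L2_vdiff[OF f g] by (simp add: hnorm_def)
  then have "AE x in M. (cmod (f x - g x))\<^sup>2 = 0"
    using integral_nonneg_eq_0_iff_AE[OF L2_funD(2)[OF d]] by simp
  then show "u = v" unfolding u v by (intro L2_class_cong) (auto elim: eventually_mono)
next
  fix u assume "u \<in> carrier (L2_space M)"
  then obtain f where f: "f \<in> L2_fun M" and u: "u = L2_class M f" by (auto simp: L2_carrier)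
  show "vscale (L2_space M) c u \<in> carrier (L2_space M)" for c
    unfolding u L2_scale[OF f] by (rule L2_class_in_carrier[OF L2_fun_scale[OF f]])
  show "cinner (L2_space M) (vzero (L2_space M)) u = 0"
    unfolding u L2_zero L2_cinner[OF L2_fun_zero f] by simp
  have "Re (cinner (L2_space M) u u) = (\<integral>x. Re (f x * cnj (f x)) \<partial>M)"
    unfolding u L2_cinner[OF f f] by (rule integral_Re[symmetric, OF L2_fun_integrable_mult[OF f f]])
  then show "0 \<le> Re (cinner (L2_space M) u u)" by simp
qed

interpretation L2: prehilbert "L2_space M" for M
  by (rule prehilbert_L2)

section \<open>Completeness of the space of square integrable functions\<close>

lemma L2_hnorm_le_nn:
  assumes f: "f \<in> borel_measurable M" and e: "0 \<le> e"
    and le: "(\<integral>\<^sup>+x. ennreal ((cmod (f x))\<^sup>2) \<partial>M) \<le> ennreal (e\<^sup>2)"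
  shows "f \<in> L2_fun M" "hnorm (L2_space M) (L2_class M f) \<le> e"
proof -
  have "(\<integral>\<^sup>+x. ennreal (norm ((cmod (f x))\<^sup>2)) \<partial>M) < \<infinity>"
    using le by (simp add: order_le_less_trans[OF _ ennreal_less_top])
  then have int: "integrable M (\<lambda>x. (cmod (f x))\<^sup>2)"
    using f by (intro integrableI_bounded) auto
  then show L: "f \<in> L2_fun M" using f by (simp add: L2_fun_def)
  have "ennreal (\<integral>x. (cmod (f x))\<^sup>2 \<partial>M) \<le> ennreal (e\<^sup>2)"
    using le nn_integral_eq_integral[OF int] by simp
  then have "(hnorm (L2_space M) (L2_class M f))\<^sup>2 \<le> e\<^sup>2"
    unfolding L2_hnorm_sq[OF L] by (subst (asm) ennreal_le_iff) simp_all
  then show "hnorm (L2_space M) (L2_class M f) \<le> e" by (rule power2_le_imp_le[OF _ e])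
qed

lemma L2_nn_integral:
  assumes "f \<in> L2_fun M"
  shows "(\<integral>\<^sup>+x. ennreal ((cmod (f x))\<^sup>2) \<partial>M) = ennreal ((hnorm (L2_space M) (L2_class M f))\<^sup>2)"
  unfolding L2_hnorm_sq[OF assms] by (rule nn_integral_eq_integral[OF L2_funD(2)[OF assms]]) simp

text \<open>Finiteness of the measure lets the \<open>L\<^sup>1\<close> norm be controlled by the \<open>L\<^sup>2\<close> norm.\<close>

lemma (in finite_measure) L2_fast_Cauchy_AE_convergent:
  assumes f: "\<And>k::nat. f k \<in> L2_fun M"
    and fast: "\<And>k. hnorm (L2_space M) (L2_class M (\<lambda>x. f (Suc k) x - f k x)) \<le> (1/2) ^ k"
  shows "AE x in M. convergent (\<lambda>k. f k x)"
proof -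
  note [measurable] = L2_funD(1)[OF f]
  define g where "g k x = f (Suc k) x - f k x" for k x
  have geq: "g k = (\<lambda>x. f (Suc k) x - f k x)" for k by (simp add: g_def fun_eq_iff)
  have g: "g k \<in> L2_fun M" for k unfolding geq by (rule L2_fun_diff[OF f f])
  note [measurable] = L2_funD(1)[OF g]
  \<comment> \<open>The summands stem from the integrals of
    \<open>2 ^ k * (cmod (g k x))\<^sup>2\<close> and of the constant
    \<open>(1/2) ^ k\<close>.\<close>
  define C where "C = 1 + measure M (space M)"
  have int: "integrable M (\<lambda>x. 2 ^ k * (cmod (g k x))\<^sup>2 + (1/2) ^ k)" for k
    using L2_funD(2)[OF g] by simp
  have le: "(\<integral>\<^sup>+x. ennreal (cmod (g k x)) \<partial>M) \<le> ennreal (C * (1/2) ^ k)" for k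
  proof -
    have "(\<integral>\<^sup>+x. ennreal (cmod (g k x)) \<partial>M) \<le> (\<integral>\<^sup>+x. ennreal (2 ^ k * (cmod (g k x))\<^sup>2 + (1/2) ^ k) \<partial>M)"
    proof (intro nn_integral_mono ennreal_leI)
      fix x
      \<comment> \<open>With \<open>t = 2 ^ k * cmod (g k x)\<close> this says
        \<open>t \<le> t\<^sup>2 + 1\<close>. The weight \<open>2 ^ k\<close> is chosen against a
        squared norm of at most \<open>(1/4) ^ k\<close>, so that both resulting integrals are
        summable in \<open>k\<close>.\<close>
      have "0 \<le> (2 ^ k * cmod (g k x) - 1)\<^sup>2 + 2 ^ k * cmod (g k x)" by simp
      then have "2 ^ k * cmod (g k x) \<le> 2 ^ k * (2 ^ k * (cmod (g k x))\<^sup>2 + (1/2) ^ k)"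
        by (simp add: power2_eq_square algebra_simps flip: power_mult_distrib)
      then show "cmod (g k x) \<le> 2 ^ k * (cmod (g k x))\<^sup>2 + (1/2) ^ k" by simp
    qed
    also have "\<dots> = ennreal (\<integral>x. 2 ^ k * (cmod (g k x))\<^sup>2 + (1/2) ^ k \<partial>M)"
      by (rule nn_integral_eq_integral[OF int]) simp
    also have "(\<integral>x. 2 ^ k * (cmod (g k x))\<^sup>2 + (1/2) ^ k \<partial>M) =
        2 ^ k * (hnorm (L2_space M) (L2_class M (g k)))\<^sup>2 + (1/2) ^ k * measure M (space M)"
      unfolding L2_hnorm_sq[OF g] using L2_funD(2)[OF g] by simp
    also have "\<dots> \<le> 2 ^ k * ((1/2) ^ k)\<^sup>2 + (1/2) ^ k * measure M (space M)"
      using fast[of k, folded geq] L2.hnorm_nonneg[OF L2_class_in_carrier[OF g]]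
      by (intro add_right_mono mult_left_mono power_mono) simp_all
    also have "\<dots> = C * (1/2) ^ k"
      by (simp add: C_def power2_eq_square algebra_simps flip: power_mult_distrib)
    finally show ?thesis by (simp add: ennreal_leI)
  qed
  have "(\<integral>\<^sup>+x. (\<Sum>k. ennreal (cmod (g k x))) \<partial>M) = (\<Sum>k. \<integral>\<^sup>+x. ennreal (cmod (g k x)) \<partial>M)"
    by (rule nn_integral_suminf) measurable
  also have "\<dots> \<le> (\<Sum>k. ennreal (C * (1/2) ^ k))"
    by (rule suminf_le[OF le]) simp_all
  also have "\<dots> = ennreal (\<Sum>k. C * (1/2) ^ k)"
    by (rule suminf_ennreal2) (auto simp: C_def intro!: summable_mult)
  also have "\<dots> < \<infinity>" by simp
  finally have "AE x in M. (\<Sum>k. ennreal (cmod (g k x))) \<noteq> \<infinity>"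
    by (intro nn_integral_PInf_AE) auto
  then show ?thesis
  proof eventually_elim
    case (elim x)
    then have "summable (\<lambda>k. cmod (g k x))"
      by (intro summable_suminf_not_top) auto
    then have "summable (\<lambda>k. g k x)" by (rule summable_norm_cancel)
    then have "convergent (\<lambda>n. \<Sum>k<n. g k x)" by (simp add: summable_iff_convergent)
    moreover have "(\<Sum>k<n. g k x) = f n x - f 0 x" for n
      unfolding g_def by (rule sum_lessThan_telescope)
    ultimately have "convergent (\<lambda>n. (f n x - f 0 x) + f 0 x)"
      by (intro convergent_add convergent_const) simp
    then show ?case by simp
  qed
qed

text \<open>A subsequence with geometrically small increments converges almost everywhere, and
  Fatou's lemma turns this into convergence of the whole sequence in norm.\<close>

lemma (in finite_measure) L2_mcomplete:
  "Metric_space.mcomplete (carrier (L2_space M)) (hdist (L2_space M))"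
  unfolding L2.hmetric.mcomplete_def
proof (intro allI impI)
  fix u assume C: "Metric_space.MCauchy (carrier (L2_space M)) (hdist (L2_space M)) u"
  have u: "u n \<in> carrier (L2_space M)" for n using C by (auto simp: L2.hmetric.MCauchy_def)
  define f where "f n = L2_rep (u n)" for n
  have f: "f n \<in> L2_fun M" and uf: "u n = L2_class M (f n)" for n
    using L2_rep[OF u] by (simp_all add: f_def)
  note [measurable] = L2_funD(1)[OF f]
  have dist: "hdist (L2_space M) (u n) (u m) = hnorm (L2_space M) (L2_class M (\<lambda>x. f n x - f m x))" for n m
    using L2.hdist_eq[OF u u] L2_vdiff[OF f f] by (simp add: uf)
  have CN: "\<exists>N. \<forall>n m. N \<le> n \<longrightarrow> N \<le> m \<longrightarrow> hdist (L2_space M) (u n) (u m) < e" if "e > 0" for e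
    using C that unfolding L2.hmetric.MCauchy_def by simp
  have "\<exists>N. \<forall>n m. N \<le> n \<longrightarrow> N \<le> m \<longrightarrow> hdist (L2_space M) (u n) (u m) < (1/2) ^ k" for k :: nat
    by (rule CN) simp
  then obtain N where N: "\<And>k n m. \<lbrakk>N k \<le> n; N k \<le> m\<rbrakk> \<Longrightarrow> hdist (L2_space M) (u n) (u m) < (1/2) ^ k"
    by metis
  \<comment> \<open>The sum dominates \<open>N i\<close> for all \<open>i \<le> k\<close>, so both
    \<open>r k\<close> and \<open>r (Suc k)\<close> are at least \<open>N k\<close>; the added
    \<open>k\<close> makes \<open>r\<close> pass every index.\<close>
  define r where "r k = (\<Sum>i\<le>k. N i) + k" for k
  have m: "N k \<le> (\<Sum>i\<le>k. N i)" for k by (rule member_le_sum) auto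
  have rN: "N k \<le> r k" "N k \<le> r (Suc k)" "k \<le> r k" for k
    using m[of k] by (simp_all add: r_def)
  have "hnorm (L2_space M) (L2_class M (\<lambda>x. f (r (Suc k)) x - f (r k) x)) \<le> (1/2) ^ k" for k
    using N[OF rN(2,1)] by (simp add: dist less_imp_le)
  from L2_fast_Cauchy_AE_convergent[OF f this]
  have conv: "AE x in M. convergent (\<lambda>k. f (r k) x)" .
  define h where "h x = lim (\<lambda>k. f (r k) x)" for x
  have h: "h \<in> borel_measurable M" unfolding h_def by measurable
  note [measurable] = h
  \<comment> \<open>Fatou's lemma for \<open>f (r k) - f n\<close> as \<open>k\<close> grows, with
    \<open>n\<close> fixed in the Cauchy range.\<close>
  have est: "(\<lambda>x. h x - f n x) \<in> L2_fun M \<and>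
      hnorm (L2_space M) (L2_class M (\<lambda>x. h x - f n x)) \<le> e"
    if e: "e > 0" and n: "n \<ge> K"
      and K: "\<And>n m. \<lbrakk>K \<le> n; K \<le> m\<rbrakk> \<Longrightarrow> hdist (L2_space M) (u n) (u m) < e" for e K n
  proof -
    have "(\<integral>\<^sup>+x. ennreal ((cmod (h x - f n x))\<^sup>2) \<partial>M) =
        (\<integral>\<^sup>+x. liminf (\<lambda>k. ennreal ((cmod (f (r k) x - f n x))\<^sup>2)) \<partial>M)"
    proof (rule nn_integral_cong_AE, use conv in eventually_elim)
      case (elim x)
      then have "(\<lambda>k. f (r k) x) \<longlonglongrightarrow> h x" by (simp add: h_def convergent_LIMSEQ_iff)
      then have "(\<lambda>k. ennreal ((cmod (f (r k) x - f n x))\<^sup>2)) \<longlonglongrightarrow> ennreal ((cmod (h x - f n x))\<^sup>2)"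
        by (intro tendsto_ennrealI tendsto_intros)
      then show ?case by (intro lim_imp_Liminf[symmetric]) simp_all
    qed
    also have "\<dots> \<le> liminf (\<lambda>k. \<integral>\<^sup>+x. ennreal ((cmod (f (r k) x - f n x))\<^sup>2) \<partial>M)"
      by (rule nn_integral_liminf) measurable
    also have "\<dots> \<le> ennreal (e\<^sup>2)"
    proof (rule order_trans[OF Liminf_mono[where g = "\<lambda>_. ennreal (e\<^sup>2)"]])
      show "liminf (\<lambda>_. ennreal (e\<^sup>2)) \<le> ennreal (e\<^sup>2)" by (simp add: Liminf_const)
      show "\<forall>\<^sub>F k in sequentially. (\<integral>\<^sup>+x. ennreal ((cmod (f (r k) x - f n x))\<^sup>2) \<partial>M) \<le> ennreal (e\<^sup>2)"
        unfolding eventually_sequentially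
      proof (intro exI[of _ K] allI impI)
        fix k assume "K \<le> k"
        then have "hnorm (L2_space M) (L2_class M (\<lambda>x. f (r k) x - f n x)) \<le> e"
          using K[OF _ n, of "r k"] rN(3)[of k] by (simp add: dist)
        then show "(\<integral>\<^sup>+x. ennreal ((cmod (f (r k) x - f n x))\<^sup>2) \<partial>M) \<le> ennreal (e\<^sup>2)"
          unfolding L2_nn_integral[OF L2_fun_diff[OF f f]]
          by (intro ennreal_leI power_mono) (simp_all add: L2_class_in_carrier L2_fun_diff f)
      qed
    qed
    finally have "(\<integral>\<^sup>+x. ennreal ((cmod (h x - f n x))\<^sup>2) \<partial>M) \<le> ennreal (e\<^sup>2)" .
    from L2_hnorm_le_nn[OF _ _ this] show ?thesis using e by simp
  qed
  obtain K where "\<And>n m. \<lbrakk>K \<le> n; K \<le> m\<rbrakk> \<Longrightarrow> hdist (L2_space M) (u n) (u m) < 1"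
    using CN[of 1] by auto
  then have "(\<lambda>x. h x - f K x) \<in> L2_fun M" using est[of 1 K K] by simp
  from L2_fun_add[OF this f[of K]] have hL: "h \<in> L2_fun M" by simp
  have "limitin (htopology (L2_space M)) u (L2_class M h) sequentially"
    unfolding L2.hmetric.limitin_metric
  proof (intro conjI L2_class_in_carrier[OF hL] allI impI)
    fix e :: real assume e: "e > 0"
    then obtain K where K: "\<And>n m. \<lbrakk>K \<le> n; K \<le> m\<rbrakk> \<Longrightarrow> hdist (L2_space M) (u n) (u m) < e / 2"
      using CN[of "e/2"] by (metis half_gt_zero)
    have "hdist (L2_space M) (u n) (L2_class M h) < e" if "n \<ge> K" for n
    proof -
      have "hdist (L2_space M) (L2_class M h) (u n) = hnorm (L2_space M) (L2_class M (\<lambda>x. h x - f n x))"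
        using L2.hdist_eq[OF L2_class_in_carrier[OF hL] u] L2_vdiff[OF hL f] by (simp add: uf)
      also have "\<dots> \<le> e / 2" using est[OF _ that K] e by simp
      also have "\<dots> < e" using e by simp
      finally show ?thesis by (simp add: L2.hmetric.commute)
    qed
    then show "\<forall>\<^sub>F n in sequentially. u n \<in> carrier (L2_space M) \<and> hdist (L2_space M) (u n) (L2_class M h) < e"
      using u by (auto simp: eventually_sequentially)
  qed
  then show "\<exists>v. limitin (htopology (L2_space M)) u v sequentially" by blast
qed

section \<open>The Hardy space\<close>

lemma continuous_circle_L2:
  assumes "continuous_on unit_circle f"
  shows "f \<in> L2_fun circle_measure"
  unfolding L2_fun_def
  by (intro CollectI conjI continuous_circle_measurable continuous_circle_integrable
      continuous_intros assms)

abbreviation circle_class :: "(complex \<Rightarrow> complex) \<Rightarrow> (complex \<Rightarrow> complex) set" where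
  "circle_class \<equiv> L2_class circle_measure"

abbreviation partial :: "(int \<Rightarrow> complex) \<Rightarrow> nat \<Rightarrow> int \<Rightarrow> complex" where
  "partial \<xi> N \<equiv> cut {0..<int N} \<xi>"

abbreviation partial_sum :: "(int \<Rightarrow> complex) \<Rightarrow> nat \<Rightarrow> (complex \<Rightarrow> complex) set" where
  "partial_sum \<xi> N \<equiv> circle_class (trig (partial \<xi> N))"

lemma trig_L2: "trig \<xi> \<in> L2_fun circle_measure"
  by (intro continuous_circle_L2 continuous_intros)

lemma trig_closed [simp]: "circle_class (trig \<xi>) \<in> carrier L2_circle"
  by (rule L2_class_in_carrier[OF trig_L2])

lemma finite_partial: "finite {x. partial \<xi> N x \<noteq> 0}"
  by (rule finite_subset[of _ "{0..<int N}"]) (auto simp: cut_def)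

lemma trig_partial: "trig (partial \<xi> N) z = (\<Sum>x\<in>{0..<int N}. \<xi> x * z powi x)"
  by (subst trig_superset[of "{0..<int N}"]) (auto simp: cut_def)

lemma partial_sum_cinner:
  "cinner L2_circle (partial_sum \<xi> N) (partial_sum \<eta> M) = cinner (ell2 UNIV) (partial \<xi> N) (partial \<eta> M)"
  unfolding L2_cinner[OF trig_L2 trig_L2] by (rule trig_cinner[OF finite_partial finite_partial])

lemma partial_sum_add:
  "partial_sum (\<lambda>x. \<xi> x + \<eta> x) N = vadd L2_circle (partial_sum \<xi> N) (partial_sum \<eta> N)"
  unfolding L2_add[OF trig_L2 trig_L2] trig_partial
  by (rule arg_cong[where f = circle_class]) (simp add: fun_eq_iff trig_partial ring_distribs sum.distrib)

lemma partial_sum_scale: "partial_sum (\<lambda>x. c * \<xi> x) N = vscale L2_circle c (partial_sum \<xi> N)"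
  unfolding L2_scale[OF trig_L2]
  by (rule arg_cong[where f = circle_class]) (simp add: fun_eq_iff trig_partial sum_distrib_left mult.assoc)

lemma partial_hconverges:
  assumes "\<xi> \<in> carrier (ell2 \<nat>)"
  shows "ell2.hconverges \<nat> (partial \<xi>) \<xi>"
proof -
  have d: "hnorm (ell2 \<nat>) (vdiff (ell2 \<nat>) (partial \<xi> N) \<xi>) \<ge> 0" for N
    using ell2.vdiff_closed[OF cut_closed(1)[OF assms] assms] by (rule hnorm_ell2_nonneg)
  have "(\<lambda>N. hnorm (ell2 \<nat>) (vdiff (ell2 \<nat>) (partial \<xi> N) \<xi>)) \<longlonglongrightarrow> 0"
  proof (rule LIMSEQ_I)
    fix e :: real assume e: "e > 0"
    then have "e / 2 > 0" by simp
    from cut_approx[OF assms this] obtain F where F: "finite F" "F \<subseteq> \<nat>"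
      "\<And>E. F \<subseteq> E \<Longrightarrow> hnorm (ell2 \<nat>) (\<lambda>x. cut E \<xi> x - \<xi> x) \<le> e / 2" by metis
    obtain b where b: "\<And>x. x \<in> F \<Longrightarrow> x \<le> b" using bdd_above_finite[OF F(1)] by (auto simp: bdd_above_def)
    have "norm (hnorm (ell2 \<nat>) (vdiff (ell2 \<nat>) (partial \<xi> N) \<xi>) - 0) < e" if "N \<ge> nat (b + 1)" for N
    proof -
      have "F \<subseteq> {0..<int N}"
      proof
        fix x assume "x \<in> F"
        then have "0 \<le> x" "x \<le> b" using F(2) b by (auto simp: subset_iff Nats_int_iff)
        then show "x \<in> {0..<int N}" using that by auto
      qed
      from F(3)[OF this] show ?thesis using d[of N] e by simp
    qed
    then show "\<exists>no. \<forall>n\<ge>no. norm (hnorm (ell2 \<nat>) (vdiff (ell2 \<nat>) (partial \<xi> n) \<xi>) - 0) < e" by blast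
  qed
  then show ?thesis using assms cut_closed(1)[OF assms] by (simp add: ell2.hconverges_def)
qed

text \<open>Carries the Cauchy property of the truncations over to the partial sums, where
  completeness provides the limit.\<close>

lemma partial_sum_dist:
  assumes "\<xi> \<in> carrier (ell2 \<nat>)"
  shows "hdist L2_circle (partial_sum \<xi> N) (partial_sum \<xi> M) = hdist (ell2 \<nat>) (partial \<xi> N) (partial \<xi> M)"
proof -
  note c = cut_closed(1)[OF assms] and c' = ell2_in_l2[OF cut_closed(1)[OF assms]]
  have d: "vdiff (ell2 \<nat>) (partial \<xi> N) (partial \<xi> M) \<in> carrier (ell2 \<nat>)"
    by (rule ell2.vdiff_closed[OF c c])
  have "cinner L2_circle (vdiff L2_circle (partial_sum \<xi> N) (partial_sum \<xi> M))
        (vdiff L2_circle (partial_sum \<xi> N) (partial_sum \<xi> M)) =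
      cinner (ell2 UNIV) (vdiff (ell2 UNIV) (partial \<xi> N) (partial \<xi> M)) (vdiff (ell2 UNIV) (partial \<xi> N) (partial \<xi> M))"
    by (simp only: L2.cinner_vdiff_left L2.cinner_vdiff_right L2.vdiff_closed trig_closed partial_sum_cinner
        ell2.cinner_vdiff_left[OF c' c'] ell2.cinner_vdiff_right[OF c' c'] ell2.vdiff_closed[OF c' c'] c')
  then have "hnorm L2_circle (vdiff L2_circle (partial_sum \<xi> N) (partial_sum \<xi> M)) =
      hnorm (ell2 UNIV) (vdiff (ell2 UNIV) (partial \<xi> N) (partial \<xi> M))"
    by (simp only: hnorm_def)
  also have "\<dots> = hnorm (ell2 \<nat>) (vdiff (ell2 \<nat>) (partial \<xi> N) (partial \<xi> M))"
    using hnorm_ell2_UNIV[OF d] by (simp only: ell2_simps)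
  finally show ?thesis
    by (simp only: L2.hdist_eq[OF trig_closed trig_closed] ell2.hdist_eq[OF c c])
qed

lemma partial_sum_converges:
  assumes "\<xi> \<in> carrier (ell2 \<nat>)"
  shows "\<exists>v. L2.hconverges circle_measure (partial_sum \<xi>) v"
proof (rule L2.mcomplete_hconverges[OF circle.L2_mcomplete])
  have "ell2.hmetric.MCauchy \<nat> (partial \<xi>)" by (rule ell2.hconverges_MCauchy[OF partial_hconverges[OF assms]])
  then show "Metric_space.MCauchy (carrier L2_circle) (hdist L2_circle) (partial_sum \<xi>)"
    unfolding ell2.hmetric.MCauchy_def L2.hmetric.MCauchy_def partial_sum_dist[OF assms] by auto
qed

text \<open>The power series with coefficients \<open>\<xi>\<close>, as a limit in norm. One fixed
  sequence of partial sums for every \<open>\<xi>\<close> makes linearity immediate, which an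
  arbitrary approximating sequence would not.\<close>

definition hardy_iso :: "(int \<Rightarrow> complex) \<Rightarrow> (complex \<Rightarrow> complex) set" where
  "hardy_iso \<xi> = (THE v. L2.hconverges circle_measure (partial_sum \<xi>) v)"

lemma hardy_iso_eq:
  assumes "L2.hconverges circle_measure (partial_sum \<xi>) v"
  shows "hardy_iso \<xi> = v"
  unfolding hardy_iso_def by (rule the_equality, rule assms, rule L2.hconverges_unique[OF _ assms])

lemma hardy_iso_converges:
  assumes "\<xi> \<in> carrier (ell2 \<nat>)"
  shows "L2.hconverges circle_measure (partial_sum \<xi>) (hardy_iso \<xi>)"
proof -
  obtain v where v: "L2.hconverges circle_measure (partial_sum \<xi>) v"
    using partial_sum_converges[OF assms] by blast
  then show ?thesis by (simp only: hardy_iso_eq[OF v])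
qed

lemma hardy_iso_closed: "\<xi> \<in> carrier (ell2 \<nat>) \<Longrightarrow> hardy_iso \<xi> \<in> carrier L2_circle"
  by (rule L2.hconvergesD(2)[OF hardy_iso_converges])

lemma hardy_iso_add:
  assumes "\<xi> \<in> carrier (ell2 \<nat>)" "\<eta> \<in> carrier (ell2 \<nat>)"
  shows "hardy_iso (vadd (ell2 \<nat>) \<xi> \<eta>) = vadd L2_circle (hardy_iso \<xi>) (hardy_iso \<eta>)"
  by (rule hardy_iso_eq)
    (simp only: ell2_simps partial_sum_add L2.hconverges_add[OF hardy_iso_converges[OF assms(1)] hardy_iso_converges[OF assms(2)]])

lemma hardy_iso_scale:
  assumes "\<xi> \<in> carrier (ell2 \<nat>)"
  shows "hardy_iso (vscale (ell2 \<nat>) c \<xi>) = vscale L2_circle c (hardy_iso \<xi>)"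
  by (rule hardy_iso_eq)
    (simp only: ell2_simps partial_sum_scale L2.hconverges_scale[OF hardy_iso_converges[OF assms]])

lemma hardy_iso_cinner:
  assumes "\<xi> \<in> carrier (ell2 \<nat>)" "\<eta> \<in> carrier (ell2 \<nat>)"
  shows "cinner L2_circle (hardy_iso \<xi>) (hardy_iso \<eta>) = cinner (ell2 \<nat>) \<xi> \<eta>"
proof (rule LIMSEQ_unique)
  show "(\<lambda>N. cinner L2_circle (partial_sum \<xi> N) (partial_sum \<eta> N)) \<longlonglongrightarrow> cinner L2_circle (hardy_iso \<xi>) (hardy_iso \<eta>)"
    by (rule L2.hconverges_cinner2[OF hardy_iso_converges[OF assms(1)] hardy_iso_converges[OF assms(2)]])
  show "(\<lambda>N. cinner L2_circle (partial_sum \<xi> N) (partial_sum \<eta> N)) \<longlonglongrightarrow> cinner (ell2 \<nat>) \<xi> \<eta>"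
    using ell2.hconverges_cinner2[OF partial_hconverges[OF assms(1)] partial_hconverges[OF assms(2)]]
    by (simp only: partial_sum_cinner cinner_ell2_UNIV[OF cut_closed(1)[OF assms(1)]])
qed

lemma hardy_iso_hnorm: "\<xi> \<in> carrier (ell2 \<nat>) \<Longrightarrow> hnorm L2_circle (hardy_iso \<xi>) = hnorm (ell2 \<nat>) \<xi>"
  by (simp add: hnorm_def hardy_iso_cinner)

lemma hardy_iso_vdiff:
  assumes "\<xi> \<in> carrier (ell2 \<nat>)" "\<eta> \<in> carrier (ell2 \<nat>)"
  shows "hardy_iso (vdiff (ell2 \<nat>) \<xi> \<eta>) = vdiff L2_circle (hardy_iso \<xi>) (hardy_iso \<eta>)"
  unfolding vdiff_def using assms
  by (simp only: hardy_iso_add hardy_iso_scale ell2.scale_closed)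

lemma hardy_iso_hdist:
  assumes "\<xi> \<in> carrier (ell2 \<nat>)" "\<eta> \<in> carrier (ell2 \<nat>)"
  shows "hdist L2_circle (hardy_iso \<xi>) (hardy_iso \<eta>) = hdist (ell2 \<nat>) \<xi> \<eta>"
  by (simp only: L2.hdist_eq[OF hardy_iso_closed[OF assms(1)] hardy_iso_closed[OF assms(2)]]
      ell2.hdist_eq[OF assms] hardy_iso_vdiff[OF assms, symmetric] hardy_iso_hnorm[OF ell2.vdiff_closed[OF assms]])

lemma hardy_iso_delta: "hardy_iso (ell2_delta (int n)) = circle_class (\<lambda>z. z ^ n)"
proof -
  have "int n \<in> \<nat>" by simp
  then have d: "ell2_delta (int n) \<in> carrier (ell2 \<nat>)" by (rule ell2_delta_in_carrier)
  have "trig (partial (ell2_delta (int n)) N) = (\<lambda>z. z ^ n)" if "N \<ge> Suc n" for N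
    using that by (auto simp: fun_eq_iff trig_partial ell2_delta_def if_distrib if_distribR sum.If_cases power_int_of_nat cong: if_cong)
  then have eq: "\<forall>\<^sub>F N in sequentially. partial_sum (ell2_delta (int n)) N = circle_class (\<lambda>z. z ^ n)"
    unfolding eventually_sequentially by metis
  have c: "circle_class (\<lambda>z. z ^ n) \<in> carrier L2_circle"
    by (intro L2_class_in_carrier continuous_circle_L2 continuous_intros)
  show ?thesis
  proof (rule hardy_iso_eq, unfold L2.hconverges_def, intro conjI allI trig_closed c)
    show "(\<lambda>N. hnorm L2_circle (vdiff L2_circle (partial_sum (ell2_delta (int n)) N) (circle_class (\<lambda>z. z ^ n)))) \<longlonglongrightarrow> 0"
    proof (rule tendsto_eventually, use eq in eventually_elim)
      case (elim N)
      then show ?case by (simp only: L2.vdiff_self[OF c] L2.hnorm_zero)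
    qed
  qed
qed

text \<open>The isometric image of a complete space is closed: a convergent sequence in the image
  comes from a Cauchy sequence of coefficients.\<close>

lemma closed_subspace_hardy_iso: "closed_subspace L2_circle (hardy_iso ` carrier (ell2 \<nat>))"
  unfolding closed_subspace_def
proof (intro conjI)
  let ?R = "hardy_iso ` carrier (ell2 \<nat>)"
  show "?R \<subseteq> carrier L2_circle" using hardy_iso_closed by blast
  show "vzero L2_circle \<in> ?R"
  proof -
    have z: "(\<lambda>x. 0) \<in> carrier (ell2 \<nat>)" by (rule ell2_zero_closed)
    have "hnorm L2_circle (hardy_iso (\<lambda>x. 0)) = 0"
      using hardy_iso_hnorm[OF z] ell2.hnorm_zero[of "\<nat>", unfolded ell2_simps] by (simp only:)
    then have "hardy_iso (\<lambda>x. 0) = vzero L2_circle"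
      using L2.hnorm_eq_0_iff[OF hardy_iso_closed[OF z]] by simp
    then show ?thesis using z by (metis image_eqI)
  qed
  show "\<forall>x\<in>?R. \<forall>y\<in>?R. vadd L2_circle x y \<in> ?R"
  proof (intro ballI)
    fix u v assume "u \<in> ?R" "v \<in> ?R"
    then obtain \<xi> \<eta> where \<xi>: "\<xi> \<in> carrier (ell2 \<nat>)" "u = hardy_iso \<xi>"
      and \<eta>: "\<eta> \<in> carrier (ell2 \<nat>)" "v = hardy_iso \<eta>" by blast
    show "vadd L2_circle u v \<in> ?R"
      unfolding \<xi>(2) \<eta>(2) hardy_iso_add[OF \<xi>(1) \<eta>(1), symmetric]
      by (rule imageI[OF ell2.add_closed[OF \<xi>(1) \<eta>(1)]])
  qed
  show "\<forall>c. \<forall>x\<in>?R. vscale L2_circle c x \<in> ?R"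
  proof (intro allI ballI)
    fix c u assume "u \<in> ?R"
    then obtain \<xi> where \<xi>: "\<xi> \<in> carrier (ell2 \<nat>)" "u = hardy_iso \<xi>" by blast
    show "vscale L2_circle c u \<in> ?R"
      unfolding \<xi>(2) hardy_iso_scale[OF \<xi>(1), symmetric]
      by (rule imageI[OF ell2.scale_closed[OF \<xi>(1)]])
  qed
  show "closedin (htopology L2_circle) ?R"
    unfolding L2.hmetric.metric_closedin_iff_sequentially_closed
  proof (intro conjI allI impI)
    show "?R \<subseteq> carrier L2_circle" using hardy_iso_closed by blast
    fix s v assume "range s \<subseteq> ?R \<and> limitin (htopology L2_circle) s v sequentially"
    then have s: "range s \<subseteq> ?R" and v: "limitin (htopology L2_circle) s v sequentially" by auto
    have "\<forall>n. \<exists>\<xi>\<in>carrier (ell2 \<nat>). s n = hardy_iso \<xi>" using s by blast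
    then obtain x where x: "\<And>n. x n \<in> carrier (ell2 \<nat>)" "\<And>n. s n = hardy_iso (x n)" by metis
    have sc: "\<forall>n. s n \<in> carrier L2_circle" using x hardy_iso_closed by simp
    have hv: "L2.hconverges circle_measure s v" by (rule iffD1[OF L2.hconverges_limitin[OF sc] v])
    have "Metric_space.MCauchy (carrier L2_circle) (hdist L2_circle) s" by (rule L2.hconverges_MCauchy[OF hv])
    then have cx: "ell2.hmetric.MCauchy \<nat> x"
      unfolding ell2.hmetric.MCauchy_def L2.hmetric.MCauchy_def x(2) hardy_iso_hdist[OF x(1) x(1)] using x(1) by blast
    obtain \<xi> where \<xi>: "ell2.hconverges \<nat> x \<xi>" using ell2.mcomplete_hconverges[OF ell2_mcomplete cx] by blast
    note \<xi>c = ell2.hconvergesD(2)[OF \<xi>]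
    have "L2.hconverges circle_measure s (hardy_iso \<xi>)"
      unfolding L2.hconverges_def
    proof (intro conjI sc hardy_iso_closed[OF \<xi>c])
      show "(\<lambda>n. hnorm L2_circle (vdiff L2_circle (s n) (hardy_iso \<xi>))) \<longlonglongrightarrow> 0"
        using ell2.hconvergesD(3)[OF \<xi>]
        by (simp only: x(2) hardy_iso_vdiff[OF x(1) \<xi>c, symmetric] hardy_iso_hnorm[OF ell2.vdiff_closed[OF x(1) \<xi>c]])
    qed
    then have "v = hardy_iso \<xi>" by (rule L2.hconverges_unique[OF hv])
    then show "v \<in> ?R" using \<xi>c by blast
  qed
qed

lemma partial_sum_in_subspace:
  assumes W: "closed_subspace L2_circle W" "range (\<lambda>n. circle_class (\<lambda>z. z ^ n)) \<subseteq> W"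
  shows "partial_sum \<xi> N \<in> W"
proof (induction N)
  case 0
  have "trig (partial \<xi> 0) = (\<lambda>z. 0)" by (rule ext, unfold trig_partial) simp
  then show ?case using W(1) by (simp add: closed_subspace_def L2_zero)
next
  case (Suc N)
  have p: "(\<lambda>z. z ^ N) \<in> L2_fun circle_measure" by (intro continuous_circle_L2 continuous_intros)
  have ivl: "{0..<int (Suc N)} = insert (int N) {0..<int N}" by auto
  have "trig (partial \<xi> (Suc N)) = (\<lambda>z. \<xi> (int N) * z ^ N + trig (partial \<xi> N) z)"
  proof (rule ext)
    fix z
    have "trig (partial \<xi> (Suc N)) z = (\<Sum>x\<in>{0..<int (Suc N)}. \<xi> x * z powi x)" by (rule trig_partial)
    also have "\<dots> = \<xi> (int N) * z ^ N + trig (partial \<xi> N) z"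
      unfolding ivl trig_partial by (simp add: power_int_of_nat)
    finally show "trig (partial \<xi> (Suc N)) z = \<xi> (int N) * z ^ N + trig (partial \<xi> N) z" .
  qed
  then have "partial_sum \<xi> (Suc N) = vadd L2_circle (vscale L2_circle (\<xi> (int N)) (circle_class (\<lambda>z. z ^ N))) (partial_sum \<xi> N)"
    unfolding L2_scale[OF p] L2_add[OF L2_fun_scale[OF p] trig_L2] by (simp only:)
  moreover have "circle_class (\<lambda>z. z ^ N) \<in> W" using W(2) by blast
  ultimately show ?case using W(1) Suc by (simp add: closed_subspace_def)
qed

text \<open>The range is a closed subspace containing the monomials. Conversely every such subspace
  contains the partial sums and therefore their limits.\<close>

lemma hardy_carrier: "carrier hardy_space = hardy_iso ` carrier (ell2 \<nat>)"
proof -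
  have "closed_span L2_circle (range (\<lambda>n. circle_class (\<lambda>z. z ^ n))) = hardy_iso ` carrier (ell2 \<nat>)"
    unfolding closed_span_def
  proof (rule hull_unique)
    show "range (\<lambda>n. circle_class (\<lambda>z. z ^ n)) \<subseteq> hardy_iso ` carrier (ell2 \<nat>)"
    proof
      fix u assume "u \<in> range (\<lambda>n. circle_class (\<lambda>z. z ^ n))"
      then obtain n where "u = hardy_iso (ell2_delta (int n))" using hardy_iso_delta by auto
      then show "u \<in> hardy_iso ` carrier (ell2 \<nat>)" using ell2_delta_in_carrier[of "int n" "\<nat>"] by simp
    qed
    show "closed_subspace L2_circle (hardy_iso ` carrier (ell2 \<nat>))" by (rule closed_subspace_hardy_iso)
    fix W assume W: "range (\<lambda>n. circle_class (\<lambda>z. z ^ n)) \<subseteq> W" "closed_subspace L2_circle W"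
    show "hardy_iso ` carrier (ell2 \<nat>) \<subseteq> W"
    proof safe
      fix \<xi> assume \<xi>: "\<xi> \<in> carrier (ell2 \<nat>)"
      note c = hardy_iso_converges[OF \<xi>]
      show "hardy_iso \<xi> \<in> W"
        by (rule L2.closedin_htopologyD[OF _ partial_sum_in_subspace[OF W(2,1)]
              L2.hconvergesD(2)[OF c] L2.hconvergesD(3)[OF c]])
          (use W(2) in \<open>simp add: closed_subspace_def\<close>)
    qed
  qed
  then show ?thesis by (simp add: hardy_space_def)
qed

lemma hardy_eq: "hardy_space = L2_circle\<lparr>carrier := hardy_iso ` carrier (ell2 \<nat>)\<rparr>"
  using hardy_carrier by (simp add: hardy_space_def)

lemma hardy_simps:
  "vzero hardy_space = vzero L2_circle" "vadd hardy_space = vadd L2_circle"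
  "vscale hardy_space = vscale L2_circle" "cinner hardy_space = cinner L2_circle"
  by (simp_all add: hardy_space_def)

lemma unitary_hardy: "unitary (ell2 \<nat>) hardy_space hardy_iso"
proof (intro unitary.intro prehilbert_ell2 unitary_axioms.intro)
  show "prehilbert hardy_space"
    unfolding hardy_eq by (rule L2.prehilbert_subspace[OF closed_subspace_hardy_iso])
  show "bij_betw hardy_iso (carrier (ell2 \<nat>)) (carrier hardy_space)"
    unfolding bij_betw_def
  proof (intro conjI inj_onI hardy_carrier[symmetric])
    fix \<xi> \<eta> assume *: "\<xi> \<in> carrier (ell2 \<nat>)" "\<eta> \<in> carrier (ell2 \<nat>)" "hardy_iso \<xi> = hardy_iso \<eta>"
    have "hdist (ell2 \<nat>) \<xi> \<eta> = 0"
      using hardy_iso_hdist[OF *(1,2)] *(3) L2.hmetric.mdist_zero[OF hardy_iso_closed[OF *(2)]] by simp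
    then show "\<xi> = \<eta>" using ell2.hmetric.zero[OF *(1,2)] by blast
  qed
qed (simp_all only: hardy_simps hardy_iso_add hardy_iso_scale hardy_iso_cinner)

interpretation hardy: unitary_hilbert "ell2 \<nat>" hardy_space hardy_iso
  by (intro unitary_hilbert.intro unitary_hardy ell2.hilbert_axioms)

text \<open>Multiplication by \<open>z\<close> preserves the norm because \<open>z\<close> has
  modulus 1, so it commutes with the limit of the partial sums; on these it shifts the
  coefficients.\<close>

lemma mult_z_hardy:
  assumes \<xi>: "\<xi> \<in> carrier (ell2 \<nat>)"
  shows "mult_op (\<lambda>z. z) (hardy_iso \<xi>) = hardy_iso (translation_op \<nat> 1 \<xi>)"
proof -
  have t: "translation_op \<nat> 1 \<xi> \<in> carrier (ell2 \<nat>)" by (rule translation_op_bounded[OF \<xi>])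
  define f where "f = L2_rep (hardy_iso \<xi>)"
  have f: "f \<in> L2_fun circle_measure" "circle_class f = hardy_iso \<xi>"
    unfolding f_def by (rule L2_rep[OF hardy_iso_closed[OF \<xi>]])+
  have zL: "(\<lambda>z. z * g z) \<in> L2_fun circle_measure"
    and zn: "hnorm L2_circle (circle_class (\<lambda>z. z * g z)) = hnorm L2_circle (circle_class g)"
    if g: "g \<in> L2_fun circle_measure" for g
  proof -
    have "(\<lambda>z. z) \<in> borel_measurable circle_measure"
      by (intro continuous_circle_measurable continuous_intros)
    then have m: "(\<lambda>z. z * g z) \<in> borel_measurable circle_measure"
      using L2_funD(1)[OF g] by (rule borel_measurable_times)
    have eq: "(cmod (z * g z))\<^sup>2 = (cmod (g z))\<^sup>2" if "z \<in> space circle_measure" for z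
      using that by (simp add: norm_mult)
    have "integrable circle_measure (\<lambda>z. (cmod (z * g z))\<^sup>2) \<longleftrightarrow>
        integrable circle_measure (\<lambda>z. (cmod (g z))\<^sup>2)"
      by (rule Bochner_Integration.integrable_cong[OF refl eq])
    then show zL: "(\<lambda>z. z * g z) \<in> L2_fun circle_measure" 
      using m L2_funD(2)[OF g] by (simp add: L2_fun_def)
    have "(hnorm L2_circle (circle_class (\<lambda>z. z * g z)))\<^sup>2 = (hnorm L2_circle (circle_class g))\<^sup>2"
      unfolding L2_hnorm_sq[OF zL] L2_hnorm_sq[OF g]
      by (rule Bochner_Integration.integral_cong[OF refl eq])
    then show "hnorm L2_circle (circle_class (\<lambda>z. z * g z)) = hnorm L2_circle (circle_class g)"
      by (simp add: L2_class_in_carrier zL g power2_eq_iff_nonneg)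
  qed
  \<comment> \<open>The shifted sum has one more index, hence \<open>Suc N\<close>; its coefficient
    at 0 vanishes.\<close>
  have shift: "partial_sum (translation_op \<nat> 1 \<xi>) (Suc N) = circle_class (\<lambda>z. z * trig (partial \<xi> N) z)" for N
  proof (rule L2_class_cong, rule AE_I2)
    fix z assume "z \<in> space circle_measure"
    then have z: "z \<noteq> 0" by auto
    have "(\<Sum>x\<in>{0..<int (Suc N)}. translation_op \<nat> 1 \<xi> x * z powi x) =
        (\<Sum>x\<in>{1..<int (Suc N)}. \<xi> (x - 1) * z powi x)"
      by (rule sum.mono_neutral_cong_right)
        (auto simp: translation_op_apply[OF \<xi>] ell2_outside[OF \<xi>] Nats_int_iff)
    also have "\<dots> = (\<Sum>x\<in>{0..<int N}. \<xi> x * z powi (x + 1))"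
      by (rule sum.reindex_bij_witness[of _ "\<lambda>x. x + 1" "\<lambda>x. x - 1"]) auto
    also have "\<dots> = z * (\<Sum>x\<in>{0..<int N}. \<xi> x * z powi x)"
      using z by (simp add: power_int_add sum_distrib_left mult_ac)
    finally show "trig (partial (translation_op \<nat> 1 \<xi>) (Suc N)) z = z * trig (partial \<xi> N) z"
      by (simp only: trig_partial)
  qed
  have "L2.hconverges circle_measure (\<lambda>N. partial_sum (translation_op \<nat> 1 \<xi>) (Suc N)) (circle_class (\<lambda>z. z * f z))"
    unfolding L2.hconverges_def shift
  proof (intro conjI allI L2_class_in_carrier zL trig_L2 f)
    have "vdiff L2_circle (circle_class (\<lambda>z. z * trig (partial \<xi> N) z)) (circle_class (\<lambda>z. z * f z)) =
        circle_class (\<lambda>z. z * (trig (partial \<xi> N) z - f z))" for N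
      unfolding L2_vdiff[OF zL[OF trig_L2] zL[OF f(1)]] by (simp add: right_diff_distrib)
    then have "hnorm L2_circle (vdiff L2_circle (circle_class (\<lambda>z. z * trig (partial \<xi> N) z)) (circle_class (\<lambda>z. z * f z))) =
        hnorm L2_circle (vdiff L2_circle (partial_sum \<xi> N) (hardy_iso \<xi>))" for N
      unfolding f(2)[symmetric] L2_vdiff[OF trig_L2 f(1)] using zn[OF L2_fun_diff[OF trig_L2 f(1)]] by simp
    then show "(\<lambda>N. hnorm L2_circle (vdiff L2_circle (circle_class (\<lambda>z. z * trig (partial \<xi> N) z)) (circle_class (\<lambda>z. z * f z)))) \<longlonglongrightarrow> 0"
      using L2.hconvergesD(3)[OF hardy_iso_converges[OF \<xi>]] by (simp only:)
  qed
  moreover have "L2.hconverges circle_measure (\<lambda>N. partial_sum (translation_op \<nat> 1 \<xi>) (Suc N)) (hardy_iso (translation_op \<nat> 1 \<xi>))"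
    by (rule L2.hconverges_Suc[OF hardy_iso_converges[OF t]])
  ultimately show ?thesis
    unfolding mult_op_def f_def[symmetric] by (rule L2.hconverges_unique)
qed

text \<open>The Hardy space is invariant under multiplication by \<open>z\<close>, so the projection
  acts as the identity on the product. Its value is unique because a vector of the Hardy space that
  is orthogonal to this space is zero.\<close>

lemma toeplitz_z: "toeplitz_op (\<lambda>z. z) = hardy.Ad (translation_op \<nat> 1)"
proof (rule extensionalityI[where A = "carrier hardy_space"])
  show "toeplitz_op (\<lambda>z. z) \<in> extensional (carrier hardy_space)"
    unfolding toeplitz_op_def by (rule restrict_extensional)
  show "hardy.Ad (translation_op \<nat> 1) \<in> extensional (carrier hardy_space)"
    unfolding hardy.Ad_def by (rule restrict_extensional)
  fix u assume u: "u \<in> carrier hardy_space"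
  then obtain \<xi> where \<xi>: "\<xi> \<in> carrier (ell2 \<nat>)" "u = hardy_iso \<xi>" by (auto simp: hardy_carrier)
  define w where "w = hardy_iso (translation_op \<nat> 1 \<xi>)"
  have w: "w \<in> carrier hardy_space"
    using translation_op_bounded(1)[OF \<xi>(1)] by (simp add: w_def hardy_carrier)
  have sub: "carrier hardy_space \<subseteq> carrier L2_circle"
    using hardy_iso_closed by (auto simp: hardy_carrier)
  have hclosed: "vdiff L2_circle w v \<in> carrier hardy_space" if "v \<in> carrier hardy_space" for v
    using hardy.K.vdiff_closed[OF w that] by (simp add: vdiff_def hardy_simps)
  have "orth_proj L2_circle (carrier hardy_space) w = w"
    unfolding orth_proj_def
  proof (rule the_equality)
    show "w \<in> carrier hardy_space \<and> (\<forall>x\<in>carrier hardy_space. cinner L2_circle (vdiff L2_circle w w) x = 0)"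
      using w sub by (auto simp: subset_iff)
    fix v assume v: "v \<in> carrier hardy_space \<and> (\<forall>x\<in>carrier hardy_space. cinner L2_circle (vdiff L2_circle w v) x = 0)"
    then have "cinner L2_circle (vdiff L2_circle w v) (vdiff L2_circle w v) = 0" using hclosed by blast
    then have "w = v" using w v sub by (intro L2.eq_if_cinner_vdiff_0) auto
    then show "v = w" ..
  qed
  then show "toeplitz_op (\<lambda>z. z) u = hardy.Ad (translation_op \<nat> 1) u"
    using u \<xi> by (simp add: toeplitz_op_def mult_z_hardy hardy.Ad_U flip: w_def)
qed

section \<open>Identification with the Toeplitz extension\<close>

lemma star_hom_compose:
  assumes "f \<in> star_hom A B" "g \<in> star_hom B C"
  shows "(\<lambda>x. g (f x)) \<in> star_hom A C"
  using assms by (auto simp: star_hom_def Pi_iff)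

lemma star_iso_inv:
  assumes f: "f \<in> star_iso A B" and A: "star_subalgebra A (carrier A)"
  shows "inv_into (carrier A) f \<in> star_hom B A"
proof -
  let ?g = "inv_into (carrier A) f"
  have hom: "f \<in> star_hom A B" and bij: "bij_betw f (carrier A) (carrier B)"
    using f by (auto simp: star_iso_def)
  have g: "?g y \<in> carrier A" "f (?g y) = y" if "y \<in> carrier B" for y
    using that bij by (auto simp: bij_betw_def inv_into_into f_inv_into_f)
  have gf: "?g (f x) = x" if "x \<in> carrier A" for x
    using that bij by (auto simp: bij_betw_def)
  have h: "f (aadd A x y) = aadd B (f x) (f y)" "f (amult A x y) = amult B (f x) (f y)"
    "f (ascale A c x) = ascale B c (f x)" "f (astar A x) = astar B (f x)"
    if "x \<in> carrier A" "y \<in> carrier A" for x y c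
    using hom that by (auto simp: star_hom_def)
  have c: "aadd A x y \<in> carrier A" "amult A x y \<in> carrier A" "ascale A c x \<in> carrier A" "astar A x \<in> carrier A"
    if "x \<in> carrier A" "y \<in> carrier A" for x y c
    using A that by (auto simp: star_subalgebra_def)
  have "?g (aadd B x y) = aadd A (?g x) (?g y)" "?g (amult B x y) = amult A (?g x) (?g y)"
    "?g (ascale B k x) = ascale A k (?g x)" "?g (astar B x) = astar A (?g x)"
    if xy: "x \<in> carrier B" "y \<in> carrier B" for x y k
    using gf[OF c(1)[OF g(1)[OF xy(1)] g(1)[OF xy(2)]]] gf[OF c(2)[OF g(1)[OF xy(1)] g(1)[OF xy(2)]]]
      gf[OF c(3)[OF g(1)[OF xy(1)] g(1)[OF xy(2)]]] gf[OF c(4)[OF g(1)[OF xy(1)] g(1)[OF xy(2)]]]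
    by (simp_all only: h[OF g(1)[OF xy(1)] g(1)[OF xy(2)]] g(2)[OF xy(1)] g(2)[OF xy(2)])
  then show ?thesis using g(1) by (auto simp: star_hom_def)
qed

text \<open>Powers of the shift give the positive translations and powers of its adjoint the
  negative ones; since the shift is an isometry, its adjoint times it gives translation by
  0.\<close>

lemma translation_Nats_generated:
  assumes B: "star_subalgebra AN B" and 1: "translation_op \<nat> 1 \<in> B"
  shows "range (translation_op \<nat>) \<subseteq> B"
proof -
  have m: "amult AN S T \<in> B" if "S \<in> B" "T \<in> B" for S T using B that by (simp only: star_subalgebra_def)
  \<comment> \<open>On \<open>\<nat>\<close> a composite loses points only if the first step goes
    down and the second goes up; the condition excludes \<open>l < 0\<close> together with
    \<open>k > 0\<close>.\<close>
  have comp: "amult AN (translation_op \<nat> k) (translation_op \<nat> l) = translation_op \<nat> (k + l)"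
    if "l \<ge> 0 \<or> k \<le> 0" for k l
  proof (rule ell2.op_eqI[where X = "\<nat>"])
    fix \<xi> assume \<xi>: "\<xi> \<in> carrier (ell2 \<nat>)"
    show "amult AN (translation_op \<nat> k) (translation_op \<nat> l) \<xi> = translation_op \<nat> (k + l) \<xi>"
      unfolding op_apply[OF \<xi>] translation_op_apply[OF \<xi>]
        translation_op_apply[OF translation_op_bounded(1)[OF \<xi>], unfolded translation_op_apply[OF \<xi>]]
      using that ell2_outside[OF \<xi>] by (auto simp: fun_eq_iff Nats_int_iff algebra_simps)
  qed (intro ops_closed translation_op_in_bounded_ops)+
  have "astar AN (translation_op \<nat> 1) \<in> B" using B 1 by (simp only: star_subalgebra_def)
  then have m1: "translation_op \<nat> (- 1) \<in> B" by (simp only: ell2.op_algebra_simps adjoint_translation_op)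
  have 0: "translation_op \<nat> 0 \<in> B"
  proof -
    have "amult AN (translation_op \<nat> (- 1)) (translation_op \<nat> 1) = translation_op \<nat> 0"
      by (subst comp) (simp_all add: algebra_simps)
    then show ?thesis using m[OF m1 1] by (simp only:)
  qed
  have pos: "translation_op \<nat> (int n) \<in> B" for n
  proof (induction n)
    case (Suc n)
    have "amult AN (translation_op \<nat> 1) (translation_op \<nat> (int n)) = translation_op \<nat> (int (Suc n))"
      by (subst comp) (simp_all add: algebra_simps)
    then show ?case using m[OF 1 Suc] by (simp only:)
  qed (use 0 in simp)
  have neg: "translation_op \<nat> (- int n) \<in> B" for n
  proof (induction n)
    case (Suc n)
    have "amult AN (translation_op \<nat> (- int n)) (translation_op \<nat> (- 1)) = translation_op \<nat> (- int (Suc n))"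
      by (subst comp) (simp_all add: algebra_simps)
    then show ?case using m[OF Suc m1] by (simp only:)
  qed (use 0 in simp)
  show ?thesis using pos neg by (auto, metis int_cases2)
qed

lemma
  shows PTN_subalgebra: "star_subalgebra AN PTN"
    and PTN_translation: "translation_op \<nat> n \<in> PTN"
    and PTN_minimal: "\<lbrakk>star_subalgebra AN B; closedin (op_topology (ell2 \<nat>)) B;
      translation_op \<nat> 1 \<in> B\<rbrakk> \<Longrightarrow> PTN \<subseteq> B"
proof -
  let ?P = "\<lambda>B. star_subalgebra AN B \<and> closedin (op_topology (ell2 \<nat>)) B"
  have hull: "?P hull range (translation_op \<nat>) = PTN"
    using arg_cong[OF partial_translation_algebra_Nats, of carrier]
    by (simp add: partial_translation_algebra_def generated_cstar_algebra_def)
  show "star_subalgebra AN PTN" using TA.star_subalgebra_dom by simp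
  show "translation_op \<nat> n \<in> PTN" using hull_subset[of "range (translation_op \<nat>)" ?P] hull by blast
  show "PTN \<subseteq> B" if "star_subalgebra AN B" "closedin (op_topology (ell2 \<nat>)) B" "translation_op \<nat> 1 \<in> B"
    using hull_minimal[of "range (translation_op \<nat>)" B ?P] translation_Nats_generated that hull by blast
qed

lemma PTN_bounded: "PTN \<subseteq> bounded_ops (ell2 \<nat>)"
  using PTN_subalgebra by (simp add: star_subalgebra_def)

lemma toeplitz_algebra_eq: "toeplitz_algebra = op_algebra hardy_space\<lparr>carrier := hardy.Ad ` PTN\<rparr>"
proof -
  have "generated_cstar_algebra hardy_space (hardy.Ad ` {translation_op \<nat> 1}) =
      op_algebra hardy_space\<lparr>carrier := hardy.Ad ` PTN\<rparr>"
    by (rule hardy.hull_Ad[OF PTN_subalgebra closedin_closure_of])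
      (use PTN_translation PTN_minimal in auto)
  then show ?thesis by (simp add: toeplitz_algebra_def toeplitz_z)
qed

lemma Ad_toeplitz_iso: "hardy.Ad \<in> star_iso (partial_translation_algebra \<nat>) toeplitz_algebra"
  unfolding partial_translation_algebra_Nats toeplitz_algebra_eq by (rule hardy.Ad_star_iso[OF PTN_bounded])

lemma Ad_compact_iso: "hardy.Ad \<in> star_iso (compact_algebra (ell2 \<nat>)) (compact_algebra hardy_space)"
  unfolding compact_algebra_def hardy.Ad_compact_ops[symmetric]
  by (rule hardy.Ad_star_iso) (auto simp: compact_ops_def)

text \<open>The quotient map is defined by transport, which makes the right-hand square commute.
  What is left is to recognise it as the quotient map of the Toeplitz extension.\<close>

definition sigma where
  "sigma S = gamma (phi (inv_into (carrier (partial_translation_algebra \<nat>)) hardy.Ad S))"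

lemma sigma_Ad: "a \<in> carrier (partial_translation_algebra \<nat>) \<Longrightarrow> sigma (hardy.Ad a) = gamma (phi a)"
  using Ad_toeplitz_iso by (simp add: sigma_def star_iso_def bij_betw_def)

lemma toeplitz_quotient_sigma: "toeplitz_quotient_map sigma"
proof -
  let ?N = "partial_translation_algebra \<nat>" and ?Z = "partial_translation_algebra UNIV"
  have bijAd: "bij_betw hardy.Ad (carrier ?N) (carrier toeplitz_algebra)"
    using Ad_toeplitz_iso by (auto simp: star_iso_def)
  have "star_subalgebra ?N (carrier ?N)"
    using PTN_subalgebra unfolding partial_translation_algebra_Nats star_subalgebra_def
    by (simp del: ell2.op_algebra_simps)
  from star_hom_compose[OF star_hom_compose[OF star_iso_inv[OF Ad_toeplitz_iso this] phi_star_hom]]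
  have hom: "sigma \<in> star_hom toeplitz_algebra CC"
    unfolding sigma_def[abs_def] using gamma_star_iso by (auto simp: star_iso_def)
  have toep: "carrier toeplitz_algebra = hardy.Ad ` carrier ?N"
    using bijAd by (simp add: bij_betw_def)
  have surj: "sigma ` carrier toeplitz_algebra = carrier CC"
  proof -
    have "sigma ` carrier toeplitz_algebra = gamma ` phi ` carrier ?N"
      unfolding toep image_image by (rule image_cong) (simp_all add: sigma_Ad)
    also have "\<dots> = carrier CC"
      unfolding phi_surj using gamma_star_iso by (simp add: star_iso_def bij_betw_def)
    finally show ?thesis .
  qed
  have g0: "gamma (azero ?Z) = azero CC"
    using Af.lift_eq[OF Af.Gbar_zero] unfolding gamma_def partial_translation_algebra_UNIV
    by (simp del: ell2.op_algebra_simps)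
  have z0: "azero ?Z \<in> carrier ?Z"
    using Af.Gbar_in_Dom[OF Af.Gbar_zero] unfolding partial_translation_algebra_UNIV
    by (simp del: ell2.op_algebra_simps)
  \<comment> \<open>\<open>gamma\<close> is injective, so the kernel is that of \<open>phi\<close>,
    carried over by conjugation.\<close>
  have iff: "sigma (hardy.Ad a) = azero CC \<longleftrightarrow> a \<in> compact_ops (ell2 \<nat>)" if a: "a \<in> carrier ?N" for a
  proof -
    have pa: "phi a \<in> carrier ?Z" using phi_surj a by blast
    have "gamma (phi a) = azero CC \<longleftrightarrow> phi a = azero ?Z"
      using gamma_star_iso inj_on_eq_iff[OF _ pa z0, of gamma] g0 by (simp add: star_iso_def bij_betw_def)
    then show ?thesis
      unfolding sigma_Ad[OF a] using phi_kernel a by (auto simp: star_kernel_def)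
  qed
  have KN: "compact_ops (ell2 \<nat>) \<subseteq> carrier ?N" using phi_kernel by (auto simp: star_kernel_def)
  have ker: "star_kernel toeplitz_algebra CC sigma = compact_ops hardy_space"
    unfolding star_kernel_def toep hardy.Ad_compact_ops[symmetric] using iff KN by blast
  have "compact_ops hardy_space \<subseteq> carrier toeplitz_algebra" using ker by (auto simp: star_kernel_def)
  then have "(\<lambda>k. k) \<in> star_hom (compact_algebra hardy_space) toeplitz_algebra"
    by (auto simp: star_hom_def compact_algebra_def toeplitz_algebra_eq)
  moreover have "carrier (compact_algebra hardy_space) = compact_ops hardy_space"
    by (simp add: compact_algebra_def)
  ultimately have ext: "star_extension (compact_algebra hardy_space) (\<lambda>k. k) toeplitz_algebra sigma CC"
    unfolding star_extension_def using hom surj ker by simp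
  have "translation_op \<nat> 1 \<in> carrier ?N"
    using PTN_translation by (simp add: partial_translation_algebra_Nats)
  then have "sigma (toeplitz_op (\<lambda>z. z)) = monomial 1"
    by (simp only: toeplitz_z sigma_Ad phi_translation gamma_translation)
  also have "monomial 1 = (\<lambda>z\<in>unit_circle. z)" by (rule restrict_ext) simp
  finally show ?thesis using ext by (simp only: toeplitz_quotient_map_def simp_thms)
qed

theorem theorem1:
  shows "star_iso (partial_translation_algebra \<nat>) toeplitz_algebra \<noteq> {} \<and>
    (\<exists>\<phi>. \<phi> \<in> star_hom (partial_translation_algebra \<nat>) reduced_group_algebra_int \<and>
       \<phi> ` carrier (partial_translation_algebra \<nat>) = carrier reduced_group_algebra_int \<and>
       (\<forall>n. \<phi> (translation_op \<nat> n) = translation_op UNIV n) \<and>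
       star_kernel (partial_translation_algebra \<nat>) reduced_group_algebra_int \<phi>
         = compact_ops (ell2 \<nat>) \<and>
       star_extension (compact_algebra (ell2 \<nat>)) (\<lambda>k. k) (partial_translation_algebra \<nat>)
         \<phi> reduced_group_algebra_int \<and>
       (\<exists>\<sigma> \<alpha> \<beta> \<gamma>. toeplitz_quotient_map \<sigma> \<and>
          \<alpha> \<in> star_iso (compact_algebra (ell2 \<nat>)) (compact_algebra hardy_space) \<and>
          \<beta> \<in> star_iso (partial_translation_algebra \<nat>) toeplitz_algebra \<and>
          \<gamma> \<in> star_iso reduced_group_algebra_int continuous_circle_algebra \<and>
          (\<forall>k\<in>carrier (compact_algebra (ell2 \<nat>)). \<beta> k = \<alpha> k) \<and>
          (\<forall>a\<in>carrier (partial_translation_algebra \<nat>). \<gamma> (\<phi> a) = \<sigma> (\<beta> a))))"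
\<comment> \<open>One conjugation serves both for the compact operators and for the full algebras,
  so the left-hand square commutes trivially.\<close>
proof (intro conjI exI[of _ phi] exI[of _ sigma] exI[of _ hardy.Ad] exI[of _ gamma] allI ballI)
  show "star_iso (partial_translation_algebra \<nat>) toeplitz_algebra \<noteq> {}"
    using Ad_toeplitz_iso by blast
qed (simp_all only: phi_star_hom phi_surj phi_translation phi_kernel phi_extension
    toeplitz_quotient_sigma Ad_compact_iso Ad_toeplitz_iso gamma_star_iso sigma_Ad)

end
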